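(* Let $\Phi=\mathbf{E}_\varphi+\psi:\mathbb{R}^d\to\mathbb{R}\cup\{+\infty\}$, where: $\psi:\mathbb{R}^d\to\mathbb{R}\cup\{+\infty\}$ is proper, lower semicontinuous and prox-bounded; $\varphi:\Xi\times\mathbb{R}^d\to\mathbb{R}$ is an upper-$C^2$ normal integrand; and $\xi\mapsto\inf_{x\in\mathbb{R}^d}(\varphi(\xi,x)+\psi(x))$ is integrable. Let $\mathcal{S}$ be the set of stationary points of $\Phi$ and suppose that $\varphi$ is $C^{1,1}$ around $\mathcal{S}$. Let $\beta\in(0,1)$ and let the sample sizes satisfy $$n_k^{-1}=\mathcal{O}(k^{-\varrho}),\qquad\text{where }\varrho\in\Big(\frac{2+2\beta}{\beta},+\infty\Big),$$ together with $\sum_{k=1}^\infty\frac{\ln(n_k)}{\sqrt{n_k}}<+\infty$. Let $(x^k)_{k\in\mathbb{N}}$ be the sequence generated by the PSS algorithm from $x^0\in\operatorname{dom}\Phi$, under the sampling and filtration assumptions (all described in the context). Then there exists a measurable set $\hat\Omega\subseteq\Omega$ with $\mathbb{P}(\Omega\setminus\hat\Omega)=0$ such that, for every $\omega\in\hat\Omega$ the following holds. Suppose $(x^k)_{k\in\mathbb{N}}=(x^k(\omega))_{k\in\mathbb{N}}$ is bounded and has an accumulation point $\bar x$ at which the Kurdyka–Łojasiewicz condition for $\Phi$ holds with desingularizing function $\theta(t)=Mt^{1-\beta}$ for some $M>0$, and that for some $p_0\in\mathbb{N}$ one has $\sum_{k=p_0}^\infty\big(\theta'\big(\sum_{t=k}^\infty\frac{\ln(n_t)}{\sqrt{n_t}}\big)\big)^{-1}<+\infty$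 and $\Phi(x^k)>\Phi(\bar x)$ for all $k\ge p_0$ (so that $\bar x$ is the limit of $(x^k)_{k\in\mathbb{N}}$). Then the following convergence rates hold. (i) If $\beta\in(0,\frac12]$, then $$\Phi(x^k)-\Phi(\bar x)=\mathcal{O}\Big(\frac{\ln(k)}{k^{\varrho/2-1}}\Big)\quad\text{and}\quad\|x^k-\bar x\|=\mathcal{O}\Big(\frac{\ln(k)}{k^{\frac12(\varrho/2-1)-1}}\Big).$$ (ii) If $\beta\in(\frac12,1)$, then $$\Phi(x^k)-\Phi(\bar x)=\begin{cases}\mathcal{O}\big(k^{-2\beta(\varrho/2-1)+1}\ln(k)\big),&\text{if }\frac{2+2\beta}{\beta}<\varrho\le\frac{4\beta}{2\beta-1},\\[2pt]\mathcal{O}\big(k^{-2\beta/(2\beta-1)+1}\ln(k)\big),&\text{if }\varrho>\frac{4\beta}{2\beta-1},\end{cases}$$ and $$\|x^k-\bar x\|=\begin{cases}\mathcal{O}\big(k^{-\beta(\varrho/2-1)+1}\ln(k)\big),&\text{if }\frac{2+2\beta}{\beta}<\varrho\le\frac{4\beta}{2\beta-1},\\[2pt]\mathcal{O}\big(k^{-(1-\beta)/(2\beta-1)}\ln^{1-\beta}(k)\big),&\text{if }\varrho>\frac{4\beta}{2\beta-1}.\end{cases}$$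
   Context: $\mathbb{N}=\{0,1,2,\dots\}$. $\mathbb{B}_r(x)$, $\mathbb{B}_r[x]$ are open, closed balls. $\mathcal{O}$ is as $k\to\infty$ (constants may depend on $\omega$), and $\ln^p(k)=(\ln k)^p$. $(\Xi,\mathcal{A},\mu)$ is a probability space, $L^p_\mu$ is the space of $p$-integrable functions on it, and $\varphi_\xi(x):=\varphi(\xi,x)$. Normal integrand: $\varphi:\Xi\times\mathbb{R}^d\to\mathbb{R}\cup\{+\infty\}$ is a normal integrand if $\xi\mapsto\operatorname{epi}\varphi_\xi$ is a measurable multifunction with closed values (a multifunction $M$ is measurable if $\{t: M(t)\cap U\ne\emptyset\}\in\mathcal{A}$ for all open $U$). It is locally Lipschitz around $\bar x$ with square integrable modulus if $\varphi(\cdot,\bar x)\in L^2_\mu$ and there are $\kappa\in L^2_\mu$ and a neighborhood $V$ of $\bar x$ with $|\varphi_\xi(y)-\varphi_\xi(z)|\le\kappa(\xi)\|y-z\|$ for all $y,z\in V$, $\xi\in\Xi$. It is upper-$C^2$ around $\bar x$ if it is locally Lipschitz around $\bar x$ with square integrable modulus and there exist a neighborhood $V$ of $\bar x$ and a nonnegative $\ell\in L^1_\mu$ such that for all $\xi\in\Xi$, $x\in V$, $v\in\partial\varphi_\xi(x)$: $\varphi_\xi(y)\le\varphi_\xi(x)+\langle v,y-x\rangle+\ell(\xi)\|y-x\|^2$ for all $y\in V$. It is an upper-$C^2$ normal integrand if it is upper-$C^2$ around every $\bar x\in\mathbb{R}^d$. $\partial$ denotes the Clarke subdifferential (for a lower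 semicontinuous extended-valued function such as $\Phi$: $v\in\partial f(x)$ iff $f(x)<+\infty$ and $(v,-1)$ lies in the Clarke normal cone of $\operatorname{epi}f$ at $(x,f(x))$). $C^{1,1}$: $\varphi$ is $C^{1,1}$ around $\bar x$ if there are $\kappa\in L^2_\mu$ and $\epsilon>0$ such that, for all $\xi\in\Xi$, $\varphi_\xi$ is differentiable on $\mathbb{B}_\epsilon[\bar x]$ and $\|\nabla_x\varphi(\xi,y)-\nabla_x\varphi(\xi,z)\|\le\kappa(\xi)\|y-z\|$ for all $y,z\in\mathbb{B}_\epsilon[\bar x]$, and $\nabla_x\varphi(\cdot,\bar x)\in L^2_\mu$. It is $C^{1,1}$ around a nonempty set if it is so around each of its points. Prox: $f$ is prox-bounded if $f+\frac{1}{2\gamma}\|\cdot\|^2$ is bounded below for some $\gamma>0$; the supremum of such $\gamma$ is the threshold $\gamma^f\in(0,+\infty]$. $\operatorname{prox}_{\gamma f}(x):=\operatorname{argmin}_{u\in\mathbb{R}^d}\{f(u)+\frac{1}{2\gamma}\|u-x\|^2\}$ (set-valued). Stationary point: $\bar x$ is a stationary point of $\Phi$ if there exist $\bar v\in\partial\mathbf{E}_\varphi(\bar x)$ and $\bar\gamma>0$ with $\bar x\in\operatorname{prox}_{\bar\gamma\psi}(\bar x-\bar\gamma\bar v)$. Kurdyka–Łojasiewicz (KL) condition for $\Phi$ at $\bar x$ with desingularizing function $\theta$: there exists $\eta>0$ such that $\theta:[0,\eta]\to[0,+\infty)$ is continuous and concave, $\theta(0)=0$, $\theta$ is continuously differentiable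 on $(0,\eta)$ with $\theta'>0$, and $\theta'(\Phi(x)-\Phi(\bar x))\,\operatorname{dist}(0;\partial\Phi(x))\ge1$ for all $x\in\mathbb{B}_\eta(\bar x)$ with $\Phi(\bar x)<\Phi(x)<\Phi(\bar x)+\eta$. (The summability condition involving $\theta'$ implicitly requires its arguments to lie in $(0,\eta)$.) Sampling: $(\Omega,\mathcal{F},\mathbb{P})$ is a probability space, $\xi_i:\Omega\to\Xi$ ($i\ge1$) are i.i.d. random variables with law $\mu$, and $(n_k)_{k\in\mathbb{N}}$ is a nondecreasing sequence of positive integers with $n_k\to+\infty$. Set $\mathbf{E}_\varphi(x):=\int_\Xi\varphi(\xi,x)\,d\mu(\xi)$, $\mathbf{E}^k_\varphi(x):=\frac1{n_k}\sum_{j=1}^{n_k}\varphi(\xi_j,x)$, $\Phi:=\mathbf{E}_\varphi+\psi$, $\Phi_k:=\mathbf{E}^k_\varphi+\psi$. PSS algorithm: parameters $x^0\in\operatorname{dom}\psi$, $\rho\in(0,1)$, $\sigma>0$, $\gamma_{\min}>0$. At iteration $k=0,1,2,\dots$: choose $v_i^k\in\partial\varphi_{\xi_i}(x^k)$, $i=1,\dots,n_k$, and set $v^k:=\frac1{n_k}\sum_{i=1}^{n_k}v_i^k$; take $\overline\gamma_k\in[\gamma_{\min},\gamma^\psi)$ and set $\gamma_k:=\overline\gamma_k$; compute $\hat x^k\in\operatorname{prox}_{\gamma_k\psi}(x^k-\gamma_kv^k)$; while $\Phi_k(\hat x^k)>\Phi_k(x^k)-\sigma\|\hat x^k-x^k\|^2$,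 replace $\gamma_k$ by $\rho\gamma_k$ and recompute $\hat x^k\in\operatorname{prox}_{\gamma_k\psi}(x^k-\gamma_kv^k)$; finally set $x^{k+1}:=\hat x^k$. Filtration: there is a filtration $(\mathcal{F}_k)_{k\in\mathbb{N}}$ of sub-$\sigma$-algebras of $\mathcal{F}$, representing all the information used by the algorithm up to iteration $k$ (in particular $x^{k+1}$, computed in iteration $k$, is $\mathcal{F}_k$-measurable), such that $\xi_j$ is $\mathcal{F}_k$-measurable for $j\le n_k$ and $\xi_j$ is independent of $\mathcal{F}_k$ for $j>n_k$. *)

theory Defs
  imports "HOL-Probability.Probability" "HOL-Probability.Stopping_Time"
    "HOL-Library.Landau_Symbols"
begin

section \<open>Variational analysis of extended-real-valued functions\<close>

text \<open>Functions into \<open>\<real> \<union> {+\<infinity>}\<close> are \<^typ>\<open>ereal\<close>-valued functions that omit \<open>-\<infinity>\<close>.\<close>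

definition ereal_epigraph :: "('a \<Rightarrow> ereal) \<Rightarrow> ('a \<times> real) set" where
  "ereal_epigraph f = {(x, t). f x \<le> ereal t}"

definition proper_fun :: "('a \<Rightarrow> ereal) \<Rightarrow> bool" where
  "proper_fun f \<longleftrightarrow> (\<forall>x. f x \<noteq> -\<infinity>) \<and> (\<exists>x. f x < \<infinity>)"

definition lower_semicontinuous :: "('a::topological_space \<Rightarrow> ereal) \<Rightarrow> bool" where
  "lower_semicontinuous f \<longleftrightarrow> (\<forall>x. f x \<le> Liminf (at x) f)"

definition clarke_tangent_cone :: "'b::real_normed_vector set \<Rightarrow> 'b \<Rightarrow> 'b set" where
  "clarke_tangent_cone C x = {w. \<forall>(X :: nat \<Rightarrow> 'b) (\<tau> :: nat \<Rightarrow> real).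
     (\<forall>n. X n \<in> C) \<and> X \<longlonglongrightarrow> x \<and> (\<forall>n. 0 < \<tau> n) \<and> \<tau> \<longlonglongrightarrow> 0 \<longrightarrow>
     (\<exists>W. W \<longlonglongrightarrow> w \<and> (\<forall>n. X n + \<tau> n *\<^sub>R W n \<in> C))}"

definition clarke_normal_cone :: "'b::real_inner set \<Rightarrow> 'b \<Rightarrow> 'b set" where
  "clarke_normal_cone C x = {v. \<forall>w\<in>clarke_tangent_cone C x. v \<bullet> w \<le> 0}"

definition clarke_subdifferential :: "('a::real_inner \<Rightarrow> ereal) \<Rightarrow> 'a \<Rightarrow> 'a set" where
  "clarke_subdifferential f x = {v. \<bar>f x\<bar> \<noteq> \<infinity> \<and>
     (v, -1) \<in> clarke_normal_cone (ereal_epigraph f) (x, real_of_ereal (f x))}"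

definition gradient :: "('a::real_inner \<Rightarrow> real) \<Rightarrow> 'a \<Rightarrow> 'a" where
  "gradient f x = (THE D. GDERIV f x :> D)"

definition moreau_bounded_below :: "real \<Rightarrow> ('a::real_normed_vector \<Rightarrow> ereal) \<Rightarrow> bool" where
  "moreau_bounded_below \<gamma> f \<longleftrightarrow>
     (\<exists>c::real. \<forall>x. ereal c \<le> f x + ereal (1 / (2 * \<gamma>) * (norm x)\<^sup>2))"

definition prox_bounded :: "('a::real_normed_vector \<Rightarrow> ereal) \<Rightarrow> bool" where
  "prox_bounded f \<longleftrightarrow> (\<exists>\<gamma>>0. moreau_bounded_below \<gamma> f)"

definition prox_threshold :: "('a::real_normed_vector \<Rightarrow> ereal) \<Rightarrow> ereal" where
  "prox_threshold f = Sup {ereal \<gamma> | \<gamma>. 0 < \<gamma> \<and> moreau_bounded_below \<gamma> f}"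

text \<open>\<open>prox \<gamma> f\<close> is the set-valued proximal mapping of \<open>\<gamma> f\<close>.\<close>

definition prox :: "real \<Rightarrow> ('a::real_normed_vector \<Rightarrow> ereal) \<Rightarrow> 'a \<Rightarrow> 'a set" where
  "prox \<gamma> f x = {u. is_arg_min (\<lambda>u. f u + ereal (1 / (2 * \<gamma>) * (norm (u - x))\<^sup>2)) (\<lambda>_. True) u}"

definition composite :: "('a \<Rightarrow> real) \<Rightarrow> ('a \<Rightarrow> ereal) \<Rightarrow> 'a \<Rightarrow> ereal" where
  "composite g \<psi> x = ereal (g x) + \<psi> x"

text \<open>Stationarity of \<open>g + \<psi>\<close> depends on the splitting, hence the two arguments.\<close>

definition stationary_points :: "('a::real_inner \<Rightarrow> real) \<Rightarrow> ('a \<Rightarrow> ereal) \<Rightarrow> 'a set" where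
  "stationary_points g \<psi> = {x. \<exists>v\<in>clarke_subdifferential (\<lambda>y. ereal (g y)) x. \<exists>\<gamma>>0.
     x \<in> prox \<gamma> \<psi> (x - \<gamma> *\<^sub>R v)}"

text \<open>
  The Kurdyka-Lojasiewicz condition at \<open>x0\<close> holds if it holds with some \<open>\<eta>\<close>; the radius is kept as
  a parameter so that other conditions can refer to the interval on which \<open>\<theta>\<close> is used.
  The distance from the origin is an infimum in \<^typ>\<open>ereal\<close>, so it is \<open>\<infinity>\<close> for an empty
  subdifferential (\<^const>\<open>infdist\<close> would give \<open>0\<close>).
\<close>

definition KL_condition ::
    "('a::real_inner \<Rightarrow> ereal) \<Rightarrow> 'a \<Rightarrow> (real \<Rightarrow> real) \<Rightarrow> real \<Rightarrow> bool" where
  "KL_condition f x0 \<theta> \<eta> \<longleftrightarrow> 0 < \<eta> \<and>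
     continuous_on {0..\<eta>} \<theta> \<and> concave_on {0..\<eta>} \<theta> \<and> (\<forall>t\<in>{0..\<eta>}. 0 \<le> \<theta> t) \<and> \<theta> 0 = 0 \<and>
     (\<forall>t\<in>{0<..<\<eta>}. \<theta> differentiable (at t) \<and> 0 < deriv \<theta> t) \<and>
     continuous_on {0<..<\<eta>} (deriv \<theta>) \<and>
     (\<forall>x\<in>ball x0 \<eta>. f x0 < f x \<and> f x < f x0 + ereal \<eta> \<longrightarrow>
        1 \<le> ereal (deriv \<theta> (real_of_ereal (f x - f x0))) *
             (INF v\<in>clarke_subdifferential f x. ereal (norm v)))"


section \<open>Integrands\<close>

definition square_integrable :: "'s measure \<Rightarrow> ('s \<Rightarrow> 'b::real_normed_vector) \<Rightarrow> bool" where
  "square_integrable M f \<longleftrightarrow> f \<in> borel_measurable M \<and> integrable M (\<lambda>s. (norm (f s))\<^sup>2)"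

definition ereal_integrable :: "'s measure \<Rightarrow> ('s \<Rightarrow> ereal) \<Rightarrow> bool" where
  "ereal_integrable M f \<longleftrightarrow> f \<in> borel_measurable M \<and> (\<integral>\<^sup>+ s. e2ennreal \<bar>f s\<bar> \<partial>M) < \<infinity>"

definition measurable_multifunction ::
    "'s measure \<Rightarrow> ('s \<Rightarrow> 'b::topological_space set) \<Rightarrow> bool" where
  "measurable_multifunction M S \<longleftrightarrow> (\<forall>U. open U \<longrightarrow> {s \<in> space M. S s \<inter> U \<noteq> {}} \<in> sets M)"

definition normal_integrand ::
    "'s measure \<Rightarrow> ('s \<Rightarrow> 'a::topological_space \<Rightarrow> ereal) \<Rightarrow> bool" where
  "normal_integrand M \<phi> \<longleftrightarrow>
     (\<forall>s\<in>space M. \<forall>x. \<phi> s x \<noteq> -\<infinity>) \<and>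
     measurable_multifunction M (\<lambda>s. ereal_epigraph (\<phi> s)) \<and>
     (\<forall>s\<in>space M. closed (ereal_epigraph (\<phi> s)))"

definition sq_lipschitz_around ::
    "'s measure \<Rightarrow> ('s \<Rightarrow> 'a::real_normed_vector \<Rightarrow> real) \<Rightarrow> 'a \<Rightarrow> bool" where
  "sq_lipschitz_around M \<phi> x0 \<longleftrightarrow>
     square_integrable M (\<lambda>s. \<phi> s x0) \<and>
     (\<exists>\<kappa> V. square_integrable M \<kappa> \<and> open V \<and> x0 \<in> V \<and>
        (\<forall>s\<in>space M. \<forall>y\<in>V. \<forall>z\<in>V. \<bar>\<phi> s y - \<phi> s z\<bar> \<le> \<kappa> s * norm (y - z)))"

definition upper_C2_around ::
    "'s measure \<Rightarrow> ('s \<Rightarrow> 'a::real_inner \<Rightarrow> real) \<Rightarrow> 'a \<Rightarrow> bool" where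
  "upper_C2_around M \<phi> x0 \<longleftrightarrow>
     sq_lipschitz_around M \<phi> x0 \<and>
     (\<exists>V L. open V \<and> x0 \<in> V \<and> integrable M L \<and> (\<forall>s\<in>space M. 0 \<le> L s) \<and>
        (\<forall>s\<in>space M. \<forall>x\<in>V. \<forall>v\<in>clarke_subdifferential (\<lambda>y. ereal (\<phi> s y)) x. \<forall>y\<in>V.
           \<phi> s y \<le> \<phi> s x + v \<bullet> (y - x) + L s * (norm (y - x))\<^sup>2))"

definition upper_C2_normal_integrand ::
    "'s measure \<Rightarrow> ('s \<Rightarrow> 'a::real_inner \<Rightarrow> real) \<Rightarrow> bool" where
  "upper_C2_normal_integrand M \<phi> \<longleftrightarrow>
     normal_integrand M (\<lambda>s x. ereal (\<phi> s x)) \<and> (\<forall>x. upper_C2_around M \<phi> x)"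

definition C11_around ::
    "'s measure \<Rightarrow> ('s \<Rightarrow> 'a::real_inner \<Rightarrow> real) \<Rightarrow> 'a \<Rightarrow> bool" where
  "C11_around M \<phi> x0 \<longleftrightarrow>
     (\<exists>\<kappa> \<epsilon>. square_integrable M \<kappa> \<and> 0 < \<epsilon> \<and>
        (\<forall>s\<in>space M. (\<forall>y\<in>cball x0 \<epsilon>. \<phi> s differentiable (at y)) \<and>
           (\<forall>y\<in>cball x0 \<epsilon>. \<forall>z\<in>cball x0 \<epsilon>.
              norm (gradient (\<phi> s) y - gradient (\<phi> s) z) \<le> \<kappa> s * norm (y - z)))) \<and>
     square_integrable M (\<lambda>s. gradient (\<phi> s) x0)"

definition C11_around_set ::
    "'s measure \<Rightarrow> ('s \<Rightarrow> 'a::real_inner \<Rightarrow> real) \<Rightarrow> 'a set \<Rightarrow> bool" where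
  "C11_around_set M \<phi> S \<longleftrightarrow> S \<noteq> {} \<and> (\<forall>x\<in>S. C11_around M \<phi> x)"

definition expected_fun :: "'s measure \<Rightarrow> ('s \<Rightarrow> 'a \<Rightarrow> real) \<Rightarrow> 'a \<Rightarrow> real" where
  "expected_fun M \<phi> x = (\<integral>s. \<phi> s x \<partial>M)"


section \<open>Sample averages and the PSS algorithm\<close>

text \<open>Samples are numbered from 1; the value at index 0 of a sample sequence is never used.\<close>

definition sample_average :: "('s \<Rightarrow> 'a \<Rightarrow> real) \<Rightarrow> (nat \<Rightarrow> 's) \<Rightarrow> nat \<Rightarrow> 'a \<Rightarrow> real" where
  "sample_average \<phi> s N x = 1 / real N * (\<Sum>j=1..N. \<phi> (s j) x)"

text \<open>
  One backtracking line search for the objective \<open>F\<close>, from \<open>x\<close> in the direction \<open>v\<close> with initial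
  step size \<open>g\<close>, returning \<open>x'\<close>: \<open>y j\<close> is the trial point for the step size \<open>\<rho> ^ j * g\<close> (any
  element of the proximal set), and \<open>m\<close> is the number of times the while loop is executed.
\<close>

definition PSS_linesearch :: "('a::real_normed_vector \<Rightarrow> ereal) \<Rightarrow> ('a \<Rightarrow> ereal) \<Rightarrow> real \<Rightarrow> real \<Rightarrow>
    real \<Rightarrow> 'a \<Rightarrow> 'a \<Rightarrow> 'a \<Rightarrow> bool" where
  "PSS_linesearch F \<psi> \<rho> \<sigma> g x v x' \<longleftrightarrow>
     (\<exists>(m::nat) y.
        (\<forall>j\<le>m. y j \<in> prox (\<rho> ^ j * g) \<psi> (x - (\<rho> ^ j * g) *\<^sub>R v)) \<and>
        (\<forall>j<m. F (y j) > F x - ereal (\<sigma> * (norm (y j - x))\<^sup>2)) \<and>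
        \<not> F (y m) > F x - ereal (\<sigma> * (norm (y m - x))\<^sup>2) \<and>
        x' = y m)"

text \<open>\<open>x\<close> is a sequence that the algorithm can generate from \<open>x0\<close> on the sample sequence \<open>s\<close>.\<close>

definition PSS_sequence :: "('s \<Rightarrow> 'a::real_inner \<Rightarrow> real) \<Rightarrow> ('a \<Rightarrow> ereal) \<Rightarrow> (nat \<Rightarrow> nat) \<Rightarrow>
    real \<Rightarrow> real \<Rightarrow> real \<Rightarrow> 'a \<Rightarrow> (nat \<Rightarrow> 's) \<Rightarrow> (nat \<Rightarrow> 'a) \<Rightarrow> bool" where
  "PSS_sequence \<phi> \<psi> n \<rho> \<sigma> \<gamma>min x0 s x \<longleftrightarrow>
     x 0 = x0 \<and>
     (\<forall>k. \<exists>v g.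
        (\<forall>i\<in>{1..n k}. v i \<in> clarke_subdifferential (\<lambda>y. ereal (\<phi> (s i) y)) (x k)) \<and>
        \<gamma>min \<le> g \<and> ereal g < prox_threshold \<psi> \<and>
        PSS_linesearch (composite (sample_average \<phi> s (n k)) \<psi>) \<psi> \<rho> \<sigma> g
          (x k) ((1 / real (n k)) *\<^sub>R (\<Sum>i=1..n k. v i)) (x (Suc k)))"

definition iid_samples :: "'o measure \<Rightarrow> 's measure \<Rightarrow> (nat \<Rightarrow> 'o \<Rightarrow> 's) \<Rightarrow> bool" where
  "iid_samples P M \<xi> \<longleftrightarrow>
     prob_space.indep_vars P (\<lambda>_. M) \<xi> {1..} \<and> (\<forall>i\<ge>1. distr P M (\<xi> i) = M)"

definition sampling_filtration :: "'o measure \<Rightarrow> 's measure \<Rightarrow> (nat \<Rightarrow> 'o \<Rightarrow> 's) \<Rightarrow> (nat \<Rightarrow> nat) \<Rightarrow>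
    (nat \<Rightarrow> 'o \<Rightarrow> 'a::topological_space) \<Rightarrow> (nat \<Rightarrow> 'o measure) \<Rightarrow> bool" where
  "sampling_filtration P M \<xi> n x F \<longleftrightarrow>
     filtration (space P) F \<and> (\<forall>k. subalgebra P (F k)) \<and>
     (\<forall>k. x (Suc k) \<in> borel_measurable (F k)) \<and>
     (\<forall>k. \<forall>j\<in>{1..n k}. \<xi> j \<in> measurable (F k) M) \<and>
     (\<forall>k. \<forall>j>n k. prob_space.indep_set P (sets (F k))
                     (sets (vimage_algebra (space P) (\<xi> j) M)))"

definition sample_error :: "(nat \<Rightarrow> nat) \<Rightarrow> nat \<Rightarrow> real" where
  "sample_error n k = ln (real (n k)) / sqrt (real (n k))"

end

theory Submission
  imports Defs "HOL-Real_Asymp.Real_Asymp"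
begin

text \<open>
  A union bound over a grid of mesh \<open>1/n\<close>, applied to summands truncated at the square root of
  their index, shows that almost surely sample averages of an integrand with square integrable
  Lipschitz modulus converge at the rate \<open>ln n / sqrt n\<close>, uniformly on small balls; where the
  integrand is \<open>C\<^sup>1\<^sup>,\<^sup>1\<close> the same holds for its gradient. Everything else is deterministic, along a single
  path. The line search decreases the objective up to a summable error, the step sizes stay away
  from zero near the accumulation point (upper-\<open>C\<^sup>2\<close> inequality), so that this point is stationary,
  and the optimality condition of the proximal step yields a subgradient of norm
  \<open>O(\<parallel>x\<^sup>k\<^sup>+\<^sup>1 - x\<^sup>k\<parallel> + ln n\<^sub>k / sqrt n\<^sub>k)\<close>. With the KL inequality the gap \<open>\<Delta>\<^sub>k\<close> therefore satisfies
  \<open>\<Delta>\<^sub>k\<^sub>+\<^sub>1 powr (2 \<beta>) \<le> c (\<Delta>\<^sub>k - \<Delta>\<^sub>k\<^sub>+\<^sub>1 + \<epsilon>\<^sub>k)\<close>, which gives its rate by comparison, while the finite-length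
  argument applied to \<open>\<Delta>\<^sub>k\<close> plus the tail of the errors gives the rate of the iterates.
\<close>

section \<open>Sample averages\<close>

text \<open>The accumulation point is known only once \<open>\<omega>\<close> is fixed, so the
  exceptional null set must not depend on it. All random estimates are therefore local, uniform on a
  neighbourhood and over every choice of subgradients. Uniformity is also what permits evaluation at
  iterates that depend on the samples. Smoothness is assumed around stationary points only.
  Stationarity of the limit must thus come from the upper-C2 inequality alone, for which bounded
  averages of the moduli suffice; gradients enter afterwards. A proximal step is optimal at its end
  point, so the KL inequality bounds the gap at \<open>Suc k\<close> by the step leaving
  \<open>k\<close>: the recurrence is implicit. The sample sizes enter through
  \<open>a = q / 2 - 1\<close>, the decay exponent of the error tails. The lower bound on
  \<open>q\<close> says exactly that \<open>a * \<beta> > 1\<close>, which makes the tails summable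
  after raising them to the power \<open>\<beta>\<close>. The distance to the limit inherits the
  slowest of three terms: the last step, the sums of these tails, and the desingularized
  potential.\<close>

lemma grid_net:
  fixes c :: "'a::euclidean_space"
  obtains A :: real and Z :: "nat \<Rightarrow> 'a set" where
    "\<And>n. finite (Z n)" "\<And>n. Z n \<subseteq> cball c r" "A \<ge> 0"
    "\<And>n. n \<ge> 1 \<Longrightarrow> real (card (Z n)) \<le> A * real n ^ DIM('a)"
    "\<And>n y. n \<ge> 1 \<Longrightarrow> y \<in> cball c r \<Longrightarrow> \<exists>z\<in>Z n. norm (y - z) \<le> DIM('a) / real n"
proof -
  define R where "R = nat \<lceil>norm c + \<bar>r\<bar>\<rceil> + 1"
  have R: "norm c + \<bar>r\<bar> \<le> real R - 1" unfolding R_def by linarith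
  have R1: "1 \<le> real R" using R norm_ge_zero[of c] by linarith
  define cell where "cell n y = (\<lambda>b\<in>(Basis::'a set). \<lfloor>real n * (y \<bullet> b)\<rfloor>)" for n and y :: 'a
  \<comment> \<open>One point of the ball is taken from every occupied cell. A cell corner could
    leave the ball, where the integrand is not controlled.\<close>
  define pick where "pick n p = (SOME y. y \<in> cball c r \<and> cell n y = p)" for n p
  define Z where "Z n = pick n ` cell n ` cball c r" for n
  have pick: "pick n (cell n y) \<in> cball c r \<and> cell n (pick n (cell n y)) = cell n y"
    if "y \<in> cball c r" for n y
    unfolding pick_def by (rule someI[of _ y]) (use that in auto)
  define S where "S n = PiE (Basis::'a set) (\<lambda>_. {- int (n * R)..int (n * R)})" for n
  \<comment> \<open>Coordinates of points in the ball are at most \<open>R\<close> in absolute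
    value, so the labels lie in an integer box with \<open>2 * n * R + 1\<close> values per
    coordinate.\<close>
  have sub: "cell n ` cball c r \<subseteq> S n" for n
  proof (clarsimp simp: S_def cell_def)
    fix y b assume y: "dist c y \<le> r" and b: "b \<in> (Basis::'a set)"
    have "\<bar>y \<bullet> b\<bar> \<le> norm y" using b by (rule Basis_le_norm)
    also have "\<dots> \<le> norm c + r" using y norm_triangle_ineq2[of y c]
      by (simp add: dist_norm norm_minus_commute)
    also have "\<dots> \<le> real R" using R by linarith
    finally have "\<bar>real n * (y \<bullet> b)\<bar> \<le> real n * real R"
      by (simp add: abs_mult mult_left_mono)
    then have "real n * (y \<bullet> b) \<le> real n * real R" "- (real n * real R) \<le> real n * (y \<bullet> b)"
      by linarith+
    then show "- (int n * int R) \<le> \<lfloor>real n * (y \<bullet> b)\<rfloor> \<and> \<lfloor>real n * (y \<bullet> b)\<rfloor> \<le> int n * int R"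
      by (auto simp: le_floor_iff floor_le_iff)
  qed
  have finS: "finite (S n)" for n unfolding S_def by (rule finite_PiE) auto
  have cardS: "card (S n) = (2 * n * R + 1) ^ DIM('a)" for n
    unfolding S_def by (subst card_PiE) (auto simp: nat_add_distrib nat_mult_distrib ac_simps)
  show ?thesis
  proof (rule that[of Z "(3 * real R) ^ DIM('a)"])
    show fin: "finite (Z n)" for n
      unfolding Z_def using finite_subset[OF sub finS] by auto
    show "Z n \<subseteq> cball c r" for n unfolding Z_def using pick by fastforce
    show "real (card (Z n)) \<le> (3 * real R) ^ DIM('a) * real n ^ DIM('a)" if n: "n \<ge> 1" for n
    proof -
      have "card (Z n) \<le> card (cell n ` cball c r)"
        unfolding Z_def by (rule card_image_le) (rule finite_subset[OF sub finS])
      also have "\<dots> \<le> card (S n)" by (rule card_mono[OF finS sub])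
      finally have "real (card (Z n)) \<le> real ((2 * n * R + 1) ^ DIM('a))"
        unfolding cardS by linarith
      also have "\<dots> = (2 * real n * real R + 1) ^ DIM('a)" by (simp add: add.commute)
      also have "\<dots> \<le> (3 * real R * real n) ^ DIM('a)"
      proof (rule power_mono)
        have "1 * 1 \<le> real R * real n" using n R1 by (intro mult_mono) auto
        then show "2 * real n * real R + 1 \<le> 3 * real R * real n" by (simp add: algebra_simps)
      qed auto
      finally show ?thesis by (simp add: power_mult_distrib)
    qed
    show "\<exists>z\<in>Z n. norm (y - z) \<le> DIM('a) / real n" if n: "n \<ge> 1" and y: "y \<in> cball c r" for n y
    proof -
      define z where "z = pick n (cell n y)"
      have zZ: "z \<in> Z n" unfolding z_def Z_def using y by auto
      have ce: "cell n z = cell n y" unfolding z_def using pick[OF y] by auto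
      have "\<bar>(y - z) \<bullet> b\<bar> \<le> 1 / real n" if b: "b \<in> Basis" for b
      proof -
        have "\<lfloor>real n * (y \<bullet> b)\<rfloor> = \<lfloor>real n * (z \<bullet> b)\<rfloor>"
          using fun_cong[OF ce, of b] b by (simp add: cell_def)
        then have "\<bar>real n * (y \<bullet> b) - real n * (z \<bullet> b)\<bar> \<le> 1" by linarith
        then have "real n * \<bar>(y - z) \<bullet> b\<bar> \<le> 1"
          by (metis abs_mult abs_of_nat inner_diff_left right_diff_distrib)
        then show ?thesis using n by (simp add: field_simps)
      qed
      then have "(\<Sum>b\<in>Basis. \<bar>(y - z) \<bullet> b\<bar>) \<le> (\<Sum>b\<in>(Basis::'a set). 1 / real n)"
        by (rule sum_mono)
      then have "norm (y - z) \<le> DIM('a) / real n"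
        using norm_le_l1[of "y - z"] by simp
      then show ?thesis using zZ by blast
    qed
  qed auto
qed

lemma sum_inverse_sqrt_le: "(\<Sum>i=1..n. 1 / sqrt (real i)) \<le> 2 * sqrt (real n)"
proof (induction n)
  case (Suc n)
  have "1 / sqrt (real (Suc n)) \<le> 2 * (sqrt (real (Suc n)) - sqrt (real n))"
  proof -
    define a b where "a = sqrt (real (Suc n))" and "b = sqrt (real n)"
    have a: "a > 0" "b \<ge> 0" "b \<le> a" by (auto simp: a_def b_def)
    have "a * a = b * b + 1" by (simp add: a_def b_def)
    then have 1: "1 = (a - b) * (a + b)" by (simp add: algebra_simps)
    also have "\<dots> \<le> (a - b) * (2 * a)" using a by (intro mult_left_mono) auto
    finally show ?thesis using a unfolding a_def[symmetric] b_def[symmetric] by (simp add: field_simps)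
  qed
  then show ?case using Suc by simp
qed simp

text \<open>Discrete layer-cake bound: after integration it turns a sum of tail probabilities into a
  moment.\<close>

lemma count_below_le:
  fixes u :: real
  assumes "0 \<le> u"
  shows "(\<Sum>i<N. indicator {real i<..} u) \<le> u + 1"
proof -
  have N: "(\<Sum>i<N. indicator {real i<..} u) \<le> real N" for N
    using sum_bounded_above[of "{..<N}" "\<lambda>i. indicator {real i<..} u" "1::real"]
    by (simp add: indicator_def)
  show ?thesis
  proof (induction N)
    case (Suc N)
    then show ?case using N[of N] by (cases "real N < u") (auto simp: indicator_def)
  qed (use assms in auto)
qed

text \<open>Indices with \<open>2 ^ j \<le> l\<close> contribute \<open>2 ^ j\<close>, the others
  \<open>l\<^sup>2 / 2 ^ j\<close>. Both series are geometric and dominated by their terms near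
  \<open>l\<close>, at most \<open>2 * l\<close> each. Integrated, this shows that a first moment
  pays for all truncated second moments along powers of two.\<close>

lemma sum_truncated_squares_le:
  fixes l :: real
  assumes l: "0 \<le> l"
  shows "(\<Sum>j<J. (min l (2 ^ j))\<^sup>2 / 2 ^ j) \<le> 4 * l"
proof -
  define S where "S J = (\<Sum>j<J. (min l (2 ^ j))\<^sup>2 / 2 ^ j)" for J :: nat
  \<comment> \<open>The induction has to carry the remainder: \<open>2 * l\<^sup>2 / 2 ^ J\<close>
    is the geometric series of the terms \<open>l\<^sup>2 / 2 ^ j\<close> with
    \<open>j \<ge> J\<close>.\<close>
  have "S J \<le> (if 2 ^ J \<le> l then 2 ^ J else 4 * l - 2 * l\<^sup>2 / 2 ^ J)"
  proof (induction J)
    case 0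
    show ?case using l mult_left_mono[of l 1 l] by (auto simp: S_def power2_eq_square)
  next
    case (Suc J)
    have rec: "S (Suc J) = S J + (min l (2 ^ J))\<^sup>2 / 2 ^ J" by (simp add: S_def)
    show ?case
    proof (cases "2 ^ J \<le> l")
      case True
      then have "S (Suc J) \<le> 2 * 2 ^ J" using Suc rec by (simp add: min_def power2_eq_square split: if_splits)
      moreover have "2 * 2 ^ J \<le> 4 * l - 2 * l\<^sup>2 / 2 ^ Suc J" if "\<not> 2 ^ Suc J \<le> l"
      proof -
        \<comment> \<open>This is the single step at which the powers pass \<open>l\<close>; the
          product of the distances from \<open>l\<close> to the two neighbouring powers yields the
          quadratic inequality.\<close>
        have "0 \<le> (l - 2 ^ J) * (2 * 2 ^ J - l)"
          using True that by (intro mult_nonneg_nonneg) auto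
        moreover have "0 \<le> l * 2 ^ J" using l by simp
        ultimately have "2 * 2 ^ J * 2 ^ J \<le> 4 * l * 2 ^ J - l\<^sup>2"
          by (simp add: algebra_simps power2_eq_square)
        then show ?thesis by (simp add: field_simps)
      qed
      ultimately show ?thesis by auto
    next
      case False
      then have "\<not> 2 ^ Suc J \<le> l"
        using power_strict_increasing[of J "Suc J" "2::real"] by linarith
      moreover have "S (Suc J) \<le> 4 * l - 2 * l\<^sup>2 / 2 ^ J + l\<^sup>2 / 2 ^ J"
        using Suc rec False by (simp add: min_def)
      ultimately show ?thesis by (simp add: field_simps)
    qed
  qed
  also have "\<dots> \<le> 4 * l" using l by auto
  finally show ?thesis by (simp add: S_def)
qed

lemma power_of_two_between:
  "n \<ge> 1 \<Longrightarrow> \<exists>j. n \<le> 2 ^ j \<and> 2 ^ j \<le> 2 * (n::nat)"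
proof (induction n rule: nat_induct_at_least)
  case base
  show ?case by (intro exI[of _ 0]) auto
next
  case (Suc n)
  then obtain j where j: "n \<le> 2 ^ j" "2 ^ j \<le> 2 * n" by auto
  show ?case
  proof (cases "Suc n \<le> 2 ^ j")
    case True
    then show ?thesis using j by (intro exI[of _ j]) auto
  next
    case False
    then show ?thesis using j Suc.hyps by (intro exI[of _ "Suc j"]) auto
  qed
qed

section \<open>Independent samples: moment bounds and almost sure estimates\<close>

locale iid_sampling = P: prob_space P + M: prob_space \<mu>
  for P :: "'o measure" and \<mu> :: "'s measure" +
  fixes \<xi> :: "nat \<Rightarrow> 'o \<Rightarrow> 's"
  assumes iid: "iid_samples P \<mu> \<xi>"
begin

lemma sample_measurable: "i \<ge> 1 \<Longrightarrow> \<xi> i \<in> measurable P \<mu>"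
  using iid unfolding iid_samples_def P.indep_vars_def by auto

lemma sample_in_space: "i \<ge> 1 \<Longrightarrow> \<omega> \<in> space P \<Longrightarrow> \<xi> i \<omega> \<in> space \<mu>"
  using sample_measurable measurable_space by metis

lemma sample_distr: "i \<ge> 1 \<Longrightarrow> distr P \<mu> (\<xi> i) = \<mu>"
  using iid unfolding iid_samples_def by auto

lemma sample_fun_measurable:
  "i \<ge> 1 \<Longrightarrow> g \<in> borel_measurable \<mu> \<Longrightarrow> (\<lambda>\<omega>. g (\<xi> i \<omega>)) \<in> borel_measurable P"
  using sample_measurable measurable_compose by blast

lemma integral_sample:
  fixes g :: "'s \<Rightarrow> real"
  assumes "i \<ge> 1" "g \<in> borel_measurable \<mu>"
  shows "(\<integral>\<omega>. g (\<xi> i \<omega>) \<partial>P) = (\<integral>s. g s \<partial>\<mu>)"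
  using integral_distr[OF sample_measurable[OF assms(1)] assms(2)] sample_distr[OF assms(1)]
  by simp

lemma integrable_sample:
  fixes g :: "'s \<Rightarrow> real"
  assumes "i \<ge> 1" "integrable \<mu> g"
  shows "integrable P (\<lambda>\<omega>. g (\<xi> i \<omega>))"
  using integrable_distr_eq[OF sample_measurable[OF assms(1)], of g] sample_distr[OF assms(1)] assms
  by auto

lemma prob_sample:
  assumes "i \<ge> 1" "A \<in> sets \<mu>"
  shows "measure P {\<omega>\<in>space P. \<xi> i \<omega> \<in> A} = measure \<mu> A"
proof -
  have "measure \<mu> A = measure (distr P \<mu> (\<xi> i)) A" using sample_distr assms by simp
  also have "\<dots> = measure P (\<xi> i -` A \<inter> space P)"
    by (rule measure_distr[OF sample_measurable[OF assms(1)] assms(2)])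
  also have "\<xi> i -` A \<inter> space P = {\<omega>\<in>space P. \<xi> i \<omega> \<in> A}" by auto
  finally show ?thesis by simp
qed

lemma indep_sample_funs:
  fixes g :: "nat \<Rightarrow> 's \<Rightarrow> real"
  assumes "I \<subseteq> {1..}" "\<And>i. i \<in> I \<Longrightarrow> g i \<in> borel_measurable \<mu>"
  shows "P.indep_vars (\<lambda>_. borel) (\<lambda>i \<omega>. g i (\<xi> i \<omega>)) I"
proof -
  have "P.indep_vars (\<lambda>_. \<mu>) \<xi> I"
    using iid P.indep_vars_subset[OF _ assms(1)] unfolding iid_samples_def by blast
  then show ?thesis using assms(2) by (rule P.indep_vars_compose2)
qed

text \<open>The mixed terms factor by independence and vanish by centring.\<close>

lemma second_moment_centred_sum:
  fixes g :: "'s \<Rightarrow> real"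
  assumes g[measurable]: "g \<in> borel_measurable \<mu>" and b: "\<And>s. s \<in> space \<mu> \<Longrightarrow> \<bar>g s\<bar> \<le> b"
    and z: "(\<integral>s. g s \<partial>\<mu>) = 0"
  shows "(\<integral>\<omega>. (\<Sum>i=1..N. g (\<xi> i \<omega>))\<^sup>2 \<partial>P) = real N * (\<integral>s. (g s)\<^sup>2 \<partial>\<mu>)"
proof -
  have ig: "integrable \<mu> g"
    by (rule M.integrable_const_bound[of _ b]) (use b in auto)
  have ig2: "integrable \<mu> (\<lambda>s. (g s)\<^sup>2)"
  proof (rule M.integrable_const_bound[of _ "b\<^sup>2"])
    show "AE x in \<mu>. norm ((g x)\<^sup>2) \<le> b\<^sup>2"
      using b by (auto intro!: AE_I2) (metis abs_ge_zero order_trans power2_abs power_mono)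
  qed auto
  have prod: "integrable P (\<lambda>\<omega>. g (\<xi> i \<omega>) * g (\<xi> j \<omega>)) \<and>
      (\<integral>\<omega>. g (\<xi> i \<omega>) * g (\<xi> j \<omega>) \<partial>P) = (if i = j then \<integral>s. (g s)\<^sup>2 \<partial>\<mu> else 0)"
    if "i \<in> {1..N}" "j \<in> {1..N}" for i j
  proof (cases "i = j")
    case True
    then show ?thesis
      using integrable_sample[OF _ ig2, of i] integral_sample[of i "\<lambda>s. (g s)\<^sup>2"] that
      by (simp add: power2_eq_square)
  next
    case False
    have iv: "P.indep_vars (\<lambda>_. borel) (\<lambda>i \<omega>. g (\<xi> i \<omega>)) {i,j}"
      using indep_sample_funs[of "{i,j}" "\<lambda>_. g"] that by auto
    have int: "\<And>k. k \<in> {i,j} \<Longrightarrow> integrable P (\<lambda>\<omega>. g (\<xi> k \<omega>))"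
      using integrable_sample[OF _ ig] that by auto
    have 1: "(\<integral>\<omega>. (\<Prod>k\<in>{i,j}. g (\<xi> k \<omega>)) \<partial>P) = (\<Prod>k\<in>{i,j}. \<integral>\<omega>. g (\<xi> k \<omega>) \<partial>P)"
      by (rule P.indep_vars_lebesgue_integral[OF _ iv int]) auto
    have 2: "integrable P (\<lambda>\<omega>. (\<Prod>k\<in>{i,j}. g (\<xi> k \<omega>)))"
      by (rule P.indep_vars_integrable[OF _ iv int]) auto
    show ?thesis using 1 2 False integral_sample[of i g] that z by simp
  qed
  have "(\<integral>\<omega>. (\<Sum>i=1..N. g (\<xi> i \<omega>))\<^sup>2 \<partial>P)
      = (\<integral>\<omega>. (\<Sum>i=1..N. \<Sum>j=1..N. g (\<xi> i \<omega>) * g (\<xi> j \<omega>)) \<partial>P)"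
    by (simp add: power2_eq_square sum_product)
  also have "\<dots> = (\<Sum>i=1..N. \<Sum>j=1..N. \<integral>\<omega>. g (\<xi> i \<omega>) * g (\<xi> j \<omega>) \<partial>P)"
    using prod by (subst Bochner_Integration.integral_sum, force)+ auto
  also have "\<dots> = (\<Sum>i=1..N. \<Sum>j=1..N. if i = j then \<integral>s. (g s)\<^sup>2 \<partial>\<mu> else 0)"
    using prod by (intro sum.cong refl) auto
  also have "\<dots> = real N * (\<integral>s. (g s)\<^sup>2 \<partial>\<mu>)" by simp
  finally show ?thesis .
qed

text \<open>Chernoff bound with parameter \<open>1 / sqrt N\<close>. Truncation at
  \<open>sqrt N\<close> keeps the scaled variable in [-1, 1], where
  \<open>exp u \<le> 1 + u + u\<^sup>2\<close>. Each summand then costs at most its share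
  \<open>1 / N\<close> of the second moment of \<open>B\<close>, so the total cost does not grow
  with \<open>N\<close>.\<close>

lemma exp_moment_centred_sum:
  fixes g :: "nat \<Rightarrow> 's \<Rightarrow> real"
  assumes g: "\<And>i. i \<in> {1..N} \<Longrightarrow> g i \<in> borel_measurable \<mu>"
    and gb: "\<And>i s. i \<in> {1..N} \<Longrightarrow> s \<in> space \<mu> \<Longrightarrow> \<bar>g i s\<bar> \<le> sqrt N"
    and gB: "\<And>i s. i \<in> {1..N} \<Longrightarrow> s \<in> space \<mu> \<Longrightarrow> \<bar>g i s\<bar> \<le> B s"
    and B2: "integrable \<mu> (\<lambda>s. (B s)\<^sup>2)"
    and N: "N \<ge> 1"
  shows "measure P {\<omega>\<in>space P. a \<le> (\<Sum>i=1..N. g i (\<xi> i \<omega>) - (\<integral>s. g i s \<partial>\<mu>))}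
     \<le> exp ((\<integral>s. (B s)\<^sup>2 \<partial>\<mu>) - a / sqrt N)"
proof -
  define l where "l = 1 / sqrt N"
  have l: "l > 0" using N by (simp add: l_def)
  define V where "V = (\<integral>s. (B s)\<^sup>2 \<partial>\<mu>)"
  define h where "h i s = exp (l * (g i s - (\<integral>s. g i s \<partial>\<mu>)))" for i s
  have hm: "h i \<in> borel_measurable \<mu>" if "i \<in> {1..N}" for i
    unfolding h_def using g[OF that] by measurable
  have *: "integrable \<mu> (h i) \<and> (\<integral>s. h i s \<partial>\<mu>) \<le> exp (V / N)" if i: "i \<in> {1..N}" for i
  proof -
    define m where "m = (\<integral>s. g i s \<partial>\<mu>)"
    note [measurable] = g[OF i]
    have ig: "integrable \<mu> (g i)"
      by (rule M.integrable_const_bound[of _ "sqrt N"]) (use gb[OF i] in auto)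
    have le1: "\<bar>l * g i s\<bar> \<le> 1" if "s \<in> space \<mu>" for s
      using gb[OF i that] N by (simp add: l_def field_simps abs_mult)
    have ex: "exp (l * g i s) \<le> 1 + l * g i s + (B s)\<^sup>2 / N" if s: "s \<in> space \<mu>" for s
    proof -
      have "exp (l * g i s) \<le> 1 + l * g i s + (l * g i s)\<^sup>2"
      proof (cases "0 \<le> l * g i s")
        case True
        then show ?thesis using exp_bound[of "l * g i s"] le1[OF s] by auto
      next
        case False
        define u where "u = - (l * g i s)"
        have u: "0 \<le> u" "u \<le> 1" using False le1[OF s] by (auto simp: u_def)
        \<comment> \<open>The product equals \<open>1 + u ^ 3\<close>.\<close>
        have "1 \<le> (1 - u + u\<^sup>2) * (1 + u)"
          using u by (simp add: algebra_simps power2_eq_square)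
        also have "\<dots> \<le> (1 - u + u\<^sup>2) * exp u"
          using u exp_ge_add_one_self[of u] by (intro mult_left_mono) auto
        finally have "exp (-u) \<le> 1 - u + u\<^sup>2" by (simp add: exp_minus field_simps)
        then show ?thesis by (simp add: u_def)
      qed
      moreover have "(l * g i s)\<^sup>2 \<le> (B s)\<^sup>2 / N"
      proof -
        have "(g i s)\<^sup>2 \<le> (B s)\<^sup>2" using gB[OF i s]
          by (metis abs_ge_zero power2_abs power_mono)
        then show ?thesis using N by (simp add: l_def power_mult_distrib field_simps)
      qed
      ultimately show ?thesis by linarith
    qed
    have ie: "integrable \<mu> (\<lambda>s. exp (l * g i s))"
    proof (rule M.integrable_const_bound[of _ "exp 1"])
      show "AE x in \<mu>. norm (exp (l * g i x)) \<le> exp 1"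
        using le1 abs_le_D1 by (auto intro!: AE_I2)
    qed auto
    have "(\<integral>s. exp (l * g i s) \<partial>\<mu>) \<le> (\<integral>s. 1 + l * g i s + (B s)\<^sup>2 / N \<partial>\<mu>)"
      by (rule integral_mono[OF ie]) (use ig B2 ex in auto)
    also have "\<dots> = 1 + l * m + V / N"
      using ig B2 by (simp add: m_def V_def M.prob_space)
    also have "\<dots> \<le> exp (l * m + V / N)" using exp_ge_add_one_self[of "l * m + V / N"] by linarith
    finally have 1: "(\<integral>s. exp (l * g i s) \<partial>\<mu>) \<le> exp (l * m + V / N)" .
    have heq: "h i = (\<lambda>s. exp (- l * m) * exp (l * g i s))"
      unfolding h_def m_def by (auto simp: exp_add[symmetric] algebra_simps)
    have "(\<integral>s. h i s \<partial>\<mu>) = exp (- l * m) * (\<integral>s. exp (l * g i s) \<partial>\<mu>)"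
      unfolding heq by simp
    also have "\<dots> \<le> exp (- l * m) * exp (l * m + V / N)" using 1 by simp
    also have "\<dots> = exp (V / N)" by (simp add: exp_add[symmetric])
    finally show ?thesis using ie unfolding heq by auto
  qed
  have iv: "P.indep_vars (\<lambda>_. borel) (\<lambda>i \<omega>. h i (\<xi> i \<omega>)) {1..N}"
    using indep_sample_funs[of "{1..N}" h] hm by auto
  have int: "\<And>k. k \<in> {1..N} \<Longrightarrow> integrable P (\<lambda>\<omega>. h k (\<xi> k \<omega>))"
    using integrable_sample * by auto
  define H where "H \<omega> = (\<Prod>k\<in>{1..N}. h k (\<xi> k \<omega>))" for \<omega>
  have iH: "integrable P H"
    unfolding H_def by (rule P.indep_vars_integrable[OF _ iv int]) auto
  have "(\<integral>\<omega>. H \<omega> \<partial>P) = (\<Prod>k\<in>{1..N}. \<integral>\<omega>. h k (\<xi> k \<omega>) \<partial>P)"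
    unfolding H_def by (rule P.indep_vars_lebesgue_integral[OF _ iv int]) auto
  also have "\<dots> = (\<Prod>k\<in>{1..N}. \<integral>s. h k s \<partial>\<mu>)"
    using hm by (intro prod.cong refl integral_sample) auto
  also have "\<dots> \<le> (\<Prod>k\<in>{1..N}. exp (V / N))"
  proof (rule prod_mono)
    fix i assume "i \<in> {1..N}"
    then show "0 \<le> (\<integral>s. h i s \<partial>\<mu>) \<and> (\<integral>s. h i s \<partial>\<mu>) \<le> exp (V / N)"
      using * by (auto simp: h_def intro!: integral_nonneg)
  qed
  also have "\<dots> = exp V" using N by (simp add: exp_of_nat_mult[symmetric])
  finally have EH: "(\<integral>\<omega>. H \<omega> \<partial>P) \<le> exp V" .
  have Heq: "H \<omega> = exp (l * (\<Sum>i=1..N. g i (\<xi> i \<omega>) - (\<integral>s. g i s \<partial>\<mu>)))" for \<omega>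
    unfolding H_def h_def by (simp add: exp_sum[symmetric] sum_distrib_left)
  have "measure P {\<omega>\<in>space P. exp (l * a) \<le> H \<omega>} \<le> (\<integral>\<omega>. H \<omega> \<partial>P) / exp (l * a)"
    by (rule integral_Markov_inequality_measure[OF iH, of "{}"])
       (auto simp: Heq)
  also have "\<dots> \<le> exp V / exp (l * a)" using EH by (simp add: divide_right_mono)
  also have "\<dots> = exp (V - a / sqrt N)" by (simp add: exp_diff l_def)
  finally show ?thesis unfolding Heq using l by (simp add: V_def)
qed

text \<open>First Borel-Cantelli lemma: the probabilities that the square exceeds the index add up
  to at most its mean plus one, by counting the indices below it.\<close>

lemma eventually_square_le_index:
  fixes B :: "'s \<Rightarrow> real"
  assumes B[measurable]: "B \<in> borel_measurable \<mu>" and B2: "integrable \<mu> (\<lambda>s. (B s)\<^sup>2)"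
  shows "AE \<omega> in P. eventually (\<lambda>i. (B (\<xi> i \<omega>))\<^sup>2 \<le> real i) sequentially"
proof -
  define D where "D i = {s\<in>space \<mu>. real i < (B s)\<^sup>2}" for i
  have D[measurable]: "D i \<in> sets \<mu>" for i unfolding D_def by measurable
  \<comment> \<open>The guard \<open>i \<ge> 1\<close> makes the event empty at index 0, about which
    the sampling assumption says nothing.\<close>
  define A where "A i = {\<omega>\<in>space P. i \<ge> 1 \<and> \<xi> i \<omega> \<in> D i}" for i
  have A: "A i \<in> sets P" for i
  proof (cases "i \<ge> 1")
    case True
    have "A i = \<xi> i -` D i \<inter> space P" using True by (auto simp: A_def)
    then show ?thesis using measurable_sets[OF sample_measurable[OF True] D] by simp
  qed (simp add: A_def)
  have Ale: "measure P (A i) \<le> measure \<mu> (D i)" for i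
    using prob_sample[of i "D i"] by (cases "i \<ge> 1") (auto simp: A_def)
  have "summable (\<lambda>i. measure \<mu> (D i))"
  proof (rule summableI_nonneg_bounded)
    fix n
    have "(\<Sum>i<n. measure \<mu> (D i)) = (\<Sum>i<n. \<integral>s. indicator (D i) s \<partial>\<mu>)"
      by simp
    also have "\<dots> = (\<integral>s. (\<Sum>i<n. indicator (D i) s) \<partial>\<mu>)"
      by (rule Bochner_Integration.integral_sum[symmetric]) (auto simp: M.emeasure_eq_measure)
    also have "\<dots> \<le> (\<integral>s. (B s)\<^sup>2 + 1 \<partial>\<mu>)"
    proof (rule integral_mono)
      fix s assume s: "s \<in> space \<mu>"
      have "(\<Sum>i<n. indicator (D i) s) = (\<Sum>i<n. indicator {real i<..} ((B s)\<^sup>2) :: real)"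
        using s by (intro sum.cong) (auto simp: D_def indicator_def)
      then show "(\<Sum>i<n. indicator (D i) s) \<le> (B s)\<^sup>2 + 1"
        using count_below_le[of "(B s)\<^sup>2" n] by simp
    qed (use B2 in \<open>auto simp: M.emeasure_eq_measure intro!: Bochner_Integration.integrable_sum\<close>)
    finally show "(\<Sum>i<n. measure \<mu> (D i)) \<le> (\<integral>s. (B s)\<^sup>2 + 1 \<partial>\<mu>)" .
  qed auto
  then have "summable (\<lambda>i. measure P (A i))"
    by (rule summable_comparison_test'[of _ 0]) (use Ale in auto)
  then have "AE \<omega> in P. eventually (\<lambda>i. \<omega> \<in> space P - A i) sequentially"
    by (intro borel_cantelli_AE1 A) (auto simp: P.emeasure_eq_measure)
  then show ?thesis
  proof eventually_elim
    case (elim \<omega>)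
    show ?case using elim eventually_ge_at_top[of 1]
      by eventually_elim (use sample_in_space in \<open>force simp: A_def D_def\<close>)
  qed
qed

text \<open>Truncating the \<open>i\<close>-th summand at \<open>B\<^sup>2 \<le> i\<close> changes only finitely many summands and costs a bias of
  \<open>O(1 / sqrt i)\<close>; exponential moments at scale \<open>1 / sqrt n\<close> then beat the polynomial size of the grid.\<close>

lemma uniform_sample_average_rate:
  fixes f :: "'s \<Rightarrow> 'a::euclidean_space \<Rightarrow> real"
  assumes fm: "\<And>y. y \<in> cball c r \<Longrightarrow> (\<lambda>s. f s y) \<in> borel_measurable \<mu>"
    and fc: "square_integrable \<mu> (\<lambda>s. f s c)" and \<kappa>: "square_integrable \<mu> \<kappa>"
    and lip: "\<And>s y z. s \<in> space \<mu> \<Longrightarrow> y \<in> cball c r \<Longrightarrow> z \<in> cball c r \<Longrightarrow>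
        \<bar>f s y - f s z\<bar> \<le> \<kappa> s * norm (y - z)"
    and r: "0 \<le> r"
  shows "AE \<omega> in P. \<exists>C. eventually (\<lambda>n. \<forall>y\<in>cball c r.
     \<bar>sample_average f (\<lambda>i. \<xi> i \<omega>) n y - expected_fun \<mu> f y\<bar> \<le> C * (ln (real n) / sqrt (real n)))
     sequentially"
proof -
  \<comment> \<open>One envelope for two purposes: \<open>r * \<bar>\<kappa> s\<bar>\<close> bounds
    the variation from the centre over the ball, and the additional
    \<open>\<bar>\<kappa> s\<bar>\<close> makes \<open>B\<close> a Lipschitz modulus as
    well.\<close>
  define B where "B s = \<bar>f s c\<bar> + (r + 1) * \<bar>\<kappa> s\<bar>" for s
  have [measurable]: "(\<lambda>s. f s c) \<in> borel_measurable \<mu>" "\<kappa> \<in> borel_measurable \<mu>"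
    using fc \<kappa> by (auto simp: square_integrable_def)
  have B[measurable]: "B \<in> borel_measurable \<mu>" unfolding B_def by measurable
  have Bnn: "B s \<ge> 0" for s using r by (simp add: B_def)
  have B2: "integrable \<mu> (\<lambda>s. (B s)\<^sup>2)"
  proof (rule Bochner_Integration.integrable_bound)
    show "integrable \<mu> (\<lambda>s. 2 * (norm (f s c))\<^sup>2 + 2 * (r + 1)\<^sup>2 * (norm (\<kappa> s))\<^sup>2)"
      using fc \<kappa> unfolding square_integrable_def
      by (intro Bochner_Integration.integrable_add integrable_mult_right) auto
    have "(B s)\<^sup>2 \<le> 2 * (norm (f s c))\<^sup>2 + 2 * (r + 1)\<^sup>2 * (norm (\<kappa> s))\<^sup>2" for s
    proof -
      have "(B s)\<^sup>2 \<le> 2 * \<bar>f s c\<bar>\<^sup>2 + 2 * ((r + 1) * \<bar>\<kappa> s\<bar>)\<^sup>2"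
        unfolding B_def using sum_squares_bound[of "\<bar>f s c\<bar>" "(r + 1) * \<bar>\<kappa> s\<bar>"]
        by (simp add: power2_sum)
      then show ?thesis by (simp add: power_mult_distrib)
    qed
    then show "AE s in \<mu>. norm ((B s)\<^sup>2) \<le>
        norm (2 * (norm (f s c))\<^sup>2 + 2 * (r + 1)\<^sup>2 * (norm (\<kappa> s))\<^sup>2)"
      by (auto intro!: AE_I2 order_trans[OF _ abs_ge_self])
  qed measurable
  have IB: "integrable \<mu> B"
  proof (rule Bochner_Integration.integrable_bound)
    show "integrable \<mu> (\<lambda>s. 1 + (B s)\<^sup>2)" using B2 by auto
    have "B s \<le> 1 + (B s)\<^sup>2" for s
      using sum_squares_bound[of "B s" 1] Bnn[of s] by (simp add: power2_eq_square)
    then show "AE s in \<mu>. norm (B s) \<le> norm (1 + (B s)\<^sup>2)"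
      using Bnn by (auto intro!: AE_I2 order_trans[OF _ abs_ge_self])
  qed measurable
  have \<kappa>B: "\<bar>\<kappa> s\<bar> \<le> B s" for s
    using r mult_nonneg_nonneg[of r "\<bar>\<kappa> s\<bar>"] unfolding B_def by (auto simp: algebra_simps)
  have fB: "\<bar>f s y\<bar> \<le> B s" if s: "s \<in> space \<mu>" and y: "y \<in> cball c r" for s y
  proof -
    have "\<bar>f s y - f s c\<bar> \<le> \<kappa> s * norm (y - c)" using lip[OF s y] r by simp
    also have "\<dots> \<le> \<bar>\<kappa> s\<bar> * r"
      using y by (intro mult_mono) (auto simp: dist_norm norm_minus_commute)
    finally have "\<bar>f s y - f s c\<bar> \<le> \<bar>\<kappa> s\<bar> * r" .
    then show ?thesis unfolding B_def by (simp add: algebra_simps)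
  qed
  have iF: "integrable \<mu> (\<lambda>s. f s y)" if y: "y \<in> cball c r" for y
    by (rule Bochner_Integration.integrable_bound[OF IB fm[OF y]])
       (use fB[OF _ y] Bnn in \<open>auto intro!: AE_I2\<close>)
  define V where "V = (\<integral>s. (B s)\<^sup>2 \<partial>\<mu>)"
  define W where "W = (\<integral>s. B s \<partial>\<mu>)"
  have W: "W \<ge> 0" unfolding W_def using Bnn by simp
  have V: "V \<ge> 0" unfolding V_def by simp
  \<comment> \<open>The cut depends on the envelope and not on \<open>y\<close>, so the finitely
    many affected indices are the same for all points of the ball.\<close>
  define Z where "Z y i s = (if (B s)\<^sup>2 \<le> real i then f s y else 0)" for y i s
  define m where "m y i = (\<integral>s. Z y i s \<partial>\<mu>)" for y i
  have Zm: "Z y i \<in> borel_measurable \<mu>" if "y \<in> cball c r" for y i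
    unfolding Z_def using fm[OF that] by measurable
  have ZB: "\<bar>Z y i s\<bar> \<le> B s" if "s \<in> space \<mu>" "y \<in> cball c r" for y i s
    using fB[OF that] Bnn by (auto simp: Z_def)
  have Zsqrt: "\<bar>Z y i s\<bar> \<le> sqrt N" if "s \<in> space \<mu>" "y \<in> cball c r" "i \<le> N" for y i s N
  proof (cases "(B s)\<^sup>2 \<le> real i")
    case True
    then have "B s \<le> sqrt N" using that by (intro real_le_rsqrt) auto
    then show ?thesis using ZB[OF that(1,2), of i] by linarith
  qed (auto simp: Z_def)
  have iZ: "integrable \<mu> (Z y i)" if "y \<in> cball c r" for y i
    by (rule Bochner_Integration.integrable_bound[OF IB Zm[OF that]])
       (use ZB[OF _ that] Bnn in \<open>auto intro!: AE_I2\<close>)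
  have bias: "\<bar>m y i - expected_fun \<mu> f y\<bar> \<le> V / sqrt i" if y: "y \<in> cball c r" and i: "i \<ge> 1" for y i
  proof -
    have "\<bar>m y i - expected_fun \<mu> f y\<bar> = \<bar>\<integral>s. Z y i s - f s y \<partial>\<mu>\<bar>"
      unfolding m_def expected_fun_def using iZ[OF y] iF[OF y] by simp
    also have "\<dots> \<le> (\<integral>s. \<bar>Z y i s - f s y\<bar> \<partial>\<mu>)" by (rule integral_abs_bound)
    also have "\<dots> \<le> (\<integral>s. (B s)\<^sup>2 / sqrt i \<partial>\<mu>)"
    proof (rule integral_mono)
      fix s assume s: "s \<in> space \<mu>"
      show "\<bar>Z y i s - f s y\<bar> \<le> (B s)\<^sup>2 / sqrt i"
      proof (cases "(B s)\<^sup>2 \<le> real i")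
        case False
        \<comment> \<open>Beyond the cut \<open>B s\<close> is at least \<open>sqrt i\<close>, so
          its first power is bounded by \<open>(B s)\<^sup>2 / sqrt i\<close>. Summed over
          \<open>i\<close>, this bias is of order \<open>sqrt n\<close>.\<close>
        then have "sqrt i \<le> B s" using Bnn[of s] by (intro real_le_lsqrt) auto
        then have "B s * sqrt i \<le> (B s)\<^sup>2" using Bnn[of s]
          by (simp add: power2_eq_square mult_left_mono)
        then have "B s \<le> (B s)\<^sup>2 / sqrt i" using i by (simp add: field_simps)
        then show ?thesis using fB[OF s y] False by (simp add: Z_def)
      qed (auto simp: Z_def)
    qed (use iZ[OF y] iF[OF y] B2 in auto)
    also have "\<dots> = V / sqrt i" by (simp add: V_def)
    finally show ?thesis .
  qed
  define d where "d = real DIM('a)"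
  obtain A :: real and Net :: "nat \<Rightarrow> 'a set" where Net: "\<And>n. finite (Net n)" "\<And>n. Net n \<subseteq> cball c r"
    "A \<ge> 0" "\<And>n. n \<ge> 1 \<Longrightarrow> real (card (Net n)) \<le> A * real n ^ DIM('a)"
    "\<And>n y. n \<ge> 1 \<Longrightarrow> y \<in> cball c r \<Longrightarrow> \<exists>z\<in>Net n. norm (y - z) \<le> DIM('a) / real n"
    using grid_net[of c r] by metis
  \<comment> \<open>The factor \<open>d + 2\<close> gives a failure probability of order
    \<open>n powr - (d + 2)\<close> per grid point; about \<open>n ^ d\<close> points leave
    \<open>n powr - 2\<close>, which is summable.\<close>
  define a where "a n = (d + 2) * sqrt n * ln (real n)" for n :: nat
  define Sm where "Sm y n \<omega> = (\<Sum>i=1..n. Z y i (\<xi> i \<omega>) - m y i)" for y n \<omega>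
  define Bad where "Bad n = (\<Union>z\<in>Net n. {\<omega>\<in>space P. n \<ge> 1 \<and> a n \<le> Sm z n \<omega>} \<union>
      {\<omega>\<in>space P. n \<ge> 1 \<and> a n \<le> - Sm z n \<omega>})" for n
  have Smm: "Sm z n \<in> borel_measurable P" if "z \<in> cball c r" for z n
    unfolding Sm_def
    by (intro borel_measurable_sum borel_measurable_diff borel_measurable_const sample_fun_measurable)
       (use Zm[OF that] in auto)
  have Badz: "{\<omega>\<in>space P. n \<ge> 1 \<and> a n \<le> Sm z n \<omega>} \<union>
      {\<omega>\<in>space P. n \<ge> 1 \<and> a n \<le> - Sm z n \<omega>} \<in> sets P" if z: "z \<in> Net n" for z n
  proof -
    have [measurable]: "Sm z n \<in> borel_measurable P" using Smm Net(2) z by blast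
    show ?thesis by measurable
  qed
  have BadP: "Bad n \<in> sets P" for n
    unfolding Bad_def by (rule sets.finite_UN[OF Net(1) Badz])
  have prob: "measure P {\<omega>\<in>space P. a n \<le> Sm z n \<omega>} \<le> exp V * real n powr - (d + 2)"
    "measure P {\<omega>\<in>space P. a n \<le> - Sm z n \<omega>} \<le> exp V * real n powr - (d + 2)"
    if n: "n \<ge> 1" and z: "z \<in> cball c r" for n z
  proof -
    have e: "exp (V - a n / sqrt n) = exp V * real n powr - (d + 2)"
    proof -
      have "a n / sqrt n = (d + 2) * ln n" using n by (simp add: a_def field_simps)
      moreover have "real n powr - (d + 2) = exp (- ((d + 2) * ln n))"
        using n unfolding powr_def by (simp add: algebra_simps)
      ultimately show ?thesis by (simp only: exp_diff exp_minus divide_inverse)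
    qed
    have "measure P {\<omega>\<in>space P. a n \<le> (\<Sum>i=1..n. Z z i (\<xi> i \<omega>) - (\<integral>s. Z z i s \<partial>\<mu>))}
       \<le> exp ((\<integral>s. (B s)\<^sup>2 \<partial>\<mu>) - a n / sqrt n)"
      by (rule exp_moment_centred_sum) (use Zm z ZB Zsqrt B2 n in auto)
    then show "measure P {\<omega>\<in>space P. a n \<le> Sm z n \<omega>} \<le> exp V * real n powr - (d + 2)"
      unfolding Sm_def m_def V_def[symmetric] e .
    have "measure P {\<omega>\<in>space P. a n \<le> (\<Sum>i=1..n. - Z z i (\<xi> i \<omega>) - (\<integral>s. - Z z i s \<partial>\<mu>))}
       \<le> exp ((\<integral>s. (B s)\<^sup>2 \<partial>\<mu>) - a n / sqrt n)"
      by (rule exp_moment_centred_sum) (use Zm z ZB Zsqrt B2 n in auto)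
    moreover have "(\<Sum>i=1..n. - Z z i (\<xi> i \<omega>) - (\<integral>s. - Z z i s \<partial>\<mu>)) = - Sm z n \<omega>" for \<omega>
      unfolding Sm_def m_def by (simp add: sum_negf[symmetric])
    ultimately show "measure P {\<omega>\<in>space P. a n \<le> - Sm z n \<omega>} \<le> exp V * real n powr - (d + 2)"
      unfolding V_def[symmetric] e by simp
  qed
  have Badle: "measure P (Bad n) \<le> (2 * A * exp V) * real n powr - 2" for n
  proof (cases "n \<ge> 1")
    case True
    have "measure P (Bad n) \<le> (\<Sum>z\<in>Net n. measure P ({\<omega>\<in>space P. n \<ge> 1 \<and> a n \<le> Sm z n \<omega>} \<union>
      {\<omega>\<in>space P. n \<ge> 1 \<and> a n \<le> - Sm z n \<omega>}))"
      unfolding Bad_def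
    proof (rule P.finite_measure_subadditive_finite[OF Net(1)])
      show "(\<lambda>z. {\<omega>\<in>space P. n \<ge> 1 \<and> a n \<le> Sm z n \<omega>} \<union>
        {\<omega>\<in>space P. n \<ge> 1 \<and> a n \<le> - Sm z n \<omega>}) ` Net n \<subseteq> sets P"
        using Badz by blast
    qed
    also have "\<dots> \<le> (\<Sum>z\<in>Net n. 2 * (exp V * real n powr - (d + 2)))"
    proof (rule sum_mono)
      fix z assume z: "z \<in> Net n"
      then have zc: "z \<in> cball c r" using Net(2) by blast
      have "measure P ({\<omega>\<in>space P. a n \<le> Sm z n \<omega>} \<union> {\<omega>\<in>space P. a n \<le> - Sm z n \<omega>})
        \<le> measure P {\<omega>\<in>space P. a n \<le> Sm z n \<omega>} + measure P {\<omega>\<in>space P. a n \<le> - Sm z n \<omega>}"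
        using Smm[OF zc] by (intro measure_Un_le borel_measurable_le) auto
      then show "measure P ({\<omega>\<in>space P. n \<ge> 1 \<and> a n \<le> Sm z n \<omega>} \<union>
        {\<omega>\<in>space P. n \<ge> 1 \<and> a n \<le> - Sm z n \<omega>}) \<le> 2 * (exp V * real n powr - (d + 2))"
        using prob[OF True zc] True by simp
    qed
    also have "\<dots> = real (card (Net n)) * (2 * (exp V * real n powr - (d + 2)))" by simp
    also have "\<dots> \<le> (A * real n ^ DIM('a)) * (2 * (exp V * real n powr - (d + 2)))"
      using Net(4)[OF True] by (intro mult_right_mono) auto
    also have "\<dots> = (2 * A * exp V) * (real n powr d * real n powr - (d + 2))"
      using True by (simp add: d_def powr_realpow)
    also have "real n powr d * real n powr - (d + 2) = real n powr - 2"
      by (simp add: powr_add[symmetric])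
    finally show ?thesis .
  next
    case False
    then show ?thesis using Net(3) by (simp add: Bad_def)
  qed
  have "summable (\<lambda>n. (2 * A * exp V) * real n powr - 2)"
    by (intro summable_mult) (simp add: summable_real_powr_iff)
  then have "summable (\<lambda>n. measure P (Bad n))"
    by (rule summable_comparison_test'[of _ 0]) (use Badle in auto)
  then have "AE \<omega> in P. eventually (\<lambda>n. \<omega> \<in> space P - Bad n) sequentially"
    by (intro borel_cantelli_AE1 BadP) (auto simp: P.emeasure_eq_measure)
  with eventually_square_le_index[OF B B2] show ?thesis
  proof eventually_elim
    case (elim \<omega>)
    obtain i0 where i0: "\<And>i. i \<ge> i0 \<Longrightarrow> (B (\<xi> i \<omega>))\<^sup>2 \<le> real i"
      using elim(1) by (auto simp: eventually_sequentially)
    have "\<omega> \<in> space P" using elim(2) by (auto simp: eventually_sequentially)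
    then have \<xi>: "\<xi> i \<omega> \<in> space \<mu>" if "i \<ge> 1" for i using sample_in_space that by blast
    \<comment> \<open>Total mass of the finitely many samples that may exceed the cut; it bounds the
      effect of the truncation for every \<open>n\<close> at once.\<close>
    define D where "D = (\<Sum>i<i0. B (\<xi> i \<omega>))"
    have D: "D \<ge> 0" unfolding D_def using Bnn by (intro sum_nonneg) auto
    define cut where "cut i = (if i < i0 then B (\<xi> i \<omega>) else 0)" for i
    have cut: "(\<Sum>i=1..n. cut i) \<le> D" for n
    proof -
      have "(\<Sum>i=1..n. cut i) = (\<Sum>i\<in>{1..n} \<inter> {..<i0}. B (\<xi> i \<omega>))"
        unfolding cut_def by (rule sum.mono_neutral_cong_right) auto
      also have "\<dots> \<le> D" unfolding D_def by (rule sum_mono2) (use Bnn in auto)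
      finally show ?thesis .
    qed
    \<comment> \<open>From \<open>i0\<close> on the envelope is at most \<open>sqrt n\<close>, so
      the average has a Lipschitz constant of order \<open>sqrt n\<close>. A mesh of order
      \<open>1 / n\<close> reduces this to \<open>1 / sqrt n\<close>.\<close>
    have sB: "(\<Sum>i=1..n. B (\<xi> i \<omega>)) \<le> D + n * sqrt n" for n
    proof -
      have "(\<Sum>i=1..n. B (\<xi> i \<omega>)) \<le> (\<Sum>i=1..n. cut i + sqrt n)"
      proof (rule sum_mono)
        fix i assume i: "i \<in> {1..n}"
        have "B (\<xi> i \<omega>) \<le> sqrt n" if "i \<ge> i0"
          using i0[OF that] i by (intro real_le_rsqrt) auto
        then show "B (\<xi> i \<omega>) \<le> cut i + sqrt n" by (auto simp: cut_def)
      qed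
      also have "\<dots> = (\<Sum>i=1..n. cut i) + n * sqrt n" by (simp add: sum.distrib)
      finally show ?thesis using cut[of n] by linarith
    qed
    \<comment> \<open>The terms stem, in this order, from the deviation on the grid, the truncation,
      the bias, and the passage to the nearest grid point in the average (\<open>d * D + d\<close>)
      and in the expectation (\<open>d * W\<close>).\<close>
    define C where "C = (d + 2) + D + 2 * V + d * D + d + d * W"
    have d0: "d \<ge> 0" by (simp add: d_def)
    have "eventually (\<lambda>n. \<omega> \<in> space P - Bad n \<and> n \<ge> 3) sequentially"
      using elim(2) eventually_ge_at_top[of 3] by eventually_elim auto
    then have "eventually (\<lambda>n. \<forall>y\<in>cball c r.
     \<bar>sample_average f (\<lambda>i. \<xi> i \<omega>) n y - expected_fun \<mu> f y\<bar> \<le> C * (ln (real n) / sqrt (real n)))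
     sequentially"
    proof (eventually_elim, intro ballI)
      case (elim n)
      fix y assume y: "y \<in> cball c r"
      have n: "n \<ge> 1" "n \<ge> 3" using elim by auto
      obtain z where z: "z \<in> Net n" "norm (y - z) \<le> d / n"
        using Net(5)[OF n(1) y] by (auto simp: d_def)
      have zc: "z \<in> cball c r" using z Net(2) by blast
      have S: "\<bar>Sm z n \<omega>\<bar> \<le> a n" using elim z n unfolding Bad_def by fastforce
      have 1: "\<bar>(\<Sum>i=1..n. f (\<xi> i \<omega>) z - Z z i (\<xi> i \<omega>))\<bar> \<le> D"
      proof -
        have "\<bar>(\<Sum>i=1..n. f (\<xi> i \<omega>) z - Z z i (\<xi> i \<omega>))\<bar> \<le> (\<Sum>i=1..n. cut i)"
        proof (rule order_trans[OF sum_abs], rule sum_mono)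
          fix i assume i: "i \<in> {1..n}"
          show "\<bar>f (\<xi> i \<omega>) z - Z z i (\<xi> i \<omega>)\<bar> \<le> cut i"
            using i0[of i] fB[OF \<xi> zc, of i] i Bnn by (auto simp: cut_def Z_def)
        qed
        then show ?thesis using cut[of n] by linarith
      qed
      have 2: "\<bar>(\<Sum>i=1..n. m z i - expected_fun \<mu> f z)\<bar> \<le> V * (2 * sqrt n)"
      proof -
        have "\<bar>(\<Sum>i=1..n. m z i - expected_fun \<mu> f z)\<bar> \<le> (\<Sum>i=1..n. V * (1 / sqrt i))"
          by (rule order_trans[OF sum_abs], rule sum_mono) (use bias[OF zc] in auto)
        also have "\<dots> = V * (\<Sum>i=1..n. 1 / sqrt i)" by (simp add: sum_distrib_left)
        also have "\<dots> \<le> V * (2 * sqrt n)" using sum_inverse_sqrt_le[of n] V by (rule mult_left_mono)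
        finally show ?thesis .
      qed
      have 3: "\<bar>(\<Sum>i=1..n. f (\<xi> i \<omega>) y - f (\<xi> i \<omega>) z)\<bar> \<le> (D + n * sqrt n) * (d / n)"
      proof -
        have "\<bar>(\<Sum>i=1..n. f (\<xi> i \<omega>) y - f (\<xi> i \<omega>) z)\<bar> \<le> (\<Sum>i=1..n. B (\<xi> i \<omega>) * (d / n))"
        proof (rule order_trans[OF sum_abs], rule sum_mono)
          fix i assume i: "i \<in> {1..n}"
          have "\<bar>f (\<xi> i \<omega>) y - f (\<xi> i \<omega>) z\<bar> \<le> \<kappa> (\<xi> i \<omega>) * norm (y - z)"
            using lip[OF \<xi> y zc] i by auto
          also have "\<dots> \<le> B (\<xi> i \<omega>) * (d / n)"
            using \<kappa>B[of "\<xi> i \<omega>"] z Bnn by (intro mult_mono) auto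
          finally show "\<bar>f (\<xi> i \<omega>) y - f (\<xi> i \<omega>) z\<bar> \<le> B (\<xi> i \<omega>) * (d / n)" .
        qed
        also have "\<dots> = (\<Sum>i=1..n. B (\<xi> i \<omega>)) * (d / n)" by (simp only: sum_distrib_right)
        also have "\<dots> \<le> (D + n * sqrt n) * (d / n)" using sB d0 by (intro mult_right_mono) auto
        finally show ?thesis .
      qed
      have 4: "\<bar>n * (expected_fun \<mu> f z - expected_fun \<mu> f y)\<bar> \<le> d * W"
      proof -
        have "\<bar>expected_fun \<mu> f z - expected_fun \<mu> f y\<bar> = \<bar>\<integral>s. f s z - f s y \<partial>\<mu>\<bar>"
          unfolding expected_fun_def using iF[OF y] iF[OF zc] by simp
        also have "\<dots> \<le> (\<integral>s. \<bar>f s z - f s y\<bar> \<partial>\<mu>)" by (rule integral_abs_bound)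
        also have "\<dots> \<le> (\<integral>s. B s * (d / n) \<partial>\<mu>)"
        proof (rule integral_mono)
          fix s assume s: "s \<in> space \<mu>"
          have "\<bar>f s z - f s y\<bar> \<le> \<kappa> s * norm (z - y)" using lip[OF s zc y] .
          also have "\<dots> \<le> B s * (d / n)"
            using \<kappa>B[of s] z Bnn by (intro mult_mono) (auto simp: norm_minus_commute)
          finally show "\<bar>f s z - f s y\<bar> \<le> B s * (d / n)" .
        qed (use iF[OF y] iF[OF zc] IB in auto)
        also have "\<dots> = W * (d / n)" by (simp add: W_def)
        finally have "real n * \<bar>expected_fun \<mu> f z - expected_fun \<mu> f y\<bar> \<le> d * W"
          using n by (simp add: field_simps)
        then show ?thesis by (simp only: abs_mult abs_of_nat)
      qed
      have "n * (sample_average f (\<lambda>i. \<xi> i \<omega>) n y - expected_fun \<mu> f y)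
         = (\<Sum>i=1..n. f (\<xi> i \<omega>) y) - n * expected_fun \<mu> f y"
        using n by (simp add: sample_average_def field_simps)
      \<comment> \<open>Route from the average at \<open>y\<close> to the mean at \<open>y\<close>:
        move to the grid point, truncate, centre, remove the bias, move back.\<close>
      also have "\<dots> = (\<Sum>i=1..n. f (\<xi> i \<omega>) y - f (\<xi> i \<omega>) z) + (\<Sum>i=1..n. f (\<xi> i \<omega>) z - Z z i (\<xi> i \<omega>))
         + Sm z n \<omega> + (\<Sum>i=1..n. m z i - expected_fun \<mu> f z) + n * (expected_fun \<mu> f z - expected_fun \<mu> f y)"
        by (simp add: Sm_def sum_subtractf algebra_simps)
      finally have "\<bar>n * (sample_average f (\<lambda>i. \<xi> i \<omega>) n y - expected_fun \<mu> f y)\<bar>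
         \<le> (D + n * sqrt n) * (d / n) + D + a n + V * (2 * sqrt n) + d * W"
        using 1 2 3 4 S by linarith
      also have "\<dots> \<le> C * (sqrt n * ln n)"
      proof -
        \<comment> \<open>From \<open>n = 3\<close> on the logarithm is at least 1, so all terms of
          order 1 and \<open>sqrt n\<close> are absorbed into \<open>sqrt n * ln n\<close>.\<close>
        have "exp 1 \<le> (3::real)" using exp_le by simp
        also have "\<dots> \<le> real n" using n by simp
        finally have "1 \<le> ln (real n)" using n by (simp add: ln_ge_iff)
        moreover have "1 \<le> sqrt n" using n by simp
        ultimately have s: "sqrt n \<le> sqrt n * ln n" "1 \<le> sqrt n * ln n"
          using mult_mono[of 1 "sqrt n" 1 "ln n"] mult_left_mono[of 1 "ln n" "sqrt n"] by auto
        have "(D + n * sqrt n) * (d / n) = d * D / n + d * sqrt n" using n by (simp add: field_simps)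
        also have "d * D / n \<le> d * D / 1" using n d0 D by (intro divide_left_mono) auto
        also have "d * D / 1 \<le> d * D * (sqrt n * ln n)" using s d0 D mult_left_mono[of 1 "sqrt n * ln n" "d * D"] by simp
        finally have "(D + n * sqrt n) * (d / n) \<le> d * D * (sqrt n * ln n) + d * sqrt n" by simp
        moreover have "d * sqrt n \<le> d * (sqrt n * ln n)" "V * sqrt n \<le> V * (sqrt n * ln n)"
          using s d0 V by (auto intro: mult_left_mono)
        moreover have "D \<le> D * (sqrt n * ln n)" "d * W \<le> d * W * (sqrt n * ln n)"
          using s D d0 W mult_left_mono[of 1 "sqrt n * ln n" "d * W"] mult_left_mono[of 1 "sqrt n * ln n" D] by auto
        ultimately show ?thesis unfolding C_def a_def by (simp add: algebra_simps)
      qed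
      finally have fin: "n * \<bar>sample_average f (\<lambda>i. \<xi> i \<omega>) n y - expected_fun \<mu> f y\<bar> \<le> C * (sqrt n * ln n)"
        by (simp add: abs_mult)
      have "real n * (C * (ln (real n) / sqrt (real n))) = C * (sqrt n * ln n)"
        using n by (simp add: field_simps)
      then show "\<bar>sample_average f (\<lambda>i. \<xi> i \<omega>) n y - expected_fun \<mu> f y\<bar> \<le> C * (ln (real n) / sqrt (real n))"
        using fin n by (metis mult_le_cancel_left_pos of_nat_0_less_iff less_le_trans zero_less_one)
    qed
    then show ?case by blast
  qed
qed

text \<open>Only integrability is available: Chebyshev's inequality for the truncated variables controls the
  means along powers of two, and monotonicity of the sums does the rest.\<close>

lemma sample_mean_bounded:
  assumes l: "integrable \<mu> l" and nn: "\<And>s. s \<in> space \<mu> \<Longrightarrow> 0 \<le> (l s :: real)"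
  shows "AE \<omega> in P. \<exists>C. \<forall>n\<ge>1. (\<Sum>i=1..n. l (\<xi> i \<omega>)) \<le> C * real n"
proof -
  have lm[measurable]: "l \<in> borel_measurable \<mu>" using l by auto
  define A where "A = (\<integral>s. l s \<partial>\<mu>)"
  have A: "A \<ge> 0" unfolding A_def by (rule Bochner_Integration.integral_nonneg) (rule nn)
  \<comment> \<open>All of the first \<open>2 ^ j\<close> samples are cut at the same level, so the
    truncated variables of one block remain identically distributed.\<close>
  define Y where "Y j s = min (l s) (2 ^ j)" for j :: nat and s
  have Ym[measurable]: "Y j \<in> borel_measurable \<mu>" for j unfolding Y_def by measurable
  have Y: "0 \<le> Y j s" "Y j s \<le> 2 ^ j" "Y j s \<le> l s" if "s \<in> space \<mu>" for j s
    using nn[OF that] by (auto simp: Y_def)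
  have iY: "integrable \<mu> (Y j)" for j
    by (rule M.integrable_const_bound[of _ "2 ^ j"]) (use Y in \<open>auto intro!: AE_I2\<close>)
  have iY2: "integrable \<mu> (\<lambda>s. (Y j s)\<^sup>2)" for j
  proof (rule M.integrable_const_bound[of _ "(2 ^ j)\<^sup>2"])
    show "AE s in \<mu>. norm ((Y j s)\<^sup>2) \<le> (2 ^ j)\<^sup>2"
      using Y by (auto intro!: AE_I2 power_mono)
  qed auto
  define m where "m j = (\<integral>s. Y j s \<partial>\<mu>)" for j
  have m: "0 \<le> m j" "m j \<le> A" for j
    unfolding m_def A_def using Y l iY by (auto intro!: integral_nonneg integral_mono)
  define t where "t j = (\<integral>s. (Y j s)\<^sup>2 \<partial>\<mu>) / 2 ^ j" for j
  have t: "summable t"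
  proof (rule summableI_nonneg_bounded)
    fix J
    have "(\<Sum>j<J. t j) = (\<integral>s. (\<Sum>j<J. (Y j s)\<^sup>2 / 2 ^ j) \<partial>\<mu>)"
      unfolding t_def using iY2 by (subst Bochner_Integration.integral_sum) auto
    also have "\<dots> \<le> (\<integral>s. 4 * l s \<partial>\<mu>)"
    proof (rule integral_mono)
      show "(\<Sum>j<J. (Y j s)\<^sup>2 / 2 ^ j) \<le> 4 * l s" if "s \<in> space \<mu>" for s
        using sum_truncated_squares_le[OF nn[OF that], of J] by (simp add: Y_def)
    qed (use iY2 l in auto)
    finally show "(\<Sum>j<J. t j) \<le> (\<integral>s. 4 * l s \<partial>\<mu>)" .
  qed (simp add: t_def)
  define D where "D j = {s\<in>space \<mu>. 2 ^ j < l s}" for j :: nat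
  have D[measurable]: "D j \<in> sets \<mu>" for j unfolding D_def by measurable
  \<comment> \<open>Where \<open>l\<close> exceeds \<open>2 ^ j\<close>, the truncated value is
    \<open>2 ^ j\<close>. The quantity \<open>t j\<close> that controls the variance thus also pays
    for the samples altered by the truncation.\<close>
  have D_le: "2 ^ j * measure \<mu> (D j) \<le> t j" for j
  proof -
    have "2 ^ j * measure \<mu> (D j) = (\<integral>s. 2 ^ j * indicator (D j) s \<partial>\<mu>)" by simp
    also have "\<dots> \<le> (\<integral>s. (Y j s)\<^sup>2 / 2 ^ j \<partial>\<mu>)"
    proof (rule integral_mono)
      fix s assume "s \<in> space \<mu>"
      show "2 ^ j * indicator (D j) s \<le> (Y j s)\<^sup>2 / 2 ^ j"
        by (auto simp: D_def Y_def indicator_def power2_eq_square)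
    qed (use iY2 in \<open>auto simp: M.emeasure_eq_measure\<close>)
    finally show ?thesis by (simp add: t_def)
  qed
  define S where "S j \<omega> = (\<Sum>i=1..2^j. Y j (\<xi> i \<omega>) - m j)" for j \<omega>
  have Sm[measurable]: "S j \<in> borel_measurable P" for j
    unfolding S_def
    by (intro borel_measurable_sum borel_measurable_diff borel_measurable_const sample_fun_measurable) auto
  \<comment> \<open>Off this event none of the first \<open>2 ^ j\<close> samples is altered and the
    centred sum stays below \<open>2 ^ j\<close>, so the original sum is at most
    \<open>2 ^ j * (A + 1)\<close>.\<close>
  define Bad where "Bad j = (\<Union>i\<in>{1..2^j}. {\<omega>\<in>space P. \<xi> i \<omega> \<in> D j}) \<union> {\<omega>\<in>space P. 2 ^ j \<le> \<bar>S j \<omega>\<bar>}" for j :: nat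
  have sD: "{\<omega>\<in>space P. \<xi> i \<omega> \<in> D j} \<in> sets P" if "i \<ge> 1" for i j
  proof -
    have "{\<omega>\<in>space P. \<xi> i \<omega> \<in> D j} = \<xi> i -` D j \<inter> space P" by auto
    then show ?thesis using measurable_sets[OF sample_measurable[OF that] D] by simp
  qed
  have sS: "{\<omega>\<in>space P. 2 ^ j \<le> \<bar>S j \<omega>\<bar>} \<in> sets P" for j by measurable
  have sU: "(\<Union>i\<in>{1..2^j}. {\<omega>\<in>space P. \<xi> i \<omega> \<in> D j}) \<in> sets P" for j
    by (rule sets.finite_UN) (use sD in auto)
  have BadP: "Bad j \<in> sets P" for j
    unfolding Bad_def using sU sS by auto
  have S2: "measure P {\<omega>\<in>space P. 2 ^ j \<le> \<bar>S j \<omega>\<bar>} \<le> t j" for j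
  proof -
    define g where "g s = Y j s - m j" for s
    have gm[measurable]: "g \<in> borel_measurable \<mu>" unfolding g_def by measurable
    have gb: "\<bar>g s\<bar> \<le> 2 ^ j + A" if "s \<in> space \<mu>" for s
      using Y[OF that, of j] m[of j] A by (auto simp: g_def)
    have gz: "(\<integral>s. g s \<partial>\<mu>) = 0" unfolding g_def using iY by (simp add: m_def M.prob_space)
    have eq: "(\<integral>\<omega>. (S j \<omega>)\<^sup>2 \<partial>P) = 2 ^ j * (\<integral>s. (g s)\<^sup>2 \<partial>\<mu>)"
      using second_moment_centred_sum[OF gm gb gz, of "2^j"] by (simp add: S_def g_def)
    have var: "(\<integral>s. (g s)\<^sup>2 \<partial>\<mu>) \<le> (\<integral>s. (Y j s)\<^sup>2 \<partial>\<mu>)"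
      using M.variance_eq[OF iY iY2, of j] unfolding g_def m_def by simp
    have iS: "integrable P (\<lambda>\<omega>. (S j \<omega>)\<^sup>2)"
    proof (rule P.integrable_const_bound[of _ "(2 ^ j * (2 ^ j + A))\<^sup>2"])
      have "\<bar>S j \<omega>\<bar> \<le> 2 ^ j * (2 ^ j + A)" if "\<omega> \<in> space P" for \<omega>
      proof -
        have "\<bar>S j \<omega>\<bar> \<le> (\<Sum>i=1..(2::nat)^j. 2 ^ j + A)"
          unfolding S_def
        proof (rule order_trans[OF sum_abs], rule sum_mono)
          fix i assume "i \<in> {1..(2::nat) ^ j}"
          then show "\<bar>Y j (\<xi> i \<omega>) - m j\<bar> \<le> 2 ^ j + A"
            using gb[OF sample_in_space[OF _ that], of i] by (simp add: g_def)
        qed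
        then show ?thesis by simp
      qed
      then show "AE \<omega> in P. norm ((S j \<omega>)\<^sup>2) \<le> (2 ^ j * (2 ^ j + A))\<^sup>2"
        by (auto intro!: AE_I2) (metis abs_ge_zero power2_abs power_mono)
    qed measurable
    have "{\<omega>\<in>space P. 2 ^ j \<le> \<bar>S j \<omega>\<bar>} = {\<omega>\<in>space P. (2 ^ j)\<^sup>2 \<le> (S j \<omega>)\<^sup>2}"
      by (auto simp: abs_le_square_iff[symmetric])
    then have "measure P {\<omega>\<in>space P. 2 ^ j \<le> \<bar>S j \<omega>\<bar>} \<le> (\<integral>\<omega>. (S j \<omega>)\<^sup>2 \<partial>P) / (2 ^ j)\<^sup>2"
      using integral_Markov_inequality_measure[OF iS, of "{}" "(2 ^ j)\<^sup>2"] by simp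
    also have "\<dots> \<le> 2 ^ j * (\<integral>s. (Y j s)\<^sup>2 \<partial>\<mu>) / (2 ^ j)\<^sup>2"
      unfolding eq using var by (intro divide_right_mono mult_left_mono) auto
    also have "\<dots> = t j" by (simp add: t_def power2_eq_square)
    finally show ?thesis .
  qed
  have Bad_le: "measure P (Bad j) \<le> 2 * t j" for j
  proof -
    have "measure P (\<Union>i\<in>{1..2^j}. {\<omega>\<in>space P. \<xi> i \<omega> \<in> D j})
        \<le> (\<Sum>i\<in>{1..(2::nat)^j}. measure P {\<omega>\<in>space P. \<xi> i \<omega> \<in> D j})"
      by (rule P.finite_measure_subadditive_finite) (use sD in auto)
    also have "\<dots> = (\<Sum>i\<in>{1..(2::nat)^j}. measure \<mu> (D j))"
      by (intro sum.cong refl prob_sample) auto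
    also have "\<dots> \<le> t j" using D_le[of j] by simp
    finally have "measure P (\<Union>i\<in>{1..2^j}. {\<omega>\<in>space P. \<xi> i \<omega> \<in> D j}) \<le> t j" .
    then show ?thesis
      unfolding Bad_def using S2[of j] measure_Un_le[OF sU[of j] sS[of j]] by linarith
  qed
  have "summable (\<lambda>j. measure P (Bad j))"
    by (rule summable_comparison_test'[OF summable_mult[OF t, of 2], of 0]) (use Bad_le in auto)
  then have "AE \<omega> in P. eventually (\<lambda>j. \<omega> \<in> space P - Bad j) sequentially"
    by (intro borel_cantelli_AE1 BadP) (auto simp: P.emeasure_eq_measure)
  then show ?thesis
  proof eventually_elim
    case (elim \<omega>)
    then obtain j0 where j0: "\<And>j. j \<ge> j0 \<Longrightarrow> \<omega> \<in> space P - Bad j"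
      by (auto simp: eventually_sequentially)
    then have \<omega>: "\<omega> \<in> space P" by blast
    have dy: "(\<Sum>i=1..2^j. l (\<xi> i \<omega>)) \<le> 2 ^ j * (A + 1)" if j: "j \<ge> j0" for j
    proof -
      have nb: "\<omega> \<notin> Bad j" using j0[OF j] by blast
      have "l (\<xi> i \<omega>) = Y j (\<xi> i \<omega>)" if i: "i \<in> {1..2^j}" for i
      proof -
        have "\<xi> i \<omega> \<notin> D j" using nb i \<omega> unfolding Bad_def by blast
        then show ?thesis using sample_in_space[OF _ \<omega>, of i] i by (auto simp: D_def Y_def)
      qed
      then have "(\<Sum>i=1..2^j. l (\<xi> i \<omega>)) = S j \<omega> + 2 ^ j * m j"
        by (simp add: S_def sum_subtractf)
      also have "S j \<omega> \<le> 2 ^ j"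
        using nb \<omega> unfolding Bad_def by (auto simp: not_le)
      also have "2 ^ j + 2 ^ j * m j \<le> 2 ^ j * (A + 1)" using m[of j] by (simp add: algebra_simps)
      finally show ?thesis by simp
    qed
    show ?case
    \<comment> \<open>The summand \<open>2 ^ j0\<close> covers the sample sizes before the good
      blocks start; the summand 2 is the loss in rounding \<open>n\<close> up to a power of
      two.\<close>
    proof (intro exI[of _ "(2 ^ j0 + 2) * (A + 1)"] allI impI)
      fix n :: nat assume n: "1 \<le> n"
      obtain j where j: "n \<le> 2 ^ j" "2 ^ j \<le> 2 * n" using power_of_two_between[OF n] by auto
      define k where "k = max j j0"
      have kn: "n \<le> 2 ^ k" using j(1) by (rule order_trans) (simp add: k_def)
      have "(\<Sum>i=1..n. l (\<xi> i \<omega>)) \<le> (\<Sum>i=1..2^k. l (\<xi> i \<omega>))"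
        by (rule sum_mono2) (use kn nn sample_in_space[OF _ \<omega>] in auto)
      also have "\<dots> \<le> 2 ^ k * (A + 1)" by (rule dy) (simp add: k_def)
      also have "\<dots> \<le> ((2 ^ j0 + 2) * real n) * (A + 1)"
      proof (rule mult_right_mono)
        have "real (2 ^ j) \<le> real (2 * n)" using j(2) by (rule of_nat_mono)
        then have "(2::real) ^ j \<le> 2 * real n" by simp
        moreover have "(2::real) ^ j0 \<le> 2 ^ j0 * real n" using n by simp
        ultimately show "(2::real) ^ k \<le> (2 ^ j0 + 2) * real n"
          unfolding k_def max_def using n by (auto simp: algebra_simps intro: add_increasing add_increasing2)
      qed (use A in auto)
      finally show "(\<Sum>i=1..n. l (\<xi> i \<omega>)) \<le> (2 ^ j0 + 2) * (A + 1) * real n"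
        by (simp add: mult_ac)
    qed
  qed
qed

end

section \<open>Clarke subgradients\<close>

lemma clarke_tangentD:
  assumes "w \<in> clarke_tangent_cone C x" "X \<longlonglongrightarrow> x" "\<forall>n. X n \<in> C" "\<And>n. 0 < \<tau> n" "\<tau> \<longlonglongrightarrow> 0"
  shows "\<exists>W. W \<longlonglongrightarrow> w \<and> (\<forall>n. X n + \<tau> n *\<^sub>R W n \<in> C)"
  using assms unfolding clarke_tangent_cone_def by blast

text \<open>Along \<open>v\<close> the function rises with slope at most
  \<open>\<kappa> * norm v\<close>, so \<open>(v, \<kappa> * norm v)\<close> is tangent to the
  epigraph. Testing the normal \<open>(v, -1)\<close> against this vector gives the bound.\<close>

lemma clarke_subgradient_norm_le:
  fixes f :: "'a::real_inner \<Rightarrow> real"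
  assumes V: "open V" "x \<in> V" and \<kappa>: "0 \<le> \<kappa>"
    and lip: "\<And>y z. y \<in> V \<Longrightarrow> z \<in> V \<Longrightarrow> \<bar>f y - f z\<bar> \<le> \<kappa> * norm (y - z)"
    and v: "v \<in> clarke_subdifferential (\<lambda>y. ereal (f y)) x"
  shows "norm v \<le> \<kappa>"
proof -
  let ?C = "ereal_epigraph (\<lambda>y. ereal (f y))"
  have "(v, \<kappa> * norm v) \<in> clarke_tangent_cone ?C (x, f x)"
    unfolding clarke_tangent_cone_def
  proof (intro CollectI allI impI, elim conjE)
    fix X :: "nat \<Rightarrow> 'a \<times> real" and \<tau> :: "nat \<Rightarrow> real"
    assume X: "\<forall>n. X n \<in> ?C" "X \<longlonglongrightarrow> (x, f x)" and \<tau>: "\<forall>n. 0 < \<tau> n" "\<tau> \<longlonglongrightarrow> 0"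
    define good where "good n \<longleftrightarrow> fst (X n) \<in> V \<and> fst (X n) + \<tau> n *\<^sub>R v \<in> V" for n
    \<comment> \<open>The value 0 at the finitely many indices outside \<open>V\<close> keeps the
      point in the epigraph without affecting the limit.\<close>
    define W where "W n = (if good n then (v, \<kappa> * norm v) else 0)" for n
    have fX: "(\<lambda>n. fst (X n)) \<longlonglongrightarrow> x" using tendsto_fst[OF X(2)] by simp
    have "(\<lambda>n. fst (X n) + \<tau> n *\<^sub>R v) \<longlonglongrightarrow> x + 0 *\<^sub>R v"
      by (intro tendsto_intros fX \<tau>)
    then have "eventually (\<lambda>n. fst (X n) + \<tau> n *\<^sub>R v \<in> V) sequentially"
      using V by (intro topological_tendstoD) auto
    moreover have "eventually (\<lambda>n. fst (X n) \<in> V) sequentially"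
      using fX V by (intro topological_tendstoD) auto
    ultimately have "eventually good sequentially"
      by eventually_elim (simp add: good_def)
    then have "eventually (\<lambda>n. W n = (v, \<kappa> * norm v)) sequentially"
      by eventually_elim (simp add: W_def)
    then have "W \<longlonglongrightarrow> (v, \<kappa> * norm v)" by (rule tendsto_eventually)
    moreover have "X n + \<tau> n *\<^sub>R W n \<in> ?C" for n
    proof (cases "good n")
      case True
      have "f (fst (X n)) \<le> snd (X n)" using X(1) by (auto simp: ereal_epigraph_def split: prod.splits)
      moreover have "\<bar>f (fst (X n) + \<tau> n *\<^sub>R v) - f (fst (X n))\<bar> \<le> \<kappa> * (\<tau> n * norm v)"
        using lip[of "fst (X n) + \<tau> n *\<^sub>R v" "fst (X n)"] True \<tau>(1)
        by (simp add: good_def less_imp_le)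
      ultimately have "f (fst (X n) + \<tau> n *\<^sub>R v) \<le> snd (X n) + \<tau> n * (\<kappa> * norm v)"
        by (simp add: mult.left_commute)
      then show ?thesis using True by (simp add: W_def ereal_epigraph_def case_prod_unfold)
    qed (use X in \<open>simp add: W_def\<close>)
    ultimately show "\<exists>W. W \<longlonglongrightarrow> (v, \<kappa> * norm v) \<and> (\<forall>n. X n + \<tau> n *\<^sub>R W n \<in> ?C)" by blast
  qed
  then have "(v, -1) \<bullet> (v, \<kappa> * norm v) \<le> 0"
    using v unfolding clarke_subdifferential_def clarke_normal_cone_def real_of_ereal.simps by blast
  then have "norm v * norm v \<le> \<kappa> * norm v"
    by (simp add: power2_norm_eq_inner[symmetric] power2_eq_square)
  then show ?thesis using \<kappa> by (cases "v = 0") auto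
qed

text \<open>An upper bound at \<open>x\<close> says little about the epigraph above \<open>x\<close>
  itself, but the tangent cone may be tested along any base points. Starting from
  \<open>x - \<tau> n *\<^sub>R w\<close>, a step along \<open>w\<close> returns close to
  \<open>x\<close>. The tangent property bounds the rise on the way back by \<open>s\<close>, the
  quadratic bound forces a rise of \<open>v \<bullet> w\<close> up to higher order, and the
  Lipschitz property covers the mismatch at the end.\<close>

lemma quadratic_supergradient_imp_clarke:
  fixes f :: "'a::real_inner \<Rightarrow> real"
  assumes V: "open V" "x \<in> V"
    and lip: "\<And>y z. y \<in> V \<Longrightarrow> z \<in> V \<Longrightarrow> \<bar>f y - f z\<bar> \<le> \<kappa> * norm (y - z)"
    and q: "\<And>y. y \<in> V \<Longrightarrow> f y \<le> f x + v \<bullet> (y - x) + L * (norm (y - x))\<^sup>2"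
  shows "v \<in> clarke_subdifferential (\<lambda>y. ereal (f y)) x"
proof -
  let ?C = "ereal_epigraph (\<lambda>y. ereal (f y))"
  have "v \<bullet> w \<le> s" if T: "(w, s) \<in> clarke_tangent_cone ?C (x, f x)" for w s
  proof -
    define \<tau> where "\<tau> n = inverse (real (Suc n))" for n
    have \<tau>: "\<tau> n > 0" "\<tau> \<longlonglongrightarrow> 0" for n
      using LIMSEQ_inverse_real_of_nat unfolding \<tau>_def[abs_def] by auto
    define a where "a n = x - \<tau> n *\<^sub>R w" for n
    have "(\<lambda>n. x - \<tau> n *\<^sub>R w) \<longlonglongrightarrow> x - 0 *\<^sub>R w" by (intro tendsto_intros \<tau>)
    then have a: "a \<longlonglongrightarrow> x" by (simp add: a_def[abs_def])
    have aV: "eventually (\<lambda>n. a n \<in> V) sequentially"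
      using a V by (intro topological_tendstoD) auto
    have fa: "(\<lambda>n. f (a n)) \<longlonglongrightarrow> f x"
    proof (rule Lim_null_comparison[THEN LIM_zero_cancel])
      show "eventually (\<lambda>n. norm (f (a n) - f x) \<le> \<kappa> * norm (a n - x)) sequentially"
        using aV by eventually_elim (use lip V in auto)
      have "(\<lambda>n. \<kappa> * norm (a n - x)) \<longlonglongrightarrow> \<kappa> * norm (x - x)" by (intro tendsto_intros a)
      then show "(\<lambda>n. \<kappa> * norm (a n - x)) \<longlonglongrightarrow> 0" by simp
    qed
    have "(\<lambda>n. (a n, f (a n))) \<longlonglongrightarrow> (x, f x)" by (intro tendsto_Pair a fa)
    moreover have "\<forall>n. (a n, f (a n)) \<in> ?C" by (simp add: ereal_epigraph_def)
    ultimately obtain W where W: "W \<longlonglongrightarrow> (w, s)" "\<And>n. (a n, f (a n)) + \<tau> n *\<^sub>R W n \<in> ?C"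
      using clarke_tangentD[OF T, of "\<lambda>n. (a n, f (a n))" \<tau>] \<tau> by metis
    have W1: "(\<lambda>n. fst (W n)) \<longlonglongrightarrow> w" and W2: "(\<lambda>n. snd (W n)) \<longlonglongrightarrow> s"
      using tendsto_fst[OF W(1)] tendsto_snd[OF W(1)] by auto
    define b where "b n = a n + \<tau> n *\<^sub>R fst (W n)" for n
    have "b \<longlonglongrightarrow> x + 0 *\<^sub>R w" unfolding b_def[abs_def] by (intro tendsto_intros a \<tau> W1)
    then have bV: "eventually (\<lambda>n. b n \<in> V) sequentially"
      using V by (intro topological_tendstoD) auto
    have fb: "f (b n) \<le> f (a n) + \<tau> n * snd (W n)" for n
      using W(2)[of n] by (simp add: ereal_epigraph_def b_def case_prod_unfold)
    have bx: "b n - x = \<tau> n *\<^sub>R (fst (W n) - w)" for n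
      by (simp add: b_def a_def algebra_simps)
    have ax: "a n - x = - (\<tau> n *\<^sub>R w)" for n by (simp add: a_def)
    have "eventually (\<lambda>n. v \<bullet> w \<le> \<kappa> * norm (fst (W n) - w) + L * \<tau> n * (norm w)\<^sup>2 + snd (W n)) sequentially"
      using aV bV
    proof eventually_elim
      case (elim n)
      have "f (a n) \<le> f x + v \<bullet> (a n - x) + L * (norm (a n - x))\<^sup>2" using q elim by auto
      also have "\<dots> = f x - \<tau> n * (v \<bullet> w) + L * \<tau> n * \<tau> n * (norm w)\<^sup>2"
        using \<tau>(1)[of n] by (simp add: ax power_mult_distrib power2_eq_square[of "\<tau> n"])
      finally have "f (a n) \<le> f x - \<tau> n * (v \<bullet> w) + L * \<tau> n * \<tau> n * (norm w)\<^sup>2" .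
      moreover have "f x - f (b n) \<le> \<kappa> * (\<tau> n * norm (fst (W n) - w))"
        using lip[OF elim(2) V(2)] \<tau>(1)[of n] unfolding bx by simp
      ultimately have "\<tau> n * (v \<bullet> w) \<le> \<kappa> * (\<tau> n * norm (fst (W n) - w)) + L * \<tau> n * \<tau> n * (norm w)\<^sup>2 + \<tau> n * snd (W n)"
        using fb[of n] by linarith
      then have "\<tau> n * (v \<bullet> w) \<le> \<tau> n * (\<kappa> * norm (fst (W n) - w) + L * \<tau> n * (norm w)\<^sup>2 + snd (W n))"
        by (simp add: algebra_simps)
      then show ?case using \<tau>(1)[of n] by simp
    qed
    moreover have "(\<lambda>n. \<kappa> * norm (fst (W n) - w) + L * \<tau> n * (norm w)\<^sup>2 + snd (W n))
        \<longlonglongrightarrow> \<kappa> * norm (w - w) + L * 0 * (norm w)\<^sup>2 + s"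
      by (intro tendsto_intros W1 W2 \<tau>)
    ultimately have "v \<bullet> w \<le> \<kappa> * norm (w - w) + L * 0 * (norm w)\<^sup>2 + s"
      by (intro tendsto_lowerbound[OF _ _ sequentially_bot])
    then show ?thesis by simp
  qed
  then show ?thesis unfolding clarke_subdifferential_def clarke_normal_cone_def by auto
qed

text \<open>For a lower bound the constant base sequence suffices: the tangent property puts points
  close to \<open>x\<close> under a slope \<open>s\<close>, and the quadratic minorant puts them
  above the slope \<open>z \<bullet> w\<close>.\<close>

lemma proximal_subgradient_imp_clarke:
  fixes \<Phi> :: "'a::real_inner \<Rightarrow> ereal"
  assumes V: "open V" "x \<in> V" and p: "\<Phi> x = ereal p"
    and q: "\<And>u. u \<in> V \<Longrightarrow> ereal (p + z \<bullet> (u - x) - C * (norm (u - x))\<^sup>2) \<le> \<Phi> u"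
  shows "z \<in> clarke_subdifferential \<Phi> x"
proof -
  let ?C = "ereal_epigraph \<Phi>"
  have "z \<bullet> w \<le> s" if T: "(w, s) \<in> clarke_tangent_cone ?C (x, p)" for w s
  proof -
    define \<tau> where "\<tau> n = inverse (real (Suc n))" for n
    have \<tau>: "\<tau> n > 0" "\<tau> \<longlonglongrightarrow> 0" for n
      using LIMSEQ_inverse_real_of_nat unfolding \<tau>_def[abs_def] by auto
    have "(\<lambda>n::nat. (x, p)) \<longlonglongrightarrow> (x, p)" by simp
    moreover have "\<forall>n::nat. (x, p) \<in> ?C" by (simp add: ereal_epigraph_def p)
    ultimately obtain W where W: "W \<longlonglongrightarrow> (w, s)" "\<And>n. (x, p) + \<tau> n *\<^sub>R W n \<in> ?C"
      using clarke_tangentD[OF T, of "\<lambda>n. (x, p)" \<tau>] \<tau> by metis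
    have W1: "(\<lambda>n. fst (W n)) \<longlonglongrightarrow> w" and W2: "(\<lambda>n. snd (W n)) \<longlonglongrightarrow> s"
      using tendsto_fst[OF W(1)] tendsto_snd[OF W(1)] by auto
    define b where "b n = x + \<tau> n *\<^sub>R fst (W n)" for n
    have "b \<longlonglongrightarrow> x + 0 *\<^sub>R w" unfolding b_def[abs_def] by (intro tendsto_intros \<tau> W1)
    then have bV: "eventually (\<lambda>n. b n \<in> V) sequentially"
      using V by (intro topological_tendstoD) auto
    have fb: "\<Phi> (b n) \<le> ereal (p + \<tau> n * snd (W n))" for n
      using W(2)[of n] by (simp add: ereal_epigraph_def b_def case_prod_unfold)
    have "eventually (\<lambda>n. z \<bullet> fst (W n) \<le> C * \<tau> n * (norm (fst (W n)))\<^sup>2 + snd (W n)) sequentially"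
      using bV
    proof eventually_elim
      case (elim n)
      have "ereal (p + z \<bullet> (b n - x) - C * (norm (b n - x))\<^sup>2) \<le> ereal (p + \<tau> n * snd (W n))"
        using order_trans[OF q[OF elim] fb] .
      then have "\<tau> n * (z \<bullet> fst (W n)) \<le> \<tau> n * (C * \<tau> n * (norm (fst (W n)))\<^sup>2 + snd (W n))"
        using \<tau>(1)[of n] by (simp add: b_def power_mult_distrib power2_eq_square[of "\<tau> n"] algebra_simps)
      then show ?case using \<tau>(1)[of n] by simp
    qed
    moreover have "(\<lambda>n. C * \<tau> n * (norm (fst (W n)))\<^sup>2 + snd (W n)) \<longlonglongrightarrow> C * 0 * (norm w)\<^sup>2 + s"
      by (intro tendsto_intros W1 W2 \<tau>)
    moreover have "(\<lambda>n. z \<bullet> fst (W n)) \<longlonglongrightarrow> z \<bullet> w" by (intro tendsto_intros W1)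
    ultimately have "z \<bullet> w \<le> C * 0 * (norm w)\<^sup>2 + s"
      by (intro tendsto_le[OF sequentially_bot])
    then show ?thesis by simp
  qed
  then show ?thesis unfolding clarke_subdifferential_def clarke_normal_cone_def by (auto simp: p)
qed

section \<open>Gradients and their relation to subgradients\<close>

lemma differentiable_imp_gradient:
  fixes f :: "'a::euclidean_space \<Rightarrow> real"
  assumes "f differentiable (at x)"
  shows "GDERIV f x :> gradient f x"
proof -
  obtain D where D: "(f has_derivative D) (at x)" using assms by (auto simp: differentiable_def)
  then have lin: "linear D" by (rule has_derivative_linear)
  define g where "g = (\<Sum>b\<in>Basis. D b *\<^sub>R b)"
  have "D h = h \<bullet> g" for h
  proof -
    have "D h = D (\<Sum>b\<in>Basis. (h \<bullet> b) *\<^sub>R b)" by (simp add: euclidean_representation)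
    also have "\<dots> = (\<Sum>b\<in>Basis. (h \<bullet> b) * D b)"
      using lin by (simp add: linear_sum linear_cmul)
    also have "\<dots> = h \<bullet> g" by (simp add: g_def inner_sum_right mult.commute)
    finally show ?thesis .
  qed
  then have Dg: "D = (\<lambda>h. h \<bullet> g)" by auto
  have g: "GDERIV f x :> g" using D unfolding gderiv_def Dg .
  \<comment> \<open>Since \<open>gradient\<close> is a definite description, uniqueness is needed as
    well as existence.\<close>
  have "g' = g" if g': "GDERIV f x :> g'" for g'
  proof -
    have "(\<lambda>h. h \<bullet> g') = (\<lambda>h. h \<bullet> g)"
      using g' g unfolding gderiv_def by (rule has_derivative_unique)
    then have "(g' - g) \<bullet> g' = (g' - g) \<bullet> g" by metis
    then have "(g' - g) \<bullet> (g' - g) = 0" by (simp add: inner_diff_right)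
    then show ?thesis by simp
  qed
  with g show ?thesis unfolding gradient_def by (rule theI)
qed

text \<open>The quadratic model minus \<open>f\<close> has a local minimum at \<open>x\<close>, so
  its derivative vanishes. Together with the upper-C2 inequality this identifies whatever Clarke
  subgradient the algorithm picks at a point of differentiability.\<close>

lemma quadratic_supergradient_eq_gradient:
  fixes f :: "'a::euclidean_space \<Rightarrow> real"
  assumes V: "open V" "x \<in> V" and f: "f differentiable (at x)"
    and q: "\<And>y. y \<in> V \<Longrightarrow> f y \<le> f x + v \<bullet> (y - x) + L * (norm (y - x))\<^sup>2"
  shows "v = gradient f x"
proof -
  define g where "g = gradient f x"
  have fd: "(f has_derivative (\<lambda>h. h \<bullet> g)) (at x)"
    using differentiable_imp_gradient[OF f] by (simp add: gderiv_def g_def)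
  define h where "h y = f x + v \<bullet> (y - x) + L * ((y - x) \<bullet> (y - x)) - f y" for y
  have "(h has_derivative (\<lambda>d. v \<bullet> d - d \<bullet> g)) (at x)"
    unfolding h_def by (auto intro!: derivative_eq_intros fd)
  moreover have "eventually (\<lambda>y. h x \<le> h y) (at x)"
  proof -
    have "eventually (\<lambda>y. y \<in> V) (at x)" using V by (intro eventually_at_in_open') auto
    then show ?thesis by eventually_elim (use q in \<open>force simp: h_def power2_norm_eq_inner\<close>)
  qed
  ultimately have "(\<lambda>d. v \<bullet> d - d \<bullet> g) = (\<lambda>d. 0)" by (rule has_derivative_local_min)
  then have "v \<bullet> (v - g) - (v - g) \<bullet> g = 0" by metis
  then have "(v - g) \<bullet> (v - g) = 0" by (simp add: inner_diff inner_commute)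
  then show ?thesis by (simp add: g_def)
qed

text \<open>Remainder in mean value form along the segment. It gives the constant
  \<open>\<kappa>\<close> itself, and integrability of \<open>\<kappa>\<close> later lets the
  estimate pass to the expectation.\<close>

lemma lipschitz_gradient_taylor:
  fixes f :: "'a::euclidean_space \<Rightarrow> real"
  assumes S: "convex S" and d: "\<And>y. y \<in> S \<Longrightarrow> f differentiable (at y)"
    and lip: "\<And>y z. y \<in> S \<Longrightarrow> z \<in> S \<Longrightarrow> norm (gradient f y - gradient f z) \<le> \<kappa> * norm (y - z)"
    and yu: "y \<in> S" "u \<in> S"
  shows "\<bar>f u - f y - gradient f y \<bullet> (u - y)\<bar> \<le> \<kappa> * (norm (u - y))\<^sup>2"
proof (cases "u = y")
  case False
  \<comment> \<open>The sign of the modulus follows from the Lipschitz inequality at two distinct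
    points.\<close>
  have "0 \<le> \<kappa> * norm (u - y)" using lip[OF yu(2) yu(1)] norm_ge_zero order_trans by blast
  then have \<kappa>: "0 \<le> \<kappa>" using False by (simp add: zero_le_mult_iff)
  define p where "p t = y + t *\<^sub>R (u - y)" for t :: real
  have pS: "p t \<in> S" if "0 \<le> t" "t \<le> 1" for t
  proof -
    have "(1 - t) *\<^sub>R y + t *\<^sub>R u \<in> S" using convexD[OF S yu, of "1 - t" t] that by auto
    then show ?thesis by (simp add: p_def algebra_simps)
  qed
  have der: "DERIV (\<lambda>t. f (p t)) t :> gradient f (p t) \<bullet> (u - y)" if "0 \<le> t" "t \<le> 1" for t
  proof -
    have "(f has_derivative (\<lambda>h. h \<bullet> gradient f (p t))) (at (p t))"
      using differentiable_imp_gradient[OF d[OF pS[OF that]]] by (simp add: gderiv_def)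
    moreover have "(p has_derivative (\<lambda>h. h *\<^sub>R (u - y))) (at t)"
      unfolding p_def by (auto intro!: derivative_eq_intros)
    ultimately have "((\<lambda>t. f (p t)) has_derivative (\<lambda>h. (h *\<^sub>R (u - y)) \<bullet> gradient f (p t))) (at t)"
      by (rule has_derivative_compose[rotated])
    then show ?thesis unfolding has_field_derivative_def
      by (rule has_derivative_eq_rhs) (auto simp: inner_commute)
  qed
  obtain t where t: "0 < t" "t < 1" "f (p 1) - f (p 0) = (1 - 0) * (gradient f (p t) \<bullet> (u - y))"
    using MVT2[of 0 1 "\<lambda>t. f (p t)" "\<lambda>t. gradient f (p t) \<bullet> (u - y)"] der by auto
  have "f u - f y - gradient f y \<bullet> (u - y) = (gradient f (p t) - gradient f y) \<bullet> (u - y)"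
    using t(3) by (simp add: p_def inner_diff_left)
  also have "\<bar>\<dots>\<bar> \<le> norm (gradient f (p t) - gradient f y) * norm (u - y)"
    by (rule Cauchy_Schwarz_ineq2)
  also have "\<dots> \<le> (\<kappa> * norm (p t - y)) * norm (u - y)"
    using lip[OF pS yu(1), of t] t by (intro mult_right_mono) auto
  also have "\<dots> \<le> (\<kappa> * norm (u - y)) * norm (u - y)"
    using \<kappa> t by (intro mult_right_mono mult_left_mono) (auto simp: p_def mult_left_le_one_le)
  finally show ?thesis by (simp add: power2_eq_square mult.assoc)
qed auto

section \<open>Descent sequences under the KL inequality\<close>

text \<open>After division by the sum both fractions lie in [0, 1], where raising to a power at most
  1 increases them.\<close>

lemma powr_add_le:
  fixes a b :: real
  assumes "0 \<le> a" "0 \<le> b" "0 < r" "r \<le> 1"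
  shows "(a + b) powr r \<le> a powr r + b powr r"
proof (cases "a + b = 0")
  case False
  define s where "s = a + b"
  have s: "s > 0" using False assms by (simp add: s_def)
  have *: "x / s \<le> (x / s) powr r" if "0 \<le> x" "x \<le> s" for x
    using powr_mono'[of r 1 "x / s"] assms that s by simp
  have "1 = a / s + b / s" using s by (simp add: s_def add_divide_distrib[symmetric])
  also have "\<dots> \<le> (a / s) powr r + (b / s) powr r"
    using *[of a] *[of b] assms by (simp add: s_def)
  also have "\<dots> = (a powr r + b powr r) / s powr r"
    using assms s by (simp add: powr_divide add_divide_distrib)
  finally show ?thesis using s by (simp add: s_def field_simps)
qed (use assms in auto)

text \<open>Tangent inequality for the concave map \<open>t powr (1 - r)\<close> at
  \<open>w\<close>, multiplied by \<open>w powr r\<close>; it is Young's inequality in disguise. It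
  turns a decrease of the potential into a decrease of its desingularized value.\<close>

lemma powr_diff_concave:
  fixes u w :: real
  assumes "0 < u" "0 < w" "0 < r" "r < 1"
  shows "(1 - r) * (w - u) \<le> w powr r * (w powr (1 - r) - u powr (1 - r))"
proof -
  have "w powr r * u powr (1 - r) \<le> r * w + (1 - r) * u"
    using Youngs_inequality_0[of r "1 - r" w u] assms by simp
  moreover have "w powr r * w powr (1 - r) = w" using assms by (simp add: powr_add[symmetric])
  ultimately show ?thesis by (simp add: algebra_simps)
qed

lemma two_mult_le_add:
  fixes d x y :: real
  assumes "0 \<le> x" "0 \<le> y" "d\<^sup>2 \<le> x * y"
  shows "2 * d \<le> x + y"
proof -
  have "(2 * d)\<^sup>2 \<le> (x + y)\<^sup>2"
  proof -
    have "(x + y)\<^sup>2 = (x - y)\<^sup>2 + 4 * (x * y)" by (simp add: power2_eq_square algebra_simps)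
    moreover have "(2 * d)\<^sup>2 = 4 * d\<^sup>2" by (simp add: power_mult_distrib)
    ultimately show ?thesis using assms(3) zero_le_power2[of "x - y"] by linarith
  qed
  then show ?thesis by (rule power2_le_imp_le) (use assms(1,2) in simp)
qed

lemma tail_suminf_Suc:
  fixes e :: "nat \<Rightarrow> real"
  assumes "summable e"
  shows "(\<Sum>t. e (k + t)) = e k + (\<Sum>t. e (Suc k + t))"
proof -
  have "summable (\<lambda>t. e (k + t))" using summable_ignore_initial_segment[OF assms, of k] by (simp add: add.commute)
  from suminf_split_head[OF this] show ?thesis by simp
qed

lemma tail_suminf_nonneg:
  fixes e :: "nat \<Rightarrow> real"
  assumes "summable e" "\<And>k. 0 \<le> e k"
  shows "0 \<le> (\<Sum>t. e (k + t))"
  using summable_ignore_initial_segment[OF assms(1), of k] assms(2)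
  by (intro suminf_nonneg) (auto simp: add.commute)

lemma tail_suminf_tendsto_0:
  fixes e :: "nat \<Rightarrow> real"
  assumes "summable e"
  shows "(\<lambda>k. \<Sum>t. e (k + t)) \<longlonglongrightarrow> 0"
proof -
  have "(\<lambda>k. suminf e - (\<Sum>i<k. e i)) \<longlonglongrightarrow> suminf e - suminf e"
    using summable_LIMSEQ[OF assms] by (intro tendsto_intros)
  moreover have "(\<Sum>t. e (k + t)) = suminf e - (\<Sum>i<k. e i)" for k
    using suminf_split_initial_segment[OF assms, of k] by (simp add: add.commute)
  ultimately show ?thesis by simp
qed

text \<open>Finite-length argument with errors. Adding \<open>A * T\<close> to the gap makes the
  inexact descent monotone; the price is an additional \<open>T powr \<beta>\<close> when the KL
  bound is transferred from \<open>D\<close> to \<open>\<Psi>\<close>. As the KL bound holds only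
  inside the ball, confinement to the ball and finite length have to be proved together.\<close>

lemma KL_descent_convergence:
  fixes X :: "nat \<Rightarrow> 'a::real_normed_vector" and D e :: "nat \<Rightarrow> real" and A :: real
  defines "d \<equiv> \<lambda>k. norm (X (Suc k) - X k)" and "T \<equiv> \<lambda>k. \<Sum>t. e (k + t)"
  defines "\<Psi> \<equiv> \<lambda>k. D k + A * T k"
  assumes \<beta>: "0 < \<beta>" "\<beta> < 1" and \<sigma>: "0 < \<sigma>" and A: "0 \<le> A" and \<delta>: "0 < \<delta>"
    and pos: "\<And>k. k \<ge> K \<Longrightarrow> 0 < D k" and e: "\<And>k. 0 \<le> e k" and se: "summable e"
    and desc: "\<And>k. k \<ge> K \<Longrightarrow> D (Suc k) + \<sigma> * (d k)\<^sup>2 \<le> D k + A * e k"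
    and sT: "summable (\<lambda>k. T k powr \<beta>)"
    and D0: "D \<longlonglongrightarrow> 0"
    and kl: "\<And>k. k \<ge> K \<Longrightarrow> X k \<in> ball xbar \<delta> \<Longrightarrow> X (Suc k) \<in> ball xbar \<delta> \<Longrightarrow>
        D (Suc k) powr \<beta> \<le> c * (d k + e k)"
    and sub: "strict_mono r" "(X \<circ> r) \<longlonglongrightarrow> xbar"
  shows "X \<longlonglongrightarrow> xbar"
    and "\<exists>B. eventually (\<lambda>k. norm (X (Suc k) - xbar) \<le>
        d k + (\<Sum>t. e (k + t) + T (Suc k + t) powr \<beta>) + B * \<Psi> (Suc k) powr (1 - \<beta>)) sequentially"
proof -
  have T0: "T \<longlonglongrightarrow> 0" unfolding T_def by (rule tail_suminf_tendsto_0[OF se])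
  have TS: "T k = e k + T (Suc k)" for k unfolding T_def by (rule tail_suminf_Suc[OF se])
  have Tn: "0 \<le> T k" for k
    unfolding T_def by (rule tail_suminf_nonneg[OF se e])
  have \<Psi>pos: "\<Psi> k > 0" if "k \<ge> K" for k
    unfolding \<Psi>_def using pos[OF that] A Tn[of k] by (intro add_pos_nonneg) auto
  have \<Psi>desc: "\<sigma> * (d k)\<^sup>2 \<le> \<Psi> k - \<Psi> (Suc k)" if "k \<ge> K" for k
    using desc[OF that] TS[of k] unfolding \<Psi>_def by (simp add: algebra_simps)
  have \<Psi>0: "\<Psi> \<longlonglongrightarrow> 0"
    unfolding \<Psi>_def using tendsto_add[OF D0 tendsto_mult_left[OF T0, of A]] by simp
  have d0: "d \<longlonglongrightarrow> 0"
  proof -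
    have "(\<lambda>k. sqrt ((\<Psi> k - \<Psi> (Suc k)) / \<sigma>)) \<longlonglongrightarrow> sqrt ((0 - 0) / \<sigma>)"
      using \<sigma> by (intro tendsto_intros \<Psi>0 LIMSEQ_Suc) auto
    then have "(\<lambda>k. sqrt ((\<Psi> k - \<Psi> (Suc k)) / \<sigma>)) \<longlonglongrightarrow> 0" by simp
    moreover have "eventually (\<lambda>k. norm (d k) \<le> sqrt ((\<Psi> k - \<Psi> (Suc k)) / \<sigma>)) sequentially"
      using eventually_ge_at_top[of K]
    proof eventually_elim
      case (elim k)
      have "(d k)\<^sup>2 \<le> (\<Psi> k - \<Psi> (Suc k)) / \<sigma>" using \<Psi>desc[OF elim] \<sigma> by (simp add: field_simps)
      then show ?case by (simp add: real_le_rsqrt d_def)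
    qed
    ultimately show ?thesis by (rule Lim_null_comparison[rotated])
  qed
  \<comment> \<open>The part of the KL bound for \<open>\<Psi>\<close> that is not due to
    steps.\<close>
  define u where "u k = e k + T (Suc k) powr \<beta>" for k
  have su: "summable u"
    unfolding u_def using se sT summable_Suc_iff[of "\<lambda>k. T k powr \<beta>"] by (intro summable_add) auto
  define U where "U k = (\<Sum>t. u (k + t))" for k
  have U0: "U \<longlonglongrightarrow> 0" unfolding U_def by (rule tail_suminf_tendsto_0[OF su])
  have US: "U k = u k + U (Suc k)" for k unfolding U_def by (rule tail_suminf_Suc[OF su])
  have un: "0 \<le> u k" for k using e by (simp add: u_def)
  have Un: "0 \<le> U k" for k
    unfolding U_def by (rule tail_suminf_nonneg[OF su un])
  \<comment> \<open>A common constant for the KL bound and the factor \<open>A powr \<beta>\<close>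
    of the tail; adding 1 makes it positive whatever the sign of \<open>c\<close>.\<close>
  define c1 where "c1 = max c (A powr \<beta>) + 1"
  have c1: "c1 > 0" "c \<le> c1" "A powr \<beta> \<le> c1"
    using powr_ge_zero[of A \<beta>] unfolding c1_def by linarith+
  define c2 where "c2 = c1 / ((1 - \<beta>) * \<sigma>)"
  have c2: "c2 \<ge> 0" using c1 \<beta> \<sigma> by (simp add: c2_def)
  \<comment> \<open>\<open>H\<close> dominates the remaining path length, since \<open>d (Suc k) + H (Suc k) \<le> H k\<close> near \<open>xbar\<close>.\<close>
  define H where "H k = d k + U k + c2 * \<Psi> (Suc k) powr (1 - \<beta>)" for k
  have dn: "0 \<le> d k" for k by (simp add: d_def)
  have dH: "d k \<le> H k" for k using Un[of k] c2 by (simp add: H_def)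
  have Hn: "0 \<le> H k" for k using Un[of k] c2 dn[of k] by (simp add: H_def)
  have H0: "H \<longlonglongrightarrow> 0"
  proof -
    have P0: "(\<lambda>k. \<Psi> (Suc k) powr (1 - \<beta>)) \<longlonglongrightarrow> 0 powr (1 - \<beta>)"
    proof (rule tendsto_powr2[OF LIMSEQ_Suc[OF \<Psi>0] tendsto_const])
      show "eventually (\<lambda>k. 0 \<le> \<Psi> (Suc k)) sequentially"
        using eventually_ge_at_top[of K] by eventually_elim (simp add: \<Psi>pos less_imp_le)
    qed (use \<beta> in auto)
    have "H \<longlonglongrightarrow> 0 + 0 + c2 * 0 powr (1 - \<beta>)"
      unfolding H_def by (intro tendsto_add tendsto_mult tendsto_const d0 U0 P0)
    then show ?thesis by simp
  qed
  have step: "d (Suc k) + H (Suc k) \<le> H k"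
    if k: "k \<ge> K" and b: "X k \<in> ball xbar \<delta>" "X (Suc k) \<in> ball xbar \<delta>" for k
  proof -
    define R where "R = d k + u k"
    have Rn: "R \<ge> 0" using dn[of k] un[of k] by (simp add: R_def)
    let ?\<Theta> = "\<lambda>k. \<Psi> k powr (1 - \<beta>)"
    have p1: "\<Psi> (Suc k) > 0" "\<Psi> (Suc (Suc k)) > 0" using \<Psi>pos k by auto
    have "\<Psi> (Suc k) powr \<beta> \<le> D (Suc k) powr \<beta> + (A * T (Suc k)) powr \<beta>"
      unfolding \<Psi>_def using \<beta> pos[of "Suc k"] k A Tn by (intro powr_add_le) auto
    also have "\<dots> \<le> c * (d k + e k) + A powr \<beta> * T (Suc k) powr \<beta>"
      using kl[OF k b] A Tn by (simp add: powr_mult)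
    also have "\<dots> \<le> c1 * (d k + e k) + c1 * T (Suc k) powr \<beta>"
      using c1 dn[of k] e[of k] by (intro add_mono mult_right_mono) auto
    also have "\<dots> = c1 * R" by (simp add: R_def u_def algebra_simps)
    finally have \<Psi>R: "\<Psi> (Suc k) powr \<beta> \<le> c1 * R" .
    have de: "0 \<le> \<Psi> (Suc k) - \<Psi> (Suc (Suc k))"
    proof -
      have "0 \<le> \<sigma> * (d (Suc k))\<^sup>2" using \<sigma> by simp
      then show ?thesis using \<Psi>desc[OF le_SucI[OF k]] by linarith
    qed
    then have \<Theta>de: "0 \<le> ?\<Theta> (Suc k) - ?\<Theta> (Suc (Suc k))"
      using p1 \<beta> by (simp add: powr_mono2)
    have "(1 - \<beta>) * (\<sigma> * (d (Suc k))\<^sup>2) \<le> (1 - \<beta>) * (\<Psi> (Suc k) - \<Psi> (Suc (Suc k)))"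
      using \<Psi>desc[of "Suc k"] k \<beta> by (intro mult_left_mono) auto
    also have "\<dots> \<le> \<Psi> (Suc k) powr \<beta> * (?\<Theta> (Suc k) - ?\<Theta> (Suc (Suc k)))"
      using powr_diff_concave[OF p1(2) p1(1) \<beta>] .
    also have "\<dots> \<le> (c1 * R) * (?\<Theta> (Suc k) - ?\<Theta> (Suc (Suc k)))"
      using \<Psi>R \<Theta>de by (rule mult_right_mono)
    finally have "((1 - \<beta>) * \<sigma>) * (d (Suc k))\<^sup>2 \<le> (c1 * R) * (?\<Theta> (Suc k) - ?\<Theta> (Suc (Suc k)))"
      by (simp add: mult.assoc)
    then have "(d (Suc k))\<^sup>2 \<le> R * (c2 * (?\<Theta> (Suc k) - ?\<Theta> (Suc (Suc k))))"
      using \<beta> \<sigma> by (simp add: c2_def pos_le_divide_eq mult.commute mult.left_commute)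
    \<comment> \<open>The factor 2 is decisive: \<open>R\<close> contains the previous step once, so
      after cancellation against \<open>H\<close> one copy of \<open>d (Suc k)\<close> is left to be
      summed.\<close>
    then have "2 * d (Suc k) \<le> R + c2 * (?\<Theta> (Suc k) - ?\<Theta> (Suc (Suc k)))"
      using Rn c2 \<Theta>de by (intro two_mult_le_add) auto
    then show ?thesis using US[of k] by (simp add: H_def R_def algebra_simps)
  qed
  \<comment> \<open>Length covered since \<open>X (Suc j)\<close> plus remaining budget never
    exceeds the initial budget \<open>H j\<close>. Membership of two consecutive iterates is carried
    along because \<open>step\<close> requires both.\<close>
  have trap: "norm (X (Suc j + m) - X (Suc j)) + H (j + m) \<le> H j \<and> X (j + m) \<in> ball xbar \<delta> \<and> X (Suc (j + m)) \<in> ball xbar \<delta>"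
    if j: "j \<ge> K" and b: "X j \<in> ball xbar \<delta>" "norm (X (Suc j) - xbar) + H j < \<delta>" for j m
  proof (induction m)
    case 0
    show ?case using b Hn[of j] by (auto simp: dist_norm norm_minus_commute)
  next
    case (Suc m)
    then have s: "d (Suc (j + m)) + H (Suc (j + m)) \<le> H (j + m)" using step[of "j + m"] j by auto
    have "norm (X (Suc j + Suc m) - X (Suc j)) \<le> norm (X (Suc j + m) - X (Suc j)) + d (Suc (j + m))"
      using norm_triangle_ineq[of "X (Suc (Suc (j + m))) - X (Suc (j + m))" "X (Suc (j + m)) - X (Suc j)"]
      by (simp add: d_def)
    then have 1: "norm (X (Suc j + Suc m) - X (Suc j)) + H (j + Suc m) \<le> H j"
      using Suc s by simp
    have "norm (X (Suc j + Suc m) - xbar) \<le> norm (X (Suc j + Suc m) - X (Suc j)) + norm (X (Suc j) - xbar)"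
      using norm_triangle_ineq[of "X (Suc j + Suc m) - X (Suc j)" "X (Suc j) - xbar"] by simp
    also have "\<dots> < \<delta>" using 1 b(2) Hn[of "j + Suc m"] by linarith
    finally show ?case using 1 Suc by (auto simp: dist_norm norm_minus_commute)
  qed
  \<comment> \<open>The three thirds pay for the distance of the starting iterate, for its first
    step, which is at most \<open>H\<close>, and for the budget \<open>H\<close> itself.\<close>
  have "eventually (\<lambda>i. K \<le> r i \<and> dist (X (r i)) xbar < \<delta> / 3 \<and> dist (H (r i)) 0 < \<delta> / 3) sequentially"
  proof (intro eventually_conj)
    show "eventually (\<lambda>i. K \<le> r i) sequentially"
      using filterlim_subseq[OF sub(1)] by (simp add: filterlim_at_top)
    show "eventually (\<lambda>i. dist (X (r i)) xbar < \<delta> / 3) sequentially"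
      using tendstoD[OF sub(2), of "\<delta> / 3"] \<delta> by simp
    show "eventually (\<lambda>i. dist (H (r i)) 0 < \<delta> / 3) sequentially"
      using tendstoD[OF LIMSEQ_subseq_LIMSEQ[OF H0 sub(1)], of "\<delta> / 3"] \<delta> by simp
  qed
  then obtain k0 where k0: "K \<le> k0" "dist (X k0) xbar < \<delta> / 3" "H k0 < \<delta> / 3"
    using Hn by (auto simp: eventually_sequentially)
  have "norm (X (Suc k0) - xbar) \<le> d k0 + norm (X k0 - xbar)"
    unfolding d_def using norm_triangle_ineq[of "X (Suc k0) - X k0" "X k0 - xbar"] by simp
  then have "norm (X (Suc k0) - xbar) + H k0 < \<delta>"
    using k0 dH[of k0] by (simp add: dist_norm)
  moreover have "X k0 \<in> ball xbar \<delta>" using k0 \<delta> by (simp add: dist_commute)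
  ultimately have inb: "X k \<in> ball xbar \<delta>" if "k \<ge> k0" for k
    using trap[OF k0(1), of "k - k0"] that by auto
  have tail: "norm (X (Suc j + m) - X (Suc j)) \<le> H j" if j: "j \<ge> k0" for j m
  proof -
    have "norm (X (Suc j + m) - X (Suc j)) + H (j + m) \<le> H j"
    proof (induction m)
      case (Suc m)
      have "d (Suc (j + m)) + H (Suc (j + m)) \<le> H (j + m)" using step[of "j + m"] j k0 inb by auto
      moreover have "norm (X (Suc j + Suc m) - X (Suc j)) \<le> norm (X (Suc j + m) - X (Suc j)) + d (Suc (j + m))"
        using norm_triangle_ineq[of "X (Suc (Suc (j + m))) - X (Suc (j + m))" "X (Suc (j + m)) - X (Suc j)"]
        by (simp add: d_def)
      ultimately show ?case using Suc by simp
    qed simp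
    then show ?thesis using Hn[of "j + m"] by linarith
  qed
  \<comment> \<open>The tail bound does not depend on the later index, so it survives the limit
    along the subsequence.\<close>
  have fin: "norm (X (Suc j) - xbar) \<le> H j" if j: "j \<ge> k0" for j
  proof -
    have "eventually (\<lambda>i. norm ((X \<circ> r) i - X (Suc j)) \<le> H j) sequentially"
    proof -
      have "eventually (\<lambda>i. Suc j \<le> r i) sequentially"
        using filterlim_subseq[OF sub(1)] by (simp add: filterlim_at_top)
      then show ?thesis
      proof eventually_elim
        case (elim i)
        then show ?case using tail[OF j, of "r i - Suc j"] by simp
      qed
    qed
    moreover have "(\<lambda>i. norm ((X \<circ> r) i - X (Suc j))) \<longlonglongrightarrow> norm (xbar - X (Suc j))"
      by (intro tendsto_intros sub)
    ultimately have "norm (xbar - X (Suc j)) \<le> H j"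
      by (intro tendsto_upperbound[OF _ _ sequentially_bot])
    then show ?thesis by (simp add: norm_minus_commute)
  qed
  have ev: "eventually (\<lambda>k. norm (X (Suc k) - xbar) \<le> H k) sequentially"
    using eventually_ge_at_top[of k0] by eventually_elim (rule fin)
  then have "(\<lambda>k. X (Suc k) - xbar) \<longlonglongrightarrow> 0" by (rule Lim_null_comparison[OF _ H0])
  then show "X \<longlonglongrightarrow> xbar" by (simp add: LIM_zero_iff filterlim_sequentially_Suc)
  show "\<exists>B. eventually (\<lambda>k. norm (X (Suc k) - xbar) \<le>
        d k + (\<Sum>t. e (k + t) + T (Suc k + t) powr \<beta>) + B * \<Psi> (Suc k) powr (1 - \<beta>)) sequentially"
    using ev by (intro exI[of _ c2]) (simp add: H_def U_def u_def)
qed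

section \<open>Decay rates of recurrences, tail sums and sample errors\<close>

text \<open>Comparison with \<open>B * g\<close>, where \<open>g k = ln k * k powr - p\<close>. If
  the bound first failed at \<open>Suc k\<close>, the left side would be at least of order
  \<open>B powr s\<close> and the right side at most of order \<open>B\<close>, a contradiction for
  large \<open>B\<close> because \<open>s > 1\<close>. The two conditions on \<open>p * s\<close>
  ensure that neither the decrease of \<open>g\<close>, of order \<open>k powr - (p + 1)\<close>,
  nor the error, of order \<open>k powr - (a + 1)\<close>, is larger than
  \<open>k powr - (p * s)\<close> up to logarithms.\<close>

lemma powr_recurrence_rate:
  fixes D :: "nat \<Rightarrow> real"
  assumes s: "1 < s" and p: "0 < p" "p * s \<le> p + 1" "p * s \<le> a + 1" and c: "0 < c" and C: "0 \<le> C"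
    and rec: "\<And>k. k \<ge> K \<Longrightarrow> D (Suc k) powr s \<le>
        c * (D k - D (Suc k) + C * (ln (real k) * real k powr - (a + 1)))"
  shows "\<exists>B. eventually (\<lambda>k. D k \<le> B * (ln (real k) * real k powr - p)) sequentially"
proof -
  define g where "g k = ln (real k) * real k powr - p" for k :: nat
  define K1 where "K1 = max K 3"
  have ln1: "1 \<le> ln (real k)" if "k \<ge> K1" for k
  proof -
    have "exp 1 \<le> (3::real)" using exp_le by simp
    also have "\<dots> \<le> real k" using that by (simp add: K1_def)
    finally show ?thesis using that by (simp add: ln_ge_iff K1_def)
  qed
  have gp: "g k > 0" if "k \<ge> K1" for k
    using ln1[OF that] that by (auto simp: g_def K1_def)
  \<comment> \<open>The factor \<open>2 powr (p * s)\<close> is the loss from replacing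
    \<open>Suc k\<close> by \<open>2 * k\<close>; adding 1 makes the final comparison
    strict.\<close>
  define Q where "Q = 2 powr (p * s) * c * (p + C) + 1"
  have Q: "Q > 0" unfolding Q_def using c p C by (intro add_nonneg_pos mult_nonneg_nonneg) auto
  \<comment> \<open>The quotient \<open>D K1 / g K1\<close> settles the base case, and the power of
    \<open>Q\<close> is the size at which \<open>B powr (s - 1)\<close> wins.\<close>
  define B where "B = max 1 (max (D K1 / g K1) (Q powr (1 / (s - 1))))"
  have "D K1 / g K1 \<le> B" by (simp add: B_def)
  then have B1: "B \<ge> 1" "D K1 \<le> B * g K1" "Q powr (1 / (s - 1)) \<le> B"
    using gp[of K1] by (auto simp: B_def pos_divide_le_eq)
  have "Q = (Q powr (1 / (s - 1))) powr (s - 1)" using Q s by (simp add: powr_powr)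
  also have "\<dots> \<le> B powr (s - 1)" using B1 s by (intro powr_mono2) auto
  finally have QB: "2 powr (p * s) * c * (p + C) < B powr (s - 1)" by (simp add: Q_def)
  have "2 powr (p * s) * (c * (B * p + C)) \<le> B * (2 powr (p * s) * c * (p + C))"
  proof -
    have "C \<le> B * C" using B1 C by (simp add: mult_le_cancel_right1)
    then have "B * p + C \<le> B * (p + C)" by (simp add: algebra_simps)
    then have "(2 powr (p * s) * c) * (B * p + C) \<le> (2 powr (p * s) * c) * (B * (p + C))"
      using c by (intro mult_left_mono) auto
    then show ?thesis by (simp add: mult_ac)
  qed
  also have "\<dots> < B * B powr (s - 1)" using QB B1 by simp
  also have "\<dots> = B powr s" using B1 by (simp add: powr_mult_base)
  finally have Bs: "2 powr (p * s) * (c * (B * p + C)) < B powr s" .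
  have "D k \<le> B * g k" if "k \<ge> K1" for k
    using that
  proof (induction k rule: nat_induct_at_least)
    case base
    show ?case using B1 by simp
  next
    case (Suc k)
    have k: "real k \<ge> 3" "k \<ge> K" using Suc.hyps by (auto simp: K1_def)
    have l1: "1 \<le> ln (real k)" using ln1 Suc.hyps by simp
    have lS: "ln (real k) \<le> ln (real (Suc k))" using k by simp
    show ?case
    \<comment> \<open>The recurrence is implicit in \<open>D (Suc k)\<close>: the negated claim is
      inserted twice, into the power on the left and into \<open>- D (Suc k)\<close> on the
      right.\<close>
    proof (rule ccontr)
      assume "\<not> D (Suc k) \<le> B * g (Suc k)"
      then have gt: "B * g (Suc k) < D (Suc k)" by simp
      have gS: "0 < g (Suc k)" using gp Suc.hyps by simp
      have "(B * g (Suc k)) powr s \<le> D (Suc k) powr s"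
        using gt gS B1 s by (intro powr_mono2) auto
      also have "\<dots> \<le> c * (D k - D (Suc k) + C * (ln (real k) * real k powr - (a + 1)))"
        using rec[OF k(2)] .
      also have "\<dots> \<le> c * (B * (g k - g (Suc k)) + C * (ln (real k) * real k powr - (a + 1)))"
        using Suc.IH gt c by (intro mult_left_mono add_right_mono) (auto simp: right_diff_distrib)
      also have "\<dots> \<le> c * (B * (ln (real k) * p * real k powr (- (p * s))) + C * (ln (real k) * real k powr (- (p * s))))"
      proof (intro mult_left_mono add_mono)
        \<comment> \<open>Bernoulli's inequality for the negative exponent, which bounds the
          decrease of \<open>k powr - p\<close> from above.\<close>
        have "1 - p / real k \<le> (1 + 1 / real k) powr - p"
        proof -
          have "p * ln (1 + 1 / real k) \<le> p * (1 / real k)"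
            using p k by (intro mult_left_mono ln_add_one_self_le_self) auto
          then have "1 - p / real k \<le> 1 + - p * ln (1 + 1 / real k)" by simp
          also have "\<dots> \<le> exp (- p * ln (1 + 1 / real k))" by (rule exp_ge_add_one_self)
          also have "\<dots> = (1 + 1 / real k) powr - p"
            using add_pos_nonneg[of 1 "1 / real k"] by (simp add: powr_def)
          finally show ?thesis .
        qed
        then have "real k powr - p * (1 - p / real k) \<le> real k powr - p * (1 + 1 / real k) powr - p"
          by (intro mult_left_mono) auto
        also have "\<dots> = (real k * (1 + 1 / real k)) powr - p" by (rule powr_mult[symmetric])
        also have "real k * (1 + 1 / real k) = real (Suc k)" using k by (simp add: field_simps)
        finally have "real k powr - p - real (Suc k) powr - p \<le> p * (real k powr - p / real k)"
          by (simp add: algebra_simps)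
        also have "real k powr - p / real k = real k powr - (p + 1)"
          using k by (simp add: powr_diff[of _ "-p" 1, simplified])
        also have "p * real k powr - (p + 1) \<le> p * real k powr (- (p * s))"
          using k p by (intro mult_left_mono powr_mono) auto
        finally have 1: "real k powr - p - real (Suc k) powr - p \<le> p * real k powr (- (p * s))" .
        have "g k - g (Suc k) \<le> ln (real k) * real k powr - p - ln (real k) * real (Suc k) powr - p"
          unfolding g_def using lS by (intro diff_mono mult_right_mono) auto
        also have "\<dots> = ln (real k) * (real k powr - p - real (Suc k) powr - p)"
          by (simp add: right_diff_distrib)
        also have "\<dots> \<le> ln (real k) * (p * real k powr (- (p * s)))"
          using 1 l1 by (intro mult_left_mono) auto
        finally show "g k - g (Suc k) \<le> ln (real k) * p * real k powr (- (p * s))" by (simp add: mult.assoc)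
        show "real k powr - (a + 1) \<le> real k powr (- (p * s))" using k p by (intro powr_mono) auto
      qed (use c C B1 l1 in auto)
      also have "\<dots> = (c * (B * p + C)) * (ln (real k) * real k powr (- (p * s)))"
        by (simp add: algebra_simps)
      finally have up: "(B * g (Suc k)) powr s \<le> (c * (B * p + C)) * (ln (real k) * real k powr (- (p * s)))" .
      have "2 powr (- (p * s)) * (ln (real k) * real k powr (- (p * s))) = ln (real k) * (2 * real k) powr (- (p * s))"
        by (simp add: powr_mult mult_ac)
      \<comment> \<open>Since the logarithm is at least 1 and \<open>s > 1\<close>, one logarithm is
        dominated by its power \<open>s\<close>; the comparison function can therefore carry the
        logarithm of the errors.\<close>
      also have "\<dots> \<le> ln (real k) powr s * (2 * real k) powr (- (p * s))"
        using l1 s powr_mono[of 1 s "ln (real k)"] by (intro mult_right_mono) auto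
      also have "\<dots> = (ln (real k) * (2 * real k) powr - p) powr s"
        using l1 by (simp add: powr_mult powr_powr)
      also have "\<dots> \<le> g (Suc k) powr s"
        unfolding g_def using l1 lS k p s
        by (intro powr_mono2 mult_mono powr_mono2') (auto intro: mult_nonneg_nonneg)
      finally have lo: "2 powr (- (p * s)) * (ln (real k) * real k powr (- (p * s))) \<le> g (Suc k) powr s" .
      have w: "0 < ln (real k) * real k powr (- (p * s))" using l1 k by auto
      have "B powr s * (2 powr (- (p * s)) * (ln (real k) * real k powr (- (p * s)))) \<le> B powr s * g (Suc k) powr s"
        using lo by (intro mult_left_mono) auto
      also have "\<dots> = (B * g (Suc k)) powr s" using B1 gS by (simp add: powr_mult)
      finally have "(B powr s * 2 powr (- (p * s))) * (ln (real k) * real k powr (- (p * s)))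
          \<le> (c * (B * p + C)) * (ln (real k) * real k powr (- (p * s)))" using up by (simp add: mult.assoc)
      then have "B powr s * 2 powr (- (p * s)) \<le> c * (B * p + C)"
        using w by (simp only: mult_le_cancel_right_pos)
      then have "B powr s \<le> 2 powr (p * s) * (c * (B * p + C))"
        by (simp add: powr_minus field_simps)
      then show False using Bs by linarith
    qed
  qed
  then show ?thesis unfolding g_def by (intro exI[of _ B]) (auto simp: eventually_sequentially)
qed

text \<open>Discrete counterpart of the integral test: \<open>ln k * k powr - b\<close> is at most
  of the order of the differences of \<open>h k = ln k * k powr (1 - b)\<close>, which
  telescope.\<close>

lemma tail_sum_ln_powr:
  fixes u :: "nat \<Rightarrow> real"
  assumes b: "1 < b" and un: "\<And>k. 0 \<le> u k"
    and u: "eventually (\<lambda>k. u k \<le> B * (ln (real k) * real k powr - b)) sequentially"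
  shows "summable u"
    and "\<exists>B'. eventually (\<lambda>k. (\<Sum>t. u (k + t)) \<le> B' * (ln (real k) * real k powr (1 - b))) sequentially"
proof -
  define h where "h k = ln (real k) * real k powr (1 - b)" for k :: nat
  have "(\<lambda>k::nat. ln (real k) * real k powr - b) \<in> O(\<lambda>k. h k - h (Suc k))"
    unfolding h_def using b by real_asymp
  then obtain c where c: "c > 0"
    "eventually (\<lambda>k. norm (ln (real k) * real k powr - b) \<le> c * norm (h k - h (Suc k))) sequentially"
    by (auto elim!: landau_o.bigE)
  have dec: "eventually (\<lambda>k. 0 < h k - h (Suc k)) sequentially"
    unfolding h_def using b by real_asymp
  \<comment> \<open>The given \<open>B\<close> may be negative; the telescoping bound needs a
    nonnegative constant.\<close>
  define B1 where "B1 = max B 0 * c"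
  have B1: "B1 \<ge> 0" using c by (simp add: B1_def)
  have "eventually (\<lambda>k. u k \<le> B1 * (h k - h (Suc k)) \<and> 0 \<le> h k) sequentially"
    using c(2) dec u eventually_ge_at_top[of 1]
  proof eventually_elim
    case (elim k)
    have nn: "0 \<le> ln (real k) * real k powr - b" using elim by simp
    have "u k \<le> max B 0 * (ln (real k) * real k powr - b)"
      using elim(3) mult_right_mono[OF max.cobounded1[of B 0] nn] by linarith
    also have "\<dots> \<le> max B 0 * (c * (h k - h (Suc k)))"
      using elim nn by (intro mult_left_mono) auto
    finally show ?case using elim by (simp add: B1_def mult.assoc h_def)
  qed
  then obtain K where K: "\<And>k. k \<ge> K \<Longrightarrow> u k \<le> B1 * (h k - h (Suc k)) \<and> 0 \<le> h k"
    by (auto simp: eventually_sequentially)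
  have part: "(\<Sum>t<N. u (k + t)) \<le> B1 * h k" if k: "k \<ge> K" for k N
  proof -
    have "(\<Sum>t<N. u (k + t)) \<le> B1 * (h k - h (k + N))"
    proof (induction N)
      case (Suc N)
      have "u (k + N) \<le> B1 * (h (k + N) - h (Suc (k + N)))" using K[of "k + N"] k by simp
      then show ?case using Suc by (simp add: algebra_simps)
    qed simp
    also have "\<dots> \<le> B1 * h k" using K[of "k + N"] k B1 by (intro mult_left_mono) auto
    finally show ?thesis .
  qed
  have sk: "summable (\<lambda>t. u (k + t))" if "k \<ge> K" for k
    by (rule summableI_nonneg_bounded[of _ "B1 * h k"]) (use un part that in auto)
  have "summable (\<lambda>t. u (t + K))" using sk[of K] by (simp add: add.commute)
  then show "summable u" by (rule summable_iff_shift[THEN iffD1])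
  have "(\<Sum>t. u (k + t)) \<le> B1 * h k" if "k \<ge> K" for k
    using suminf_le_const[OF sk[OF that]] part[OF that] by auto
  then show "\<exists>B'. eventually (\<lambda>k. (\<Sum>t. u (k + t)) \<le> B' * (ln (real k) * real k powr (1 - b))) sequentially"
    unfolding h_def by (intro exI[of _ B1]) (auto simp: eventually_sequentially)
qed

text \<open>Only a lower bound \<open>y k\<close> for the sample size is available, and
  \<open>ln x / sqrt x\<close> decreases only beyond \<open>exp 2\<close>. Instead of monotonicity
  the proof splits \<open>ln N\<close> into \<open>ln (y k)\<close> and twice the logarithm of
  \<open>sqrt N / sqrt (y k)\<close>, and bounds the latter logarithm by its argument; division by
  \<open>sqrt N\<close> leaves an expression in \<open>y k\<close> alone.\<close>

lemma sample_error_rate: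
  assumes n: "\<And>k. 0 < n k"
    and O: "(\<lambda>k. inverse (real (n k))) \<in> O(\<lambda>k. real k powr (- q))" and q: "0 < q"
  shows "\<exists>C\<ge>0. eventually (\<lambda>k. sample_error n k \<le> C * (ln (real k) * real k powr - (q / 2))) sequentially"
proof -
  obtain c where c: "c > 0" "eventually (\<lambda>k. norm (inverse (real (n k))) \<le> c * norm (real k powr - q)) sequentially"
    using O by (auto elim!: landau_o.bigE)
  define y where "y k = real k powr q / c" for k :: nat
  have y1: "eventually (\<lambda>k. 1 \<le> y k) sequentially"
    unfolding y_def using q c(1) by real_asymp
  have "(\<lambda>k. ln (y k) / sqrt (y k) + 2 / sqrt (y k)) \<in> O(\<lambda>k. ln (real k) * real k powr - (q / 2))"
    unfolding y_def using q c(1) by real_asymp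
  then obtain C where C: "C > 0" "eventually (\<lambda>k. norm (ln (y k) / sqrt (y k) + 2 / sqrt (y k)) \<le>
      C * norm (ln (real k) * real k powr - (q / 2))) sequentially"
    by (auto elim!: landau_o.bigE)
  have "eventually (\<lambda>k. sample_error n k \<le> C * (ln (real k) * real k powr - (q / 2))) sequentially"
    using c(2) y1 C(2) eventually_ge_at_top[of 1]
  proof eventually_elim
    case (elim k)
    define N where "N = real (n k)"
    have N: "N > 0" using n by (simp add: N_def)
    have "inverse N \<le> c * real k powr - q" using elim by (simp add: N_def)
    then have Ny: "y k \<le> N" using N c elim by (simp add: y_def powr_minus field_simps)
    have sy: "0 < sqrt (y k)" "sqrt (y k) \<le> sqrt N" using Ny elim by auto
    have "ln N = ln (y k) + 2 * ln (sqrt N / sqrt (y k))"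
      using N elim by (simp add: ln_div ln_sqrt)
    also have "ln (sqrt N / sqrt (y k)) \<le> sqrt N / sqrt (y k)"
      using ln_le_minus_one[of "sqrt N / sqrt (y k)"] sy by simp
    finally have "ln N / sqrt N \<le> (ln (y k) + 2 * (sqrt N / sqrt (y k))) / sqrt N"
      using N by (intro divide_right_mono) auto
    also have "\<dots> = ln (y k) / sqrt N + 2 / sqrt (y k)"
      using N by (simp add: add_divide_distrib)
    also have "\<dots> \<le> ln (y k) / sqrt (y k) + 2 / sqrt (y k)"
      using sy elim by (intro add_right_mono divide_left_mono) auto
    also have "\<dots> \<le> C * (ln (real k) * real k powr - (q / 2))"
      using elim by auto
    finally show ?case by (simp add: sample_error_def N_def)
  qed
  then show ?thesis using C by (intro exI[of _ C]) auto
qed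

text \<open>The logarithm carries a real exponent so that the scale is closed under powers; one
  final rate contains the logarithm to the power \<open>1 - \<beta>\<close>.\<close>

abbreviation ln_powr_scale :: "real \<Rightarrow> real \<Rightarrow> nat \<Rightarrow> real" where
  "ln_powr_scale r x \<equiv> \<lambda>k. ln (real k) powr r * real k powr - x"

lemma ln_powr_scale_bigo:
  assumes "y < x \<or> x = y \<and> r \<le> t"
  shows "ln_powr_scale r x \<in> O(ln_powr_scale t y)"
  using assms
proof
  assume "y < x"
  then show ?thesis by real_asymp
next
  assume "x = y \<and> r \<le> t"
  then show ?thesis
  proof (cases "r = t")
    case False
    with \<open>x = y \<and> r \<le> t\<close> have "r < t" "x = y" by auto
    then show ?thesis by real_asymp
  qed auto
qed

text \<open>The finite-length bound speaks of iterate \<open>Suc k\<close>; comparing with the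
  shifted scale allows the shift to be undone at the end by \<open>bigo_shift_Suc\<close>.\<close>

lemma ln_powr_scale_bigo_Suc: "ln_powr_scale t y \<in> O(\<lambda>k. ln_powr_scale t y (Suc k))"
  by real_asymp

lemma powr_bigo_ln_powr_scale:
  assumes f: "f \<in> O(ln_powr_scale r x)" and nn: "eventually (\<lambda>k. 0 \<le> f k) sequentially" and w: "0 < w"
  shows "(\<lambda>k. f k powr w) \<in> O(ln_powr_scale (r * w) (x * w))"
proof -
  obtain c where c: "c > 0" "eventually (\<lambda>k. norm (f k) \<le> c * norm (ln_powr_scale r x k)) sequentially"
    using f by (auto elim!: landau_o.bigE)
  show ?thesis
  proof (rule bigoI[of _ "c powr w"])
    show "eventually (\<lambda>k. norm (f k powr w) \<le> c powr w * norm (ln_powr_scale (r * w) (x * w) k)) sequentially"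
      using c(2) nn
    proof eventually_elim
      case (elim k)
      then have "f k \<le> c * ln_powr_scale r x k" by simp
      then have "f k powr w \<le> (c * ln_powr_scale r x k) powr w"
        using elim w by (intro powr_mono2) auto
      then show ?case using c by (simp add: powr_mult powr_powr)
    qed
  qed
qed

lemma bigo_shift_Suc:
  fixes f g :: "nat \<Rightarrow> real"
  assumes "(\<lambda>k. f (Suc k)) \<in> O(\<lambda>k. g (Suc k))"
  shows "f \<in> O(g)"
proof -
  obtain c where c: "eventually (\<lambda>k. norm (f (Suc k)) \<le> c * norm (g (Suc k))) sequentially"
    using assms by (auto elim!: landau_o.bigE)
  then have "eventually (\<lambda>k. norm (f k) \<le> c * norm (g k)) sequentially"
    by (rule eventually_sequentially_Suc[THEN iffD1])
  then show ?thesis by (rule bigoI)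
qed

lemma ln_powr_scale_1: "eventually (\<lambda>k. ln_powr_scale 1 x k = ln (real k) * real k powr - x) sequentially"
  using eventually_ge_at_top[of 1] by eventually_elim simp

lemma bigo_ln_powr_scale_1:
  assumes "f \<in> O(\<lambda>k. ln (real k) * real k powr - x)"
  shows "f \<in> O(ln_powr_scale 1 x)"
  using assms landau_o.big.cong[OF ln_powr_scale_1] by simp

lemma upper_bound_imp_bigo:
  fixes f g :: "nat \<Rightarrow> real"
  assumes "eventually (\<lambda>k. f k \<le> B * g k) sequentially" "eventually (\<lambda>k. 0 \<le> f k) sequentially"
  shows "f \<in> O(g)"
proof (rule bigoI[of _ "\<bar>B\<bar>"])
  show "eventually (\<lambda>k. norm (f k) \<le> \<bar>B\<bar> * norm (g k)) sequentially"
    using assms by eventually_elim (auto simp: abs_mult[symmetric])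
qed

lemma nonneg_bigoE:
  fixes f g :: "nat \<Rightarrow> real"
  assumes "f \<in> O(g)" "eventually (\<lambda>k. 0 \<le> g k) sequentially"
  obtains B where "B > 0" "eventually (\<lambda>k. f k \<le> B * g k) sequentially"
proof -
  obtain c where c: "c > 0" "eventually (\<lambda>k. norm (f k) \<le> c * norm (g k)) sequentially"
    using assms(1) by (auto elim!: landau_o.bigE)
  have "eventually (\<lambda>k. f k \<le> c * g k) sequentially"
    using c(2) assms(2) by eventually_elim auto
  then show ?thesis using c that by blast
qed

lemma tail_sum_bigo:
  assumes b: "1 < b" and un: "\<And>k. 0 \<le> u k" and u: "u \<in> O(ln_powr_scale 1 b)"
  shows "summable u" and "(\<lambda>k. \<Sum>t. u (k + t)) \<in> O(ln_powr_scale 1 (b - 1))"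
proof -
  have "u \<in> O(\<lambda>k. ln (real k) * real k powr - b)"
    using u landau_o.big.cong[OF ln_powr_scale_1] by simp
  moreover have "eventually (\<lambda>k. 0 \<le> ln (real k) * real k powr - b) sequentially"
    using eventually_ge_at_top[of 1] by eventually_elim simp
  ultimately obtain B where "eventually (\<lambda>k. u k \<le> B * (ln (real k) * real k powr - b)) sequentially"
    using nonneg_bigoE by blast
  note * = tail_sum_ln_powr[OF b un this]
  show "summable u" by fact
  then have "0 \<le> (\<Sum>t. u (k + t))" for k
    using un by (intro tail_suminf_nonneg)
  then have "(\<lambda>k. \<Sum>t. u (k + t)) \<in> O(\<lambda>k. ln (real k) * real k powr (1 - b))"
    using *(2) upper_bound_imp_bigo[of "\<lambda>k. \<Sum>t. u (k + t)" _ "\<lambda>k. ln (real k) * real k powr (1 - b)"] by auto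
  then show "(\<lambda>k. \<Sum>t. u (k + t)) \<in> O(ln_powr_scale 1 (b - 1))"
    by (intro bigo_ln_powr_scale_1) simp
qed

section \<open>Rates for abstract inexact descent sequences\<close>

text \<open>What the rates depend on, detached from the algorithm: \<open>D\<close> is the objective
  gap and \<open>e\<close> the sample error. The KL inequality appears solved for the gap and only
  for consecutive iterates in the ball, since its right side contains the step between them.\<close>

locale KL_descent =
  fixes X :: "nat \<Rightarrow> 'a::real_normed_vector" and xbar :: 'a and D e :: "nat \<Rightarrow> real"
    and \<beta> \<sigma> A \<delta> c q :: real and K :: nat and r :: "nat \<Rightarrow> nat"
  assumes \<beta>: "0 < \<beta>" "\<beta> < 1" and \<sigma>: "0 < \<sigma>" and A: "0 \<le> A" and \<delta>: "0 < \<delta>"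
    and q: "(2 + 2 * \<beta>) / \<beta> < q"
    and pos: "\<And>k. k \<ge> K \<Longrightarrow> 0 < D k" and e: "\<And>k. 0 \<le> e k"
    and e_rate: "e \<in> O(\<lambda>k. ln (real k) * real k powr - (q / 2))"
    and desc: "\<And>k. k \<ge> K \<Longrightarrow> D (Suc k) + \<sigma> * (norm (X (Suc k) - X k))\<^sup>2 \<le> D k + A * e k"
    and D0: "D \<longlonglongrightarrow> 0"
    and kl: "\<And>k. k \<ge> K \<Longrightarrow> X k \<in> ball xbar \<delta> \<Longrightarrow> X (Suc k) \<in> ball xbar \<delta> \<Longrightarrow>
        D (Suc k) powr \<beta> \<le> c * (norm (X (Suc k) - X k) + e k)"
    and sub: "strict_mono r" "(X \<circ> r) \<longlonglongrightarrow> xbar"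
begin

text \<open>Decay exponent of the tails of \<open>e\<close>, one less than that of \<open>e\<close>
  itself.\<close>

definition "a = q / 2 - 1"
definition "d k = norm (X (Suc k) - X k)"
definition "T k = (\<Sum>t. e (k + t))"
definition "\<Psi> k = D k + A * T k"

text \<open>The lower bound on \<open>q\<close>, rewritten.\<close>

lemma a_beta: "1 < a * \<beta>"
  using q \<beta> by (simp add: a_def field_simps)

lemma a_gt_1: "1 < a"
proof -
  have "0 < a" using zero_less_mult_pos2[of a \<beta>] a_beta \<beta> by linarith
  then have "a * \<beta> \<le> a" using \<beta> by simp
  then show ?thesis using a_beta by linarith
qed

lemma e_bigo: "e \<in> O(ln_powr_scale 1 (a + 1))"
  using bigo_ln_powr_scale_1[OF e_rate] by (simp add: a_def)

lemma e_summable: "summable e" and T_bigo: "T \<in> O(ln_powr_scale 1 a)"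
  using tail_sum_bigo[OF _ e e_bigo] a_gt_1 by (auto simp: T_def[abs_def])

lemma T_nonneg: "0 \<le> T k"
  unfolding T_def by (rule tail_suminf_nonneg[OF e_summable e])

lemma T_powr_bigo: "(\<lambda>k. T k powr \<beta>) \<in> O(ln_powr_scale 1 (a * \<beta>))"
proof -
  have "(\<lambda>k. T k powr \<beta>) \<in> O(ln_powr_scale (1 * \<beta>) (a * \<beta>))"
    by (rule powr_bigo_ln_powr_scale[OF T_bigo]) (use T_nonneg \<beta> in auto)
  \<comment> \<open>The power of the logarithm is rounded up from \<open>\<beta>\<close> to 1, the
    form to which \<open>tail_sum_bigo\<close> applies.\<close>
  also have "ln_powr_scale (1 * \<beta>) (a * \<beta>) \<in> O(ln_powr_scale 1 (a * \<beta>))"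
    using \<beta> by (intro ln_powr_scale_bigo) auto
  finally show ?thesis .
qed

lemma T_powr_summable: "summable (\<lambda>k. T k powr \<beta>)"
  by (rule tail_sum_bigo(1)[OF a_beta _ T_powr_bigo]) auto

lemma convergent: "X \<longlonglongrightarrow> xbar"
  by (rule KL_descent_convergence(1)[where D = D and e = e and A = A and \<beta> = \<beta> and \<sigma> = \<sigma> and
        \<delta> = \<delta> and K = K and c = c and r = r])
     (use \<beta> \<sigma> A \<delta> pos e e_summable desc T_powr_summable D0 kl sub in \<open>auto simp: T_def\<close>)

lemma err_bound:
  obtains B where "eventually (\<lambda>k. norm (X (Suc k) - xbar) \<le>
        d k + (\<Sum>t. e (k + t) + T (Suc k + t) powr \<beta>) + B * \<Psi> (Suc k) powr (1 - \<beta>)) sequentially"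
proof -
  have "\<exists>B. eventually (\<lambda>k. norm (X (Suc k) - xbar) \<le>
        norm (X (Suc k) - X k) + (\<Sum>t. e (k + t) + (\<Sum>s. e ((Suc k + t) + s)) powr \<beta>)
         + B * (D (Suc k) + A * (\<Sum>t. e (Suc k + t))) powr (1 - \<beta>)) sequentially"
    by (rule KL_descent_convergence(2)[where D = D and e = e and A = A and \<beta> = \<beta> and \<sigma> = \<sigma> and
        \<delta> = \<delta> and K = K and c = c and r = r])
     (use \<beta> \<sigma> A \<delta> pos e e_summable desc T_powr_summable D0 kl sub in \<open>auto simp: T_def\<close>)
  then show ?thesis using that unfolding d_def T_def \<Psi>_def by blast
qed

text \<open>Squaring the KL inequality and inserting the descent inequality for the squared step
  gives the recurrence of \<open>powr_recurrence_rate\<close> with exponent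
  \<open>2 * \<beta>\<close>. As the gap is eventually below 1, the exponent may be enlarged to any
  \<open>s \<ge> 2 * \<beta>\<close>; the recurrence lemma needs \<open>s > 1\<close>.\<close>

lemma D_bigo:
  assumes s: "1 < s" "2 * \<beta> \<le> s" and p: "0 < p" "p * s \<le> p + 1" "p * s \<le> a + 1"
  shows "D \<in> O(ln_powr_scale 1 p)"
proof -
  define c' where "c' = \<bar>c\<bar> + 1"
  have c': "c' > 0" "c \<le> c'" by (auto simp: c'_def)
  have eO: "eventually (\<lambda>k. 0 \<le> ln (real k) * real k powr - (q / 2)) sequentially"
    using eventually_ge_at_top[of 1] by eventually_elim simp
  obtain C where C: "C > 0" "eventually (\<lambda>k. e k \<le> C * (ln (real k) * real k powr - (q / 2))) sequentially"
    using nonneg_bigoE[OF e_rate eO] by blast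
  have "e \<longlonglongrightarrow> 0" using e_summable by (rule summable_LIMSEQ_zero)
  then have e1: "eventually (\<lambda>k. e k < 1) sequentially" by (rule order_tendstoD) simp
  have D1: "eventually (\<lambda>k. D (Suc k) < 1) sequentially"
    using LIMSEQ_Suc[OF D0] by (rule order_tendstoD) simp
  have b1: "eventually (\<lambda>k. X k \<in> ball xbar \<delta>) sequentially"
    using convergent by (rule topological_tendstoD) (use \<delta> in auto)
  have b2: "eventually (\<lambda>k. X (Suc k) \<in> ball xbar \<delta>) sequentially"
    using LIMSEQ_Suc[OF convergent] by (rule topological_tendstoD) (use \<delta> in auto)
  have "eventually (\<lambda>k. D (Suc k) powr s \<le> 2 * c'\<^sup>2 / \<sigma> * (D k - D (Suc k) + ((A + \<sigma>) * C) * (ln (real k) * real k powr - (a + 1)))) sequentially"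
    using eventually_ge_at_top[of K] C(2) e1 D1 b1 b2
  proof eventually_elim
    case (elim k)
    have Dp: "0 < D (Suc k)" using pos elim by simp
    have dn: "0 \<le> d k" by (simp add: d_def)
    have "D (Suc k) powr \<beta> \<le> c * (d k + e k)"
      unfolding d_def using elim by (intro kl) auto
    also have "\<dots> \<le> c' * (d k + e k)" using c' dn e[of k] by (intro mult_right_mono) auto
    finally have 1: "D (Suc k) powr \<beta> \<le> c' * (d k + e k)" .
    have "D (Suc k) powr s \<le> D (Suc k) powr (2 * \<beta>)"
      using Dp elim s by (intro powr_mono') auto
    also have "\<dots> = (D (Suc k) powr \<beta>)\<^sup>2"
      by (simp add: power2_eq_square powr_add[symmetric])
    also have "\<dots> \<le> (c' * (d k + e k))\<^sup>2" using 1 by (intro power_mono) auto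
    also have "\<dots> \<le> c'\<^sup>2 * (2 * ((d k)\<^sup>2 + e k))"
    proof -
      have "(d k + e k)\<^sup>2 \<le> 2 * ((d k)\<^sup>2 + (e k)\<^sup>2)"
        using sum_squares_bound[of "d k" "e k"] by (simp add: power2_sum)
      \<comment> \<open>Nothing is lost in the order by dropping the square: the descent inequality
        contributes \<open>e k\<close> to the first power anyway.\<close>
      also have "(e k)\<^sup>2 \<le> e k" using elim e[of k] by (simp add: power2_eq_square mult_left_le)
      finally show ?thesis by (simp add: power_mult_distrib mult_left_mono)
    qed
    also have "\<dots> \<le> c'\<^sup>2 * (2 * ((D k - D (Suc k) + A * e k) / \<sigma> + e k))"
    proof -
      have "(d k)\<^sup>2 \<le> (D k - D (Suc k) + A * e k) / \<sigma>"
        using desc[of k] elim \<sigma> by (simp add: d_def field_simps)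
      then show ?thesis by (intro mult_left_mono) auto
    qed
    also have "\<dots> = 2 * c'\<^sup>2 / \<sigma> * (D k - D (Suc k) + (A + \<sigma>) * e k)"
      using \<sigma> by (simp add: field_simps)
    also have "\<dots> \<le> 2 * c'\<^sup>2 / \<sigma> * (D k - D (Suc k) + (A + \<sigma>) * (C * (ln (real k) * real k powr - (q / 2))))"
      using elim A \<sigma> by (intro mult_left_mono add_left_mono) auto
    finally show ?case by (simp add: a_def mult.assoc)
  qed
  then obtain K' where "\<And>k. k \<ge> K' \<Longrightarrow> D (Suc k) powr s \<le> 2 * c'\<^sup>2 / \<sigma> * (D k - D (Suc k) + ((A + \<sigma>) * C) * (ln (real k) * real k powr - (a + 1)))"
    by (auto simp: eventually_sequentially)
  then have "\<exists>B. eventually (\<lambda>k. D k \<le> B * (ln (real k) * real k powr - p)) sequentially"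
    using s p c' \<sigma> A C
    by (intro powr_recurrence_rate[of s p a "2 * c'\<^sup>2 / \<sigma>" "(A + \<sigma>) * C" K' D]) auto
  then obtain B where B: "eventually (\<lambda>k. D k \<le> B * (ln (real k) * real k powr - p)) sequentially"
    by blast
  have "eventually (\<lambda>k. 0 \<le> D k) sequentially"
    using eventually_ge_at_top[of K] by eventually_elim (simp add: pos less_imp_le)
  with B show ?thesis by (intro bigo_ln_powr_scale_1 upper_bound_imp_bigo)
qed

lemma Psi_bigo:
  assumes "D \<in> O(ln_powr_scale 1 p)" "p \<le> a"
  shows "\<Psi> \<in> O(ln_powr_scale 1 p)"
proof -
  have "T \<in> O(ln_powr_scale 1 p)"
    by (rule landau_o.big_trans[OF T_bigo ln_powr_scale_bigo]) (use assms(2) in auto)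
  then show ?thesis unfolding \<Psi>_def[abs_def]
    using assms by (intro sum_in_bigo) auto
qed

lemma Psi_pos: "k \<ge> K \<Longrightarrow> 0 < \<Psi> k"
  unfolding \<Psi>_def using pos A T_nonneg by (intro add_pos_nonneg) auto

text \<open>By descent the squared step is at most the potential over \<open>\<sigma>\<close>, the
  next gap being positive; a square root halves both exponents.\<close>

lemma d_bigo:
  assumes "\<Psi> \<in> O(ln_powr_scale 1 p)"
  shows "d \<in> O(ln_powr_scale (1 / 2) (p / 2))"
proof -
  have "eventually (\<lambda>k. d k \<le> (1 / \<sigma>) powr (1 / 2) * \<Psi> k powr (1 / 2)) sequentially"
    using eventually_ge_at_top[of K]
  proof eventually_elim
    case (elim k)
    have TS: "T k = e k + T (Suc k)" unfolding T_def by (rule tail_suminf_Suc[OF e_summable])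
    have "A * T k = A * e k + A * T (Suc k)" by (simp add: TS algebra_simps)
    moreover have "0 \<le> A * T (Suc k)" using A T_nonneg by simp
    ultimately have "\<sigma> * (d k)\<^sup>2 \<le> \<Psi> k"
      using desc[OF elim] pos[of "Suc k"] elim unfolding \<Psi>_def d_def by simp
    then have "(d k)\<^sup>2 \<le> 1 / \<sigma> * \<Psi> k" using \<sigma> by (simp add: field_simps)
    then have "d k \<le> sqrt (1 / \<sigma> * \<Psi> k)" by (rule real_le_rsqrt)
    moreover have "(1 / \<sigma>) powr (1 / 2) = sqrt (1 / \<sigma>)" "\<Psi> k powr (1 / 2) = sqrt (\<Psi> k)"
      using \<sigma> Psi_pos[OF elim] by (auto intro!: powr_half_sqrt)
    ultimately show ?case by (simp only: real_sqrt_mult)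
  qed
  then have "d \<in> O(\<lambda>k. \<Psi> k powr (1 / 2))"
    by (rule upper_bound_imp_bigo) (simp add: d_def)
  also have "(\<lambda>k. \<Psi> k powr (1 / 2)) \<in> O(ln_powr_scale (1 * (1 / 2)) (p * (1 / 2)))"
  proof (rule powr_bigo_ln_powr_scale[OF assms])
    show "eventually (\<lambda>k. 0 \<le> \<Psi> k) sequentially"
      using eventually_ge_at_top[of K] by eventually_elim (simp add: Psi_pos less_imp_le)
  qed auto
  finally show ?thesis by simp
qed

text \<open>The three alternatives belong to the three terms of \<open>err_bound\<close>: last step,
  tail sum of the error terms, desingularized potential. Each compares exponents lexicographically,
  the power of the logarithm deciding ties.\<close>

lemma err_bigo:
  assumes p: "D \<in> O(ln_powr_scale 1 p)" "p \<le> a"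
    and 1: "y < p / 2 \<or> p / 2 = y \<and> 1 / 2 \<le> t"
    and 2: "y < a * \<beta> - 1 \<or> a * \<beta> - 1 = y \<and> 1 \<le> t"
    and 3: "y < p * (1 - \<beta>) \<or> p * (1 - \<beta>) = y \<and> 1 - \<beta> \<le> t"
  shows "(\<lambda>k. norm (X k - xbar)) \<in> O(ln_powr_scale t y)"
proof -
  let ?g = "\<lambda>k. ln_powr_scale t y (Suc k)"
  have lift: "f \<in> O(?g)" if "f \<in> O(ln_powr_scale s x)" "y < x \<or> x = y \<and> s \<le> t" for f s x
    by (rule landau_o.big_trans[OF landau_o.big_trans[OF that(1) ln_powr_scale_bigo[OF that(2)]] ln_powr_scale_bigo_Suc])
  have \<Psi>: "\<Psi> \<in> O(ln_powr_scale 1 p)" by (rule Psi_bigo[OF p])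
  have d: "d \<in> O(?g)" by (rule lift[OF d_bigo[OF \<Psi>] 1])
  define u where "u k = e k + T (Suc k) powr \<beta>" for k
  have "(\<lambda>k. T (Suc k) powr \<beta>) \<in> O(ln_powr_scale 1 (a * \<beta>))"
  proof -
    have "T (Suc k) \<le> T k" for k
      using tail_suminf_Suc[OF e_summable, of k] e[of k] by (simp add: T_def)
    then have "(\<lambda>k. T (Suc k) powr \<beta>) \<in> O(\<lambda>k. T k powr \<beta>)"
      using T_nonneg \<beta> by (intro landau_o.big_mono always_eventually) (auto intro!: powr_mono2)
    then show ?thesis using T_powr_bigo by (rule landau_o.big_trans)
  qed
  moreover have "e \<in> O(ln_powr_scale 1 (a * \<beta>))"
  proof (rule landau_o.big_trans[OF e_bigo ln_powr_scale_bigo])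
    have "a * \<beta> < a * 1" using a_gt_1 \<beta> by (intro mult_strict_left_mono) auto
    then show "a * \<beta> < a + 1 \<or> a + 1 = a * \<beta> \<and> (1::real) \<le> 1" by linarith
  qed
  ultimately have "u \<in> O(ln_powr_scale 1 (a * \<beta>))"
    unfolding u_def[abs_def] by (intro sum_in_bigo)
  then have "(\<lambda>k. \<Sum>t. u (k + t)) \<in> O(ln_powr_scale 1 (a * \<beta> - 1))"
    by (intro tail_sum_bigo(2)[OF a_beta]) (simp add: u_def e)
  then have U: "(\<lambda>k. \<Sum>t. u (k + t)) \<in> O(?g)" using 2 by (rule lift)
  have "(\<lambda>k. \<Psi> k powr (1 - \<beta>)) \<in> O(ln_powr_scale (1 * (1 - \<beta>)) (p * (1 - \<beta>)))"
  proof (rule powr_bigo_ln_powr_scale[OF \<Psi>])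
    show "eventually (\<lambda>k. 0 \<le> \<Psi> k) sequentially"
      using eventually_ge_at_top[of K] by eventually_elim (simp add: Psi_pos less_imp_le)
  qed (use \<beta> in auto)
  then have "(\<lambda>k. \<Psi> k powr (1 - \<beta>)) \<in> O(ln_powr_scale t y)"
    by (rule landau_o.big_trans) (use 3 in \<open>simp add: ln_powr_scale_bigo\<close>)
  then have \<Theta>: "(\<lambda>k. \<Psi> (Suc k) powr (1 - \<beta>)) \<in> O(?g)"
    by (rule landau_o.big.compose) (rule filterlim_Suc)
  obtain B where B: "eventually (\<lambda>k. norm (X (Suc k) - xbar) \<le>
        d k + (\<Sum>t. e (k + t) + T (Suc k + t) powr \<beta>) + B * \<Psi> (Suc k) powr (1 - \<beta>)) sequentially"
    using err_bound by blast
  have "(\<lambda>k. norm (X (Suc k) - xbar)) \<in> O(\<lambda>k. d k + (\<Sum>t. u (k + t)) + B * \<Psi> (Suc k) powr (1 - \<beta>))"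
    using B by (intro upper_bound_imp_bigo[of _ 1]) (auto simp: u_def)
  also have "(\<lambda>k. d k + (\<Sum>t. u (k + t)) + B * \<Psi> (Suc k) powr (1 - \<beta>)) \<in> O(?g)"
    using d U \<Theta> by (intro sum_in_bigo) auto
  finally show ?thesis by (rule bigo_shift_Suc)
qed

text \<open>If \<open>p > 2\<close> the steps themselves are summable and their tails bound the
  distance. For \<open>\<beta> \<le> 1 / 2\<close> and \<open>p = a\<close> this gives the exponent
  \<open>a / 2 - 1\<close>, at least the \<open>a * \<beta> - 1\<close> to which
  \<open>err_bigo\<close> is limited.\<close>

lemma err_bigo_summable:
  assumes \<Psi>: "\<Psi> \<in> O(ln_powr_scale 1 p)" and p: "2 < p"
  shows "(\<lambda>k. norm (X k - xbar)) \<in> O(ln_powr_scale 1 (p / 2 - 1))"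
proof -
  have d1: "d \<in> O(ln_powr_scale 1 (p / 2))"
    by (rule landau_o.big_trans[OF d_bigo[OF \<Psi>] ln_powr_scale_bigo]) auto
  have sd: "summable d" and tail: "(\<lambda>k. \<Sum>t. d (k + t)) \<in> O(ln_powr_scale 1 (p / 2 - 1))"
    using tail_sum_bigo[OF _ _ d1] p by (auto simp: d_def)
  have sdk: "summable (\<lambda>t. d (k + t))" for k
    using summable_ignore_initial_segment[OF sd, of k] by (simp add: add.commute)
  have "norm (X k - xbar) \<le> (\<Sum>t. d (k + t))" for k
  proof -
    have part: "norm (X k - X (k + N)) \<le> (\<Sum>t<N. d (k + t))" for N
    proof (induction N)
      case (Suc N)
      have "norm (X k - X (k + Suc N)) \<le> norm (X k - X (k + N)) + d (k + N)"
        unfolding d_def using norm_triangle_ineq[of "X k - X (k + N)" "X (k + N) - X (k + Suc N)"]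
        by (simp add: norm_minus_commute)
      then show ?case using Suc by simp
    qed simp
    have "norm (X k - X (k + N)) \<le> (\<Sum>t. d (k + t))" for N
      using part[of N] sum_le_suminf[OF sdk, of "{..<N}" k] by (auto simp: d_def intro: order_trans)
    moreover have "(\<lambda>N. norm (X k - X (k + N))) \<longlonglongrightarrow> norm (X k - xbar)"
      using LIMSEQ_ignore_initial_segment[OF convergent, of k]
      by (intro tendsto_intros) (simp add: add.commute)
    ultimately show ?thesis
      by (intro tendsto_upperbound[OF _ _ sequentially_bot]) auto
  qed
  then have "(\<lambda>k. norm (X k - xbar)) \<in> O(\<lambda>k. \<Sum>t. d (k + t))"
    by (intro upper_bound_imp_bigo[of _ 1] always_eventually) auto
  then show ?thesis using tail by (rule landau_o.big_trans)
qed

lemma rates: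
  "\<beta> \<le> 1 / 2 \<longrightarrow>
     D \<in> O(\<lambda>k. ln (real k) / real k powr (q / 2 - 1)) \<and>
     (\<lambda>k. norm (X k - xbar)) \<in> O(\<lambda>k. ln (real k) / real k powr (1 / 2 * (q / 2 - 1) - 1))"
  "1 / 2 < \<beta> \<longrightarrow> q \<le> 4 * \<beta> / (2 * \<beta> - 1) \<longrightarrow>
     D \<in> O(\<lambda>k. real k powr (- 2 * \<beta> * (q / 2 - 1) + 1) * ln (real k)) \<and>
     (\<lambda>k. norm (X k - xbar)) \<in> O(\<lambda>k. real k powr (- \<beta> * (q / 2 - 1) + 1) * ln (real k))"
  "1 / 2 < \<beta> \<longrightarrow> 4 * \<beta> / (2 * \<beta> - 1) < q \<longrightarrow>
     D \<in> O(\<lambda>k. real k powr (- 2 * \<beta> / (2 * \<beta> - 1) + 1) * ln (real k)) \<and>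
     (\<lambda>k. norm (X k - xbar)) \<in>
       O(\<lambda>k. real k powr (- (1 - \<beta>) / (2 * \<beta> - 1)) * ln (real k) powr (1 - \<beta>))"
proof -
  have O1: "O(ln_powr_scale 1 x) = O(\<lambda>k. real k powr z * ln (real k))" if "z = - x" for x z
  proof (rule landau_o.big.cong)
    show "eventually (\<lambda>k. ln_powr_scale 1 x k = real k powr z * ln (real k)) sequentially"
      using ln_powr_scale_1[of x] by eventually_elim (simp add: that)
  qed
  have O2: "O(ln_powr_scale 1 x) = O(\<lambda>k. ln (real k) / real k powr x)" for x
  proof (rule landau_o.big.cong)
    show "eventually (\<lambda>k. ln_powr_scale 1 x k = ln (real k) / real k powr x) sequentially"
      using ln_powr_scale_1[of x] by eventually_elim (simp add: powr_minus divide_inverse)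
  qed
  have ab: "1 < a * \<beta>" and a1: "1 < a" by (rule a_beta a_gt_1)+
  show "\<beta> \<le> 1 / 2 \<longrightarrow>
     D \<in> O(\<lambda>k. ln (real k) / real k powr (q / 2 - 1)) \<and>
     (\<lambda>k. norm (X k - xbar)) \<in> O(\<lambda>k. ln (real k) / real k powr (1 / 2 * (q / 2 - 1) - 1))"
  proof
    assume b: "\<beta> \<le> 1 / 2"
    have "a * \<beta> \<le> a * (1 / 2)" using b a1 by (intro mult_left_mono) auto
    then have a2: "2 < a" using ab by simp
    have D: "D \<in> O(ln_powr_scale 1 a)"
    \<comment> \<open>the exponent may be raised from \<open>2 * \<beta> \<le> 1\<close> because the gap is eventually below 1\<close>
    proof (rule D_bigo)
      \<comment> \<open>The exponent is \<open>s = 1 + 1 / a\<close>, the largest one with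
        \<open>a * s \<le> a + 1\<close>; with \<open>p = a\<close> both conditions on
        \<open>p * s\<close> are then equalities.\<close>
      have "0 < 1 / a" using a1 by simp
      then show "1 < 1 + 1 / a" "2 * \<beta> \<le> 1 + 1 / a" using b by linarith+
    qed (use a1 in \<open>auto simp: distrib_left\<close>)
    have "(\<lambda>k. norm (X k - xbar)) \<in> O(ln_powr_scale 1 (a / 2 - 1))"
      by (rule err_bigo_summable[OF Psi_bigo[OF D] a2]) simp
    with D show "D \<in> O(\<lambda>k. ln (real k) / real k powr (q / 2 - 1)) \<and>
     (\<lambda>k. norm (X k - xbar)) \<in> O(\<lambda>k. ln (real k) / real k powr (1 / 2 * (q / 2 - 1) - 1))"
      unfolding O2 by (simp add: a_def)
  qed
  show "1 / 2 < \<beta> \<longrightarrow> q \<le> 4 * \<beta> / (2 * \<beta> - 1) \<longrightarrow>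
     D \<in> O(\<lambda>k. real k powr (- 2 * \<beta> * (q / 2 - 1) + 1) * ln (real k)) \<and>
     (\<lambda>k. norm (X k - xbar)) \<in> O(\<lambda>k. real k powr (- \<beta> * (q / 2 - 1) + 1) * ln (real k))"
  proof (intro impI)
    assume b: "1 / 2 < \<beta>" and q': "q \<le> 4 * \<beta> / (2 * \<beta> - 1)"
    have "q * (2 * \<beta> - 1) \<le> 4 * \<beta>" using q' b by (simp add: pos_le_divide_eq)
    then have k: "2 * \<beta> * a \<le> 1 + a" by (simp add: a_def algebra_simps)
    \<comment> \<open>Since \<open>p + 1 = 2 * \<beta> * a\<close>, both conditions on
      \<open>p * (2 * \<beta>)\<close> reduce to \<open>p \<le> a\<close>, which is the case
      assumption on \<open>q\<close> rewritten.\<close>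
    define p where "p = 2 * \<beta> * a - 1"
    have p: "p \<le> a" "0 < p" using k ab by (auto simp: p_def mult_ac)
    have "p * (2 * \<beta>) \<le> a * (2 * \<beta>)" using p \<beta> by (intro mult_right_mono) auto
    then have ps: "p * (2 * \<beta>) \<le> p + 1" by (simp add: p_def mult_ac)
    have D: "D \<in> O(ln_powr_scale 1 p)"
      by (rule D_bigo[of "2 * \<beta>"]) (use b p ps in auto)
    \<comment> \<open>The identity shows that the exponent of the potential term is at least
      \<open>a * \<beta> - 1\<close>; that of the last step is
      \<open>p / 2 = a * \<beta> - 1 / 2\<close>. The tail sums of the errors therefore dictate the
      rate.\<close>
    have "(1 - \<beta>) * p - (a * \<beta> - 1) = \<beta> * (1 + a - 2 * \<beta> * a)"
      by (simp add: p_def algebra_simps)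
    moreover have "0 \<le> \<beta> * (1 + a - 2 * \<beta> * a)" using k \<beta> by (intro mult_nonneg_nonneg) auto
    ultimately have "a * \<beta> - 1 \<le> p * (1 - \<beta>)" by (simp add: mult.commute)
    then have "(\<lambda>k. norm (X k - xbar)) \<in> O(ln_powr_scale 1 (a * \<beta> - 1))"
      using \<beta> by (intro err_bigo[OF D p(1)]) (auto simp: p_def field_simps)
    moreover have "- 2 * \<beta> * (q / 2 - 1) + 1 = - p" "- \<beta> * (q / 2 - 1) + 1 = - (a * \<beta> - 1)"
      by (auto simp: p_def a_def algebra_simps)
    ultimately show "D \<in> O(\<lambda>k. real k powr (- 2 * \<beta> * (q / 2 - 1) + 1) * ln (real k)) \<and>
     (\<lambda>k. norm (X k - xbar)) \<in> O(\<lambda>k. real k powr (- \<beta> * (q / 2 - 1) + 1) * ln (real k))"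
      using D O1 by metis
  qed
  show "1 / 2 < \<beta> \<longrightarrow> 4 * \<beta> / (2 * \<beta> - 1) < q \<longrightarrow>
     D \<in> O(\<lambda>k. real k powr (- 2 * \<beta> / (2 * \<beta> - 1) + 1) * ln (real k)) \<and>
     (\<lambda>k. norm (X k - xbar)) \<in>
       O(\<lambda>k. real k powr (- (1 - \<beta>) / (2 * \<beta> - 1)) * ln (real k) powr (1 - \<beta>))"
  proof (intro impI)
    assume b: "1 / 2 < \<beta>" and q': "4 * \<beta> / (2 * \<beta> - 1) < q"
    have "4 * \<beta> < q * (2 * \<beta> - 1)" using q' b by (simp add: pos_divide_less_eq)
    then have k: "1 + a < 2 * \<beta> * a" by (simp add: a_def algebra_simps)
    \<comment> \<open>Solution of \<open>p * (2 * \<beta>) = p + 1\<close>: the rate of the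
      recurrence without errors. The sample errors no longer limit it because \<open>p < a\<close>
      in this case.\<close>
    define p where "p = 1 / (2 * \<beta> - 1)"
    have p0: "0 < p" using b by (simp add: p_def)
    have ps: "p * (2 * \<beta>) = p + 1" using b by (simp add: p_def field_simps)
    have pa: "p < a" using k b by (simp add: p_def field_simps)
    have D: "D \<in> O(ln_powr_scale 1 p)"
      by (rule D_bigo[of "2 * \<beta>"]) (use b p0 ps pa in auto)
    \<comment> \<open>The exponents of the other two terms are strictly larger than
      \<open>p * (1 - \<beta>)\<close>, so only the potential term counts and the logarithm keeps
      the power \<open>1 - \<beta>\<close>.\<close>
    have "p * \<beta> < a * \<beta>" using pa \<beta> by simp
    moreover have "p * (1 - \<beta>) = p * \<beta> - 1" using ps by (simp add: algebra_simps)
    ultimately have 2: "p * (1 - \<beta>) < a * \<beta> - 1" by linarith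
    have 1: "p * (1 - \<beta>) < p / 2" using mult_strict_left_mono[OF _ p0, of "1 - \<beta>" "1 / 2"] b by simp
    have "(\<lambda>k. norm (X k - xbar)) \<in> O(ln_powr_scale (1 - \<beta>) (p * (1 - \<beta>)))"
      using 1 2 pa by (intro err_bigo[OF D]) auto
    moreover have "- 2 * \<beta> / (2 * \<beta> - 1) + 1 = - p" "- (1 - \<beta>) / (2 * \<beta> - 1) = - (p * (1 - \<beta>))"
      using b by (auto simp: p_def field_simps)
    ultimately show "D \<in> O(\<lambda>k. real k powr (- 2 * \<beta> / (2 * \<beta> - 1) + 1) * ln (real k)) \<and>
     (\<lambda>k. norm (X k - xbar)) \<in>
       O(\<lambda>k. real k powr (- (1 - \<beta>) / (2 * \<beta> - 1)) * ln (real k) powr (1 - \<beta>))"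
      using D O1[of "- p" p] by (simp add: mult.commute)
  qed
qed

end

section \<open>Paths of the algorithm\<close>

lemma lsc_le_limit:
  fixes f :: "'a::metric_space \<Rightarrow> ereal"
  assumes lsc: "lower_semicontinuous f" and y: "Y \<longlonglongrightarrow> y"
    and le: "eventually (\<lambda>i. f (Y i) \<le> ereal (B i)) sequentially" and B: "B \<longlonglongrightarrow> b"
  shows "f y \<le> ereal b"
proof (rule ccontr)
  assume "\<not> f y \<le> ereal b"
  then have "ereal b < f y" by simp
  then obtain t where t: "ereal b < ereal t" "ereal t < f y" using ereal_dense2 by blast
  have "ereal t < Liminf (at y) f" using t lsc unfolding lower_semicontinuous_def by (meson less_le_trans)
  then have "eventually (\<lambda>z. ereal t < f z) (at y)" by (rule less_LiminfD)
  \<comment> \<open>Lower semicontinuity is stated with the punctured filter, but the sequence may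
    hit \<open>y\<close>; the strict inequality at \<open>y\<close> itself closes the gap.\<close>
  then have "eventually (\<lambda>z. ereal t < f z) (nhds y)"
    using t(2) unfolding eventually_at_filter by (auto elim: eventually_mono)
  then have "eventually (\<lambda>i. ereal t < f (Y i)) sequentially"
    using y by (rule eventually_compose_filterlim)
  moreover have "eventually (\<lambda>i. B i < t) sequentially"
    using B t(1) by (intro order_tendstoD) auto
  ultimately have "eventually (\<lambda>i. False) sequentially" using le
  proof eventually_elim
    case (elim i)
    then have "ereal t < ereal (B i)" by (meson less_le_trans)
    then show ?case using elim by simp
  qed
  then show False by simp
qed

lemma prox_objective_expand:
  fixes u x v :: "'a::real_inner"
  assumes "0 < \<gamma>"
  shows "1 / (2 * \<gamma>) * (norm (u - (x - \<gamma> *\<^sub>R v)))\<^sup>2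
    = (v \<bullet> (u - x) + (norm (u - x))\<^sup>2 / (2 * \<gamma>)) + \<gamma> / 2 * (norm v)\<^sup>2"
proof -
  have "u - (x - \<gamma> *\<^sub>R v) = (u - x) + \<gamma> *\<^sub>R v" by simp
  then have *: "(norm (u - (x - \<gamma> *\<^sub>R v)))\<^sup>2
      = (norm (u - x))\<^sup>2 + 2 * \<gamma> * (v \<bullet> (u - x)) + \<gamma>\<^sup>2 * (norm v)\<^sup>2"
    using power2_norm_eq_inner[of "(u - x) + \<gamma> *\<^sub>R v"]
    by (simp only:) (simp add: inner_add inner_commute power2_norm_eq_inner power2_eq_square[of \<gamma>])
  show ?thesis unfolding * using assms by (simp add: field_simps power2_eq_square)
qed

lemma prox_step:
  fixes \<psi> :: "'a::real_inner \<Rightarrow> ereal"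
  assumes "proper_fun \<psi>" and \<gamma>: "0 < \<gamma>" and y: "y \<in> prox \<gamma> \<psi> (x - \<gamma> *\<^sub>R v)"
  shows "\<bar>\<psi> y\<bar> \<noteq> \<infinity>"
    and "ereal (real_of_ereal (\<psi> y) + v \<bullet> (y - x) + (norm (y - x))\<^sup>2 / (2 * \<gamma>))
      \<le> \<psi> u + ereal (v \<bullet> (u - x) + (norm (u - x))\<^sup>2 / (2 * \<gamma>))"
proof -
  define h where "h u = 1 / (2 * \<gamma>) * (norm (u - (x - \<gamma> *\<^sub>R v)))\<^sup>2" for u
  have h: "h u = (v \<bullet> (u - x) + (norm (u - x))\<^sup>2 / (2 * \<gamma>)) + \<gamma> / 2 * (norm v)\<^sup>2" for u
    unfolding h_def by (rule prox_objective_expand[OF \<gamma>])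
  have min: "\<psi> y + ereal (h y) \<le> \<psi> u + ereal (h u)" for u
    using y unfolding prox_def is_arg_min_def h_def by (auto simp: not_less)
  obtain w where "\<psi> w < \<infinity>" using assms(1) by (auto simp: proper_fun_def)
  then have "\<psi> y + ereal (h y) < \<infinity>" using min[of w] by (cases "\<psi> w") auto
  moreover have "\<psi> y \<noteq> -\<infinity>" using assms(1) by (auto simp: proper_fun_def)
  ultimately show fin: "\<bar>\<psi> y\<bar> \<noteq> \<infinity>" by (cases "\<psi> y") auto
  have m: "\<psi> u \<noteq> -\<infinity>" using assms(1) by (auto simp: proper_fun_def)
  show "ereal (real_of_ereal (\<psi> y) + v \<bullet> (y - x) + (norm (y - x))\<^sup>2 / (2 * \<gamma>))
      \<le> \<psi> u + ereal (v \<bullet> (u - x) + (norm (u - x))\<^sup>2 / (2 * \<gamma>))"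
    using min[of u] fin m unfolding h by (cases "\<psi> y"; cases "\<psi> u") auto
qed

lemma mem_proxI:
  fixes \<psi> :: "'a::real_inner \<Rightarrow> ereal"
  assumes p: "\<psi> x = ereal p" and \<gamma>: "0 < \<gamma>"
    and le: "\<And>u. ereal p \<le> \<psi> u + ereal (v \<bullet> (u - x) + (norm (u - x))\<^sup>2 / (2 * \<gamma>))"
  shows "x \<in> prox \<gamma> \<psi> (x - \<gamma> *\<^sub>R v)"
proof -
  have "\<psi> x + ereal (1 / (2 * \<gamma>) * (norm (x - (x - \<gamma> *\<^sub>R v)))\<^sup>2)
      \<le> \<psi> u + ereal (1 / (2 * \<gamma>) * (norm (u - (x - \<gamma> *\<^sub>R v)))\<^sup>2)" for u
    using le[of u] prox_objective_expand[OF \<gamma>, of u x v] prox_objective_expand[OF \<gamma>, of x x v]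
    by (cases "\<psi> u") (auto simp: p)
  then show ?thesis unfolding prox_def is_arg_min_def by (auto simp: not_less)
qed

lemma prox_bounded_minorant:
  assumes "prox_bounded \<psi>"
  obtains c a :: real where "0 \<le> a" "\<And>u. ereal (c - a * (norm u)\<^sup>2) \<le> \<psi> u"
proof -
  obtain \<gamma> c where \<gamma>: "\<gamma> > 0" "\<And>u. ereal c \<le> \<psi> u + ereal (1 / (2 * \<gamma>) * (norm u)\<^sup>2)"
    using assms unfolding prox_bounded_def moreau_bounded_below_def by auto
  have "ereal (c - 1 / (2 * \<gamma>) * (norm u)\<^sup>2) \<le> \<psi> u" for u
    using \<gamma>(2)[of u] by (cases "\<psi> u") auto
  then show ?thesis using \<gamma>(1) by (intro that[of "1 / (2 * \<gamma>)" c]) auto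
qed

section \<open>Deterministic analysis of a single path\<close>

text \<open>All randomness has been turned into properties of one sample path. The local estimates
  \<open>dev\<close> and \<open>up\<close> are required around every point, since compactness of the
  whole orbit is used, and the smooth estimate \<open>grad\<close> around stationary points only. In
  \<open>up\<close> a single \<open>L\<close> bounds both the subgradient averages and the
  curvature.\<close>

locale pss_path =
  fixes E :: "'a::euclidean_space \<Rightarrow> real" and Es :: "nat \<Rightarrow> 'a \<Rightarrow> real" and \<psi> :: "'a \<Rightarrow> ereal"
    and x v :: "nat \<Rightarrow> 'a" and g e :: "nat \<Rightarrow> real" and \<rho> \<sigma> \<gamma>min :: real
    and xbar :: 'a and r :: "nat \<Rightarrow> nat"
  assumes proper: "proper_fun \<psi>" and lsc: "lower_semicontinuous \<psi>" and pb: "prox_bounded \<psi>"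
    and E_lip: "\<And>c. \<exists>V \<kappa>. open V \<and> c \<in> V \<and> (\<forall>y\<in>V. \<forall>z\<in>V. \<bar>E y - E z\<bar> \<le> \<kappa> * norm (y - z))"
    and dev: "\<And>c. \<exists>V C. open V \<and> c \<in> V \<and> eventually (\<lambda>k. \<forall>y\<in>V. \<bar>Es k y - E y\<bar> \<le> C * e k) sequentially"
    and up: "\<And>c. \<exists>V L. open V \<and> c \<in> V \<and> (\<forall>k. x k \<in> V \<longrightarrow> norm (v k) \<le> L \<and>
        (\<forall>y\<in>V. Es k y \<le> Es k (x k) + v k \<bullet> (y - x k) + L * (norm (y - x k))\<^sup>2))"
    and grad: "\<And>c. c \<in> stationary_points E \<psi> \<Longrightarrow> \<exists>V C G. open V \<and> c \<in> V \<and>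
        (\<forall>y\<in>V. \<forall>u\<in>V. \<bar>E u - E y - G y \<bullet> (u - y)\<bar> \<le> C * (norm (u - y))\<^sup>2 \<and>
           norm (G u - G y) \<le> C * norm (u - y)) \<and>
        eventually (\<lambda>k. x k \<in> V \<longrightarrow> norm (v k - G (x k)) \<le> C * e k) sequentially"
    and ls: "\<And>k. PSS_linesearch (composite (Es k) \<psi>) \<psi> \<rho> \<sigma> (g k) (x k) (v k) (x (Suc k))"
    and g: "\<And>k. \<gamma>min \<le> g k"
    and e: "\<And>k. 0 \<le> e k" "summable e"
    and dom: "\<psi> (x 0) < \<infinity>"
    and \<rho>: "0 < \<rho>" "\<rho> < 1" and \<sigma>: "0 < \<sigma>" and \<gamma>min: "0 < \<gamma>min"
    and bdd: "bounded (range x)" and sub: "strict_mono r" "(x \<circ> r) \<longlonglongrightarrow> xbar"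
begin

definition "p k = real_of_ereal (\<psi> (x k))"

definition "W k = E (x k) + p k"

lemma step_pos: "0 < \<rho> ^ j * g k"
  using \<rho> \<gamma>min g[of k] by (intro mult_pos_pos) auto

lemma psi_finite: "\<psi> (x k) = ereal (p k)"
proof -
  have "\<bar>\<psi> (x k)\<bar> \<noteq> \<infinity>"
  proof (cases k)
    case 0
    then show ?thesis using dom proper by (cases "\<psi> (x 0)") (auto simp: proper_fun_def)
  next
    case (Suc j)
    obtain m y where "\<forall>i\<le>m. y i \<in> prox (\<rho> ^ i * g j) \<psi> (x j - (\<rho> ^ i * g j) *\<^sub>R v j)" "x (Suc j) = y m"
      using ls[of j] unfolding PSS_linesearch_def by blast
    then have "x (Suc j) \<in> prox (\<rho> ^ m * g j) \<psi> (x j - (\<rho> ^ m * g j) *\<^sub>R v j)" by simp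
    from prox_step(1)[OF proper step_pos this] show ?thesis by (simp add: Suc)
  qed
  then show ?thesis unfolding p_def by (rule ereal_real'[symmetric])
qed

text \<open>The negated comparison is the exit test of the backtracking loop. The value at the
  current iterate is finite, so the extended-real arithmetic reduces to a real bound on
  \<open>\<psi> y\<close>.\<close>

lemma composite_le_iff:
  "\<not> composite f \<psi> y > composite f \<psi> (x k) - ereal s \<longleftrightarrow> \<psi> y \<le> ereal (f (x k) + p k - s - f y)"
  using proper unfolding composite_def psi_finite
  by (cases "\<psi> y") (auto simp: proper_fun_def not_less algebra_simps)

lemma es_descent: "Es k (x (Suc k)) + p (Suc k) \<le> Es k (x k) + p k - \<sigma> * (norm (x (Suc k) - x k))\<^sup>2"
proof -
  have "\<not> composite (Es k) \<psi> (x (Suc k)) > composite (Es k) \<psi> (x k) - ereal (\<sigma> * (norm (x (Suc k) - x k))\<^sup>2)"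
  proof -
    obtain m y where "\<not> composite (Es k) \<psi> (y m) > composite (Es k) \<psi> (x k) - ereal (\<sigma> * (norm (y m - x k))\<^sup>2)"
      "x (Suc k) = y m"
      using ls[of k] unfolding PSS_linesearch_def by blast
    then show ?thesis by (simp only: not_False_eq_True)
  qed
  then show ?thesis unfolding composite_le_iff psi_finite by simp
qed

lemma E_continuous: "continuous_on UNIV E"
proof -
  have "isCont E c" for c
  proof -
    obtain V \<kappa> where V: "open V" "c \<in> V" and lip: "\<forall>y\<in>V. \<forall>z\<in>V. \<bar>E y - E z\<bar> \<le> \<kappa> * norm (y - z)"
      using E_lip[of c] by blast
    have "eventually (\<lambda>y. norm (E y - E c) \<le> \<kappa> * norm (y - c)) (at c)"
      using eventually_at_in_open'[OF V] by eventually_elim (use lip V in auto)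
    moreover have "((\<lambda>y. \<kappa> * norm (y - c)) \<longlongrightarrow> \<kappa> * norm (c - c)) (at c)"
      by (intro tendsto_intros)
    then have "((\<lambda>y. \<kappa> * norm (y - c)) \<longlongrightarrow> 0) (at c)" by simp
    ultimately have "((\<lambda>y. E y - E c) \<longlongrightarrow> 0) (at c)"
      by (rule Lim_null_comparison)
    then show ?thesis by (simp add: isCont_def LIM_zero_iff)
  qed
  then show ?thesis by (simp add: continuous_on_eq_continuous_at)
qed

lemma x_bounded: obtains N where "\<And>k. norm (x k) \<le> N"
  using bdd unfolding bounded_iff by blast

lemma E_bounded: obtains R where "\<And>k. \<bar>E (x k)\<bar> \<le> R"
proof -
  have "compact (closure (range x))" using bdd by simp
  then have "compact (E ` closure (range x))"
    using E_continuous continuous_on_subset by (intro compact_continuous_image) auto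
  then obtain R where "\<forall>y\<in>E ` closure (range x). norm y \<le> R"
    using compact_imp_bounded bounded_iff by blast
  then show ?thesis using closure_subset[of "range x"] by (intro that[of R]) auto
qed

text \<open>The descent estimate is needed along the entire sequence, not only near
  \<open>xbar\<close>. Compactness of the closure of the bounded orbit replaces the local constants
  by one.\<close>

lemma dev_uniform:
  obtains C K where "0 \<le> C" "\<And>k j. k \<ge> K \<Longrightarrow> \<bar>Es k (x j) - E (x j)\<bar> \<le> C * e k"
proof -
  \<comment> \<open>Neighbourhood and constant are packed into a pair so that one application of
    choice selects both.\<close>
  define good where "good c Z \<longleftrightarrow> open (fst Z) \<and> c \<in> fst Z \<and>
    eventually (\<lambda>k. \<forall>y\<in>fst Z. \<bar>Es k y - E y\<bar> \<le> snd Z * e k) sequentially" for c and Z :: "'a set \<times> real"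
  have "\<forall>c. \<exists>Z. good c Z"
  proof
    fix c
    obtain V C where "open V \<and> c \<in> V \<and> eventually (\<lambda>k. \<forall>y\<in>V. \<bar>Es k y - E y\<bar> \<le> C * e k) sequentially"
      using dev[of c] by blast
    then show "\<exists>Z. good c Z" by (intro exI[of _ "(V, C)"]) (simp add: good_def)
  qed
  from choice[OF this] obtain Z where Z: "\<And>c. good c (Z c)" by blast
  define V C where "V c = fst (Z c)" and "C c = snd (Z c)" for c
  have VC: "open (V c)" "c \<in> V c"
    "eventually (\<lambda>k. \<forall>y\<in>V c. \<bar>Es k y - E y\<bar> \<le> C c * e k) sequentially" for c
    using Z[of c] unfolding good_def V_def C_def by blast+
  have "compact (closure (range x))" using bdd by simp
  then obtain F where F: "finite F" "closure (range x) \<subseteq> (\<Union>c\<in>F. V c)"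
  proof (rule compactE_image[of _ UNIV V])
    show "closure (range x) \<subseteq> (\<Union>c. V c)" using VC(2) by auto
  qed (use VC(1) in auto)
  define C' where "C' = (\<Sum>c\<in>F. \<bar>C c\<bar>)"
  have "eventually (\<lambda>k. \<forall>c\<in>F. \<forall>y\<in>V c. \<bar>Es k y - E y\<bar> \<le> C c * e k) sequentially"
    using F(1) VC(3) by (simp add: eventually_ball_finite)
  then obtain K where K: "\<And>k c y. k \<ge> K \<Longrightarrow> c \<in> F \<Longrightarrow> y \<in> V c \<Longrightarrow> \<bar>Es k y - E y\<bar> \<le> C c * e k"
    unfolding eventually_sequentially by blast
  show ?thesis
  proof (rule that[of C' K])
    show "0 \<le> C'" unfolding C'_def by (rule sum_nonneg) auto
    fix k j assume k: "K \<le> k"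
    have "x j \<in> closure (range x)" using closure_subset[of "range x"] by (rule subsetD) simp
    then have "x j \<in> (\<Union>c\<in>F. V c)" using F(2) by (rule subsetD[rotated])
    then obtain c where c: "c \<in> F" "x j \<in> V c" by (rule UN_E)
    have "\<bar>Es k (x j) - E (x j)\<bar> \<le> C c * e k" using K[OF k c] .
    also have "\<dots> \<le> C' * e k"
    proof (rule mult_right_mono[OF _ e(1)])
      have "\<bar>C c\<bar> \<le> C'" unfolding C'_def using F(1) c(1) by (intro member_le_sum) auto
      then show "C c \<le> C'" by linarith
    qed
    finally show "\<bar>Es k (x j) - E (x j)\<bar> \<le> C' * e k" .
  qed
qed

lemma W_descent:
  obtains A K where "0 \<le> A"
    "\<And>k. k \<ge> K \<Longrightarrow> W (Suc k) + \<sigma> * (norm (x (Suc k) - x k))\<^sup>2 \<le> W k + A * e k"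
proof -
  obtain C K where C: "0 \<le> C" "\<And>k j. k \<ge> K \<Longrightarrow> \<bar>Es k (x j) - E (x j)\<bar> \<le> C * e k"
    using dev_uniform by blast
  show ?thesis
  \<comment> \<open>The line search controls the sample objective; passing to the expectation costs
    one deviation at each end of the step.\<close>
  proof (rule that[of "2 * C" K])
    fix k assume "k \<ge> K"
    then show "W (Suc k) + \<sigma> * (norm (x (Suc k) - x k))\<^sup>2 \<le> W k + 2 * C * e k"
      using es_descent[of k] C(2)[of k k] C(2)[of k "Suc k"] unfolding W_def by linarith
  qed (use C in simp)
qed

text \<open>Adding the error tail makes the objective values decrease from some index on. They are
  bounded below because the iterates are bounded, \<open>E\<close> is continuous and
  \<open>\<psi>\<close> has a quadratic minorant. The upper bound on \<open>p\<close> comes from the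
  same monotonicity.\<close>

lemma W_convergent:
  obtains w P K where "W \<longlonglongrightarrow> w" "(\<lambda>k. x (Suc k) - x k) \<longlonglongrightarrow> 0" "\<And>k. k \<ge> K \<Longrightarrow> p k \<le> P"
proof -
  obtain A K where A: "0 \<le> A"
    "\<And>k. k \<ge> K \<Longrightarrow> W (Suc k) + \<sigma> * (norm (x (Suc k) - x k))\<^sup>2 \<le> W k + A * e k"
    using W_descent by blast
  define T where "T k = (\<Sum>t. e (k + t))" for k
  have TS: "T k = e k + T (Suc k)" for k unfolding T_def by (rule tail_suminf_Suc[OF e(2)])
  have T0: "T \<longlonglongrightarrow> 0" unfolding T_def by (rule tail_suminf_tendsto_0[OF e(2)])
  have Tn: "0 \<le> T k" for k
    unfolding T_def by (rule tail_suminf_nonneg[OF e(2) e(1)])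
  define Y where "Y k = W (K + k) + A * T (K + k)" for k
  have Ydesc: "Y (Suc k) + \<sigma> * (norm (x (Suc (K + k)) - x (K + k)))\<^sup>2 \<le> Y k" for k
    using A(2)[of "K + k"] TS[of "K + k"] by (simp add: Y_def algebra_simps)
  have Yle: "Y (Suc k) \<le> Y k" for k
  proof -
    have "0 \<le> \<sigma> * (norm (x (Suc (K + k)) - x (K + k)))\<^sup>2" using \<sigma> by simp
    then show ?thesis using Ydesc[of k] by linarith
  qed
  then have dec: "decseq Y" by (rule decseq_SucI)
  obtain R where R: "\<And>k. \<bar>E (x k)\<bar> \<le> R" using E_bounded by blast
  obtain c a where ca: "0 \<le> a" "\<And>u. ereal (c - a * (norm u)\<^sup>2) \<le> \<psi> u"
    using prox_bounded_minorant[OF pb] by metis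
  obtain N where N: "\<And>k. norm (x k) \<le> N" using x_bounded by blast
  have "c - a * N\<^sup>2 - R \<le> Y k" for k
  proof -
    have "c - a * (norm (x (K + k)))\<^sup>2 \<le> p (K + k)"
      using ca(2)[of "x (K + k)"] by (simp add: psi_finite)
    moreover have "a * (norm (x (K + k)))\<^sup>2 \<le> a * N\<^sup>2"
      using N ca by (intro mult_left_mono power_mono) auto
    moreover have "0 \<le> A * T (K + k)" using A Tn by simp
    ultimately show ?thesis using R[of "K + k"] unfolding Y_def W_def by linarith
  qed
  then obtain w where w: "Y \<longlonglongrightarrow> w" using decseq_convergent[OF dec] by blast
  have "(\<lambda>k. Y k - A * T (k + K)) \<longlonglongrightarrow> w - A * 0"
    by (intro tendsto_intros w LIMSEQ_ignore_initial_segment T0)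
  then have "(\<lambda>k. W (k + K)) \<longlonglongrightarrow> w" by (simp add: Y_def add.commute)
  then have W: "W \<longlonglongrightarrow> w" by (rule LIMSEQ_offset)
  have "(\<lambda>k. sqrt ((Y k - Y (Suc k)) / \<sigma>)) \<longlonglongrightarrow> sqrt ((w - w) / \<sigma>)"
    using \<sigma> by (intro tendsto_intros w LIMSEQ_Suc) auto
  then have "(\<lambda>k. sqrt ((Y k - Y (Suc k)) / \<sigma>)) \<longlonglongrightarrow> 0" by simp
  moreover have "norm (x (Suc (k + K)) - x (k + K)) \<le> sqrt ((Y k - Y (Suc k)) / \<sigma>)" for k
  proof (rule real_le_rsqrt)
    show "(norm (x (Suc (k + K)) - x (k + K)))\<^sup>2 \<le> (Y k - Y (Suc k)) / \<sigma>"
      using Ydesc[of k] \<sigma> by (simp add: field_simps add.commute)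
  qed
  ultimately have "(\<lambda>k. x (Suc (k + K)) - x (k + K)) \<longlonglongrightarrow> 0"
    by (intro Lim_null_comparison[of "\<lambda>k. x (Suc (k + K)) - x (k + K)"]) auto
  then have X: "(\<lambda>k. x (Suc k) - x k) \<longlonglongrightarrow> 0"
    by (rule LIMSEQ_offset[where f = "\<lambda>k. x (Suc k) - x k"])
  have "p k \<le> Y 0 + R" if "k \<ge> K" for k
  proof -
    have "Y (k - K) \<le> Y 0" using dec by (simp add: decseq_def)
    moreover have "0 \<le> A * T k" using A Tn by simp
    ultimately show ?thesis using R[of k] that by (simp add: Y_def W_def)
  qed
  then show ?thesis using that[OF W X] by blast
qed

text \<open>A small step size forces the trial point to stay near \<open>x k\<close>, hence in the
  neighbourhood where the upper-C2 inequality holds; that inequality then makes the line search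
  accept. Rejections can thus occur only above a fixed threshold.\<close>

lemma step_lower_bound:
  obtains V \<gamma>\<^sub>0 K where "open V" "xbar \<in> V" "0 < \<gamma>\<^sub>0"
    "\<And>k. k \<ge> K \<Longrightarrow> x k \<in> V \<Longrightarrow> \<exists>\<gamma>\<ge>\<gamma>\<^sub>0. x (Suc k) \<in> prox \<gamma> \<psi> (x k - \<gamma> *\<^sub>R v k)"
proof -
  obtain P K where P: "\<And>k. k \<ge> K \<Longrightarrow> p k \<le> P" using W_convergent by metis
  obtain c a where ca: "0 \<le> a" "\<And>u. ereal (c - a * (norm u)\<^sup>2) \<le> \<psi> u"
    using prox_bounded_minorant[OF pb] by metis
  obtain N where N: "\<And>k. norm (x k) \<le> N" using x_bounded by blast
  obtain V L where V: "open V" "xbar \<in> V" and upV: "\<And>k. x k \<in> V \<Longrightarrow> norm (v k) \<le> L"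
    "\<And>k y. x k \<in> V \<Longrightarrow> y \<in> V \<Longrightarrow> Es k y \<le> Es k (x k) + v k \<bullet> (y - x k) + L * (norm (y - x k))\<^sup>2"
    using up[of xbar] by metis
  obtain d where d: "d > 0" "ball xbar d \<subseteq> V" using V by (meson openE)
  \<comment> \<open>Half of the radius for \<open>x k\<close>, half for the displacement of the
    trial point.\<close>
  define \<delta> where "\<delta> = d / 2"
  have \<delta>: "\<delta> > 0" using d by (simp add: \<delta>_def)
  \<comment> \<open>Collects the terms of the proximal inequality that do not contain the squared
    displacement \<open>s\<close>: the bound on \<open>p k\<close>, the quadratic minorant at
    \<open>norm y\<close>, and Young's inequality for the linear term.\<close>
  define Q where "Q = \<bar>P\<bar> + \<bar>c\<bar> + 2 * a * N\<^sup>2 + L\<^sup>2 / 2"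
  have Q: "Q \<ge> 0" using ca by (simp add: Q_def)
  \<comment> \<open>The part \<open>2 * a + 1 / 2\<close> absorbs the multiples of \<open>s\<close>
    from the minorant and from Young's inequality, \<open>(Q + 1) / \<delta>\<^sup>2\<close> forces
    \<open>s < \<delta>\<^sup>2\<close>, and \<open>\<bar>L\<bar> + \<sigma>\<close> covers
    curvature plus the required decrease.\<close>
  define \<Gamma> where "\<Gamma> = 2 * a + 1 / 2 + (Q + 1) / \<delta>\<^sup>2 + \<bar>L\<bar> + \<sigma>"
  have \<Gamma>: "\<Gamma> > 0" using ca Q \<delta> \<sigma> by (auto simp: \<Gamma>_def intro!: add_nonneg_pos add_nonneg_nonneg)
  have acc: "\<not> composite (Es k) \<psi> y > composite (Es k) \<psi> (x k) - ereal (\<sigma> * (norm (y - x k))\<^sup>2)"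
    if k: "k \<ge> K" "x k \<in> ball xbar \<delta>" and \<gamma>: "0 < \<gamma>" "\<gamma> \<le> 1 / (2 * \<Gamma>)"
      and y: "y \<in> prox \<gamma> \<psi> (x k - \<gamma> *\<^sub>R v k)" for k y \<gamma>
  proof -
    define s where "s = (norm (y - x k))\<^sup>2"
    have s: "s \<ge> 0" by (simp add: s_def)
    have xV: "x k \<in> V" using k(2) d by (auto simp: \<delta>_def)
    have \<Gamma>\<gamma>: "\<Gamma> \<le> 1 / (2 * \<gamma>)" using \<gamma> \<Gamma> by (simp add: field_simps)
    have \<psi>y: "\<psi> y = ereal (real_of_ereal (\<psi> y))"
      using prox_step(1)[OF proper \<gamma>(1) y] by (rule ereal_real'[symmetric])
    have "ereal (real_of_ereal (\<psi> y) + v k \<bullet> (y - x k) + (norm (y - x k))\<^sup>2 / (2 * \<gamma>))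
      \<le> \<psi> (x k) + ereal (v k \<bullet> (x k - x k) + (norm (x k - x k))\<^sup>2 / (2 * \<gamma>))"
      by (rule prox_step(2)[OF proper \<gamma>(1) y])
    then have px: "real_of_ereal (\<psi> y) + v k \<bullet> (y - x k) + s * (1 / (2 * \<gamma>)) \<le> p k"
      by (simp add: psi_finite s_def)
    have py: "c - a * (norm y)\<^sup>2 \<le> real_of_ereal (\<psi> y)"
      using ca(2)[of y] \<psi>y by (metis ereal_less_eq(3))
    have "norm y \<le> norm (y - x k) + norm (x k)" using norm_triangle_ineq[of "y - x k" "x k"] by simp
    then have "(norm y)\<^sup>2 \<le> (norm (y - x k) + norm (x k))\<^sup>2" by (intro power_mono) auto
    also have "\<dots> \<le> 2 * s + 2 * (norm (x k))\<^sup>2"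
      using sum_squares_bound[of "norm (y - x k)" "norm (x k)"] by (simp add: s_def power2_sum)
    also have "(norm (x k))\<^sup>2 \<le> N\<^sup>2" using N by (intro power_mono) auto
    finally have "a * (norm y)\<^sup>2 \<le> a * (2 * s + 2 * N\<^sup>2)" using ca(1) by (intro mult_left_mono) auto
    then have 1: "c - 2 * a * N\<^sup>2 - 2 * a * s \<le> real_of_ereal (\<psi> y)" using py by (simp add: algebra_simps)
    have "\<bar>v k \<bullet> (y - x k)\<bar> \<le> norm (v k) * norm (y - x k)" by (rule Cauchy_Schwarz_ineq2)
    also have "\<dots> \<le> L * norm (y - x k)" using upV(1)[OF xV] by (intro mult_right_mono) auto
    also have "\<dots> \<le> L\<^sup>2 / 2 + s / 2"
      using sum_squares_bound[of L "norm (y - x k)"] by (simp add: s_def)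
    finally have 2: "- (L\<^sup>2 / 2) - s / 2 \<le> v k \<bullet> (y - x k)" by linarith
    have "s * \<Gamma> \<le> s * (1 / (2 * \<gamma>))" using \<Gamma>\<gamma> s by (intro mult_left_mono) auto
    then have "s * \<Gamma> \<le> Q + 2 * a * s + s / 2" using 1 2 px P[OF k(1)] unfolding Q_def by linarith
    moreover have "s * \<Gamma> = 2 * a * s + s / 2 + s * ((Q + 1) / \<delta>\<^sup>2) + s * \<bar>L\<bar> + s * \<sigma>"
      by (simp add: \<Gamma>_def algebra_simps)
    moreover have "0 \<le> s * \<bar>L\<bar>" "0 \<le> s * \<sigma>" using s \<sigma> by auto
    ultimately have "s * ((Q + 1) / \<delta>\<^sup>2) \<le> Q" by linarith
    then have "s * (Q + 1) \<le> Q * \<delta>\<^sup>2" using \<delta> by (simp add: field_simps)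
    also have "\<dots> < (Q + 1) * \<delta>\<^sup>2" using \<delta> by simp
    finally have "s < \<delta>\<^sup>2" using Q by (simp add: mult.commute)
    then have "norm (y - x k) < \<delta>" using \<delta> unfolding s_def by (simp add: power_less_imp_less_base)
    then have "dist xbar y < d" using k(2) dist_triangle[of xbar y "x k"]
      by (simp add: \<delta>_def dist_norm norm_minus_commute)
    then have yV: "y \<in> V" using d by auto
    have "s * (L + \<sigma>) \<le> s * \<Gamma>"
    proof (rule mult_left_mono[OF _ s])
      have "0 \<le> (Q + 1) / \<delta>\<^sup>2" using Q by simp
      then show "L + \<sigma> \<le> \<Gamma>" unfolding \<Gamma>_def using ca(1) by linarith
    qed
    then have "real_of_ereal (\<psi> y) \<le> Es k (x k) + p k - \<sigma> * s - Es k y"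
      using upV(2)[OF xV yV] px \<open>s * \<Gamma> \<le> s * (1 / (2 * \<gamma>))\<close>
      by (simp add: s_def[symmetric] algebra_simps)
    then show ?thesis unfolding composite_le_iff s_def[symmetric] using \<psi>y by (metis ereal_less_eq(3))
  qed
  \<comment> \<open>Either the initial step size is accepted, or the last rejected one exceeded
    \<open>1 / (2 * \<Gamma>)\<close> and was shrunk once by \<open>\<rho>\<close>.\<close>
  define \<gamma>\<^sub>0 where "\<gamma>\<^sub>0 = min \<gamma>min (\<rho> * (1 / (2 * \<Gamma>)))"
  have g0: "\<gamma>\<^sub>0 > 0" using \<gamma>min \<rho> \<Gamma> by (simp add: \<gamma>\<^sub>0_def)
  show ?thesis
  proof (rule that[of "ball xbar \<delta>" \<gamma>\<^sub>0 K])
    fix k assume k: "k \<ge> K" "x k \<in> ball xbar \<delta>"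
    obtain m y where m: "\<And>j. j \<le> m \<Longrightarrow> y j \<in> prox (\<rho> ^ j * g k) \<psi> (x k - (\<rho> ^ j * g k) *\<^sub>R v k)"
      "\<And>j. j < m \<Longrightarrow> composite (Es k) \<psi> (y j) > composite (Es k) \<psi> (x k) - ereal (\<sigma> * (norm (y j - x k))\<^sup>2)"
      "x (Suc k) = y m"
      using ls[of k] unfolding PSS_linesearch_def by blast
    have "\<gamma>\<^sub>0 \<le> \<rho> ^ m * g k"
    proof (cases m)
      case 0
      then show ?thesis using g[of k] by (simp add: \<gamma>\<^sub>0_def)
    next
      case (Suc j)
      have "\<not> \<rho> ^ j * g k \<le> 1 / (2 * \<Gamma>)"
        using acc[OF k step_pos _ m(1)] m(2) Suc by (meson Suc_n_not_le_n le_refl lessI less_imp_le)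
      then have "\<rho> * (1 / (2 * \<Gamma>)) \<le> \<rho> * (\<rho> ^ j * g k)" using \<rho> by (intro mult_left_mono) auto
      then show ?thesis by (simp add: \<gamma>\<^sub>0_def Suc mult.assoc)
    qed
    then show "\<exists>\<gamma>\<ge>\<gamma>\<^sub>0. x (Suc k) \<in> prox \<gamma> \<psi> (x k - \<gamma> *\<^sub>R v k)"
      using m(1)[of m] m(3) by auto
  qed (use \<delta> g0 in auto)
qed

text \<open>Both defining properties of stationarity are closed under limits along a subsequence:
  the proximal inequality because the step sizes are at least \<open>\<gamma>\<^sub>0\<close>, and
  the quadratic supergradient inequality because its constants are uniform near \<open>xbar\<close>.
  The values converge although \<open>\<psi>\<close> is only lower semicontinuous, by testing the
  proximal inequality at \<open>xbar\<close>.\<close>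

lemma accumulation_point_stationary:
  "xbar \<in> stationary_points E \<psi>" and accumulation_value_finite: "\<bar>\<psi> xbar\<bar> \<noteq> \<infinity>"
  and W_tendsto: "W \<longlonglongrightarrow> E xbar + real_of_ereal (\<psi> xbar)"
proof -
  obtain w where w: "W \<longlonglongrightarrow> w" and d0: "(\<lambda>k. x (Suc k) - x k) \<longlonglongrightarrow> 0"
    using W_convergent by metis
  obtain V1 \<gamma>\<^sub>0 K where V1: "open V1" "xbar \<in> V1" and \<gamma>0: "0 < \<gamma>\<^sub>0" and
    step: "\<And>k. k \<ge> K \<Longrightarrow> x k \<in> V1 \<Longrightarrow> \<exists>\<gamma>\<ge>\<gamma>\<^sub>0. x (Suc k) \<in> prox \<gamma> \<psi> (x k - \<gamma> *\<^sub>R v k)"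
    using step_lower_bound by metis
  obtain V2 L where V2: "open V2" "xbar \<in> V2" and upV: "\<And>k. x k \<in> V2 \<Longrightarrow> norm (v k) \<le> L"
    "\<And>k y. x k \<in> V2 \<Longrightarrow> y \<in> V2 \<Longrightarrow> Es k y \<le> Es k (x k) + v k \<bullet> (y - x k) + L * (norm (y - x k))\<^sup>2"
    using up[of xbar] by metis
  obtain V3 C where V3: "open V3" "xbar \<in> V3" and
    devV: "eventually (\<lambda>k. \<forall>y\<in>V3. \<bar>Es k y - E y\<bar> \<le> C * e k) sequentially"
    using dev[of xbar] by blast
  obtain V4 \<kappa> where V4: "open V4" "xbar \<in> V4" and lip: "\<forall>y\<in>V4. \<forall>z\<in>V4. \<bar>E y - E z\<bar> \<le> \<kappa> * norm (y - z)"
    using E_lip[of xbar] by blast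
  define V where "V = V1 \<inter> V2 \<inter> V3 \<inter> V4"
  have V: "open V" "xbar \<in> V" using V1 V2 V3 V4 by (auto simp: V_def)
  have "eventually (\<lambda>i. (x \<circ> r) i \<in> V) sequentially"
    using sub(2) V by (rule topological_tendstoD)
  then obtain i0 where i0: "\<And>i. i \<ge> i0 \<Longrightarrow> x (r i) \<in> V" by (auto simp: eventually_sequentially)
  \<comment> \<open>The subgradient averages are bounded near \<open>xbar\<close>; a further
    subsequence makes them converge to the candidate \<open>vbar\<close>.\<close>
  have "bounded (range (\<lambda>i. v (r (i + i0))))"
    unfolding bounded_iff using upV(1) i0 by (intro exI[of _ L]) (auto simp: V_def)
  then obtain vbar s where s: "strict_mono s" and vs: "((\<lambda>i. v (r (i + i0))) \<circ> s) \<longlonglongrightarrow> vbar"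
    using bounded_imp_convergent_subsequence by blast
  define h where "h i = r (s i + i0)" for i
  have hm: "strict_mono h"
    using sub(1) s unfolding strict_mono_def h_def by simp
  have hV: "x (h i) \<in> V" for i using i0 by (simp add: h_def)
  have vh: "(\<lambda>i. v (h i)) \<longlonglongrightarrow> vbar" using vs by (simp add: h_def comp_def)
  have xh: "(\<lambda>i. x (h i)) \<longlonglongrightarrow> xbar"
  proof -
    have "(\<lambda>i. (x \<circ> r) (s i + i0)) \<longlonglongrightarrow> xbar"
      using LIMSEQ_subseq_LIMSEQ[OF LIMSEQ_ignore_initial_segment[OF sub(2), of i0] s] by (simp add: comp_def)
    then show ?thesis by (simp add: h_def)
  qed
  have lim: "F \<longlonglongrightarrow> l \<Longrightarrow> (\<lambda>i. F (h i)) \<longlonglongrightarrow> l" for F :: "nat \<Rightarrow> 'b::topological_space" and l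
    using LIMSEQ_subseq_LIMSEQ[OF _ hm] by (simp add: comp_def)
  have xSh: "(\<lambda>i. x (Suc (h i))) \<longlonglongrightarrow> xbar"
    using tendsto_add[OF lim[OF d0] xh] by simp
  have evK: "eventually (\<lambda>i. K \<le> h i) sequentially"
    using filterlim_subseq[OF hm] by (simp add: filterlim_at_top)
  \<comment> \<open>The accepted step sizes vary with the iteration. Replacing each by its lower
    bound \<open>\<gamma>\<^sub>0\<close> only enlarges the right side and leaves a fixed parameter
    for the limit.\<close>
  have key: "eventually (\<lambda>i. ereal (p (Suc (h i))) \<le>
      \<psi> u + ereal (v (h i) \<bullet> (u - x (Suc (h i))) + (norm (u - x (h i)))\<^sup>2 / (2 * \<gamma>\<^sub>0))) sequentially" for u
    using evK
  proof eventually_elim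
    case (elim i)
    have "x (h i) \<in> V1" using hV by (simp add: V_def)
    then obtain \<gamma> where \<gamma>: "\<gamma> \<ge> \<gamma>\<^sub>0" "x (Suc (h i)) \<in> prox \<gamma> \<psi> (x (h i) - \<gamma> *\<^sub>R v (h i))"
      using step[OF elim] by blast
    have gp: "0 < \<gamma>" using \<gamma> \<gamma>0 by simp
    have *: "ereal (p (Suc (h i)) + v (h i) \<bullet> (x (Suc (h i)) - x (h i)) + (norm (x (Suc (h i)) - x (h i)))\<^sup>2 / (2 * \<gamma>))
      \<le> \<psi> u + ereal (v (h i) \<bullet> (u - x (h i)) + (norm (u - x (h i)))\<^sup>2 / (2 * \<gamma>))"
      using prox_step(2)[OF proper gp \<gamma>(2)] by (simp add: p_def)
    have 1: "(norm (u - x (h i)))\<^sup>2 / (2 * \<gamma>) \<le> (norm (u - x (h i)))\<^sup>2 / (2 * \<gamma>\<^sub>0)"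
      using \<gamma>(1) \<gamma>0 by (intro divide_left_mono) auto
    have 2: "0 \<le> (norm (x (Suc (h i)) - x (h i)))\<^sup>2 / (2 * \<gamma>)" using gp by simp
    show ?case
      using * 1 2 by (cases "\<psi> u") (auto simp: inner_diff_right algebra_simps)
  qed
  have ineq: "\<psi> xbar \<le> \<psi> u + ereal (vbar \<bullet> (u - xbar) + (norm (u - xbar))\<^sup>2 / (2 * \<gamma>\<^sub>0))" for u
  proof (cases "\<psi> u")
    case (real pu)
    have "\<psi> xbar \<le> ereal (pu + (vbar \<bullet> (u - xbar) + (norm (u - xbar))\<^sup>2 / (2 * \<gamma>\<^sub>0)))"
    proof (rule lsc_le_limit[OF lsc xSh])
      show "eventually (\<lambda>i. \<psi> (x (Suc (h i))) \<le>
        ereal (pu + (v (h i) \<bullet> (u - x (Suc (h i))) + (norm (u - x (h i)))\<^sup>2 / (2 * \<gamma>\<^sub>0)))) sequentially"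
        using key[of u] by eventually_elim (simp add: real psi_finite)
      show "(\<lambda>i. pu + (v (h i) \<bullet> (u - x (Suc (h i))) + (norm (u - x (h i)))\<^sup>2 / (2 * \<gamma>\<^sub>0)))
          \<longlonglongrightarrow> pu + (vbar \<bullet> (u - xbar) + (norm (u - xbar))\<^sup>2 / (2 * \<gamma>\<^sub>0))"
        using \<gamma>0 by (intro tendsto_intros vh xh xSh) auto
    qed
    then show ?thesis by (simp add: real)
  next
    case MInf
    then show ?thesis using proper by (auto simp: proper_fun_def)
  qed simp
  obtain u0 where u0: "\<psi> u0 < \<infinity>" using proper by (auto simp: proper_fun_def)
  have "\<psi> xbar < \<infinity>" using ineq[of u0] u0 by (cases "\<psi> u0") auto
  moreover have "\<psi> xbar \<noteq> -\<infinity>" using proper by (auto simp: proper_fun_def)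
  ultimately show fin: "\<bar>\<psi> xbar\<bar> \<noteq> \<infinity>" by (cases "\<psi> xbar") auto
  define pbar where "pbar = real_of_ereal (\<psi> xbar)"
  have pbar: "\<psi> xbar = ereal pbar" using fin unfolding pbar_def by (rule ereal_real'[symmetric])
  have prox: "xbar \<in> prox \<gamma>\<^sub>0 \<psi> (xbar - \<gamma>\<^sub>0 *\<^sub>R vbar)"
    using ineq by (intro mem_proxI[where \<psi> = \<psi>, OF pbar \<gamma>0]) (simp add: pbar)
  have Exh: "(\<lambda>i. E (x (h i))) \<longlonglongrightarrow> E xbar" "(\<lambda>i. E (x (Suc (h i)))) \<longlonglongrightarrow> E xbar"
    using E_continuous xh xSh by (auto simp: continuous_on_eq_continuous_at intro: isCont_tendsto_compose)
  have wh: "(\<lambda>i. W (Suc (h i))) \<longlonglongrightarrow> w" using lim[OF LIMSEQ_Suc[OF w]] .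
  have ph: "(\<lambda>i. p (Suc (h i))) \<longlonglongrightarrow> w - E xbar"
    using tendsto_diff[OF wh Exh(2)] by (simp add: W_def)
  have "pbar \<le> w - E xbar"
    using lsc_le_limit[OF lsc xSh _ ph] by (simp add: psi_finite pbar)
  \<comment> \<open>Testing with \<open>u = xbar\<close> gives the upper estimate that lower
    semicontinuity lacks.\<close>
  moreover have "w - E xbar \<le> pbar"
  proof (rule tendsto_le[OF sequentially_bot _ ph])
    show "eventually (\<lambda>i. p (Suc (h i)) \<le> pbar + (v (h i) \<bullet> (xbar - x (Suc (h i))) + (norm (xbar - x (h i)))\<^sup>2 / (2 * \<gamma>\<^sub>0))) sequentially"
      using key[of xbar] by eventually_elim (simp add: pbar)
    have "(\<lambda>i. pbar + (v (h i) \<bullet> (xbar - x (Suc (h i))) + (norm (xbar - x (h i)))\<^sup>2 / (2 * \<gamma>\<^sub>0)))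
        \<longlonglongrightarrow> pbar + (vbar \<bullet> (xbar - xbar) + (norm (xbar - xbar))\<^sup>2 / (2 * \<gamma>\<^sub>0))"
      using \<gamma>0 by (intro tendsto_intros vh xh xSh) auto
    then show "(\<lambda>i. pbar + (v (h i) \<bullet> (xbar - x (Suc (h i))) + (norm (xbar - x (h i)))\<^sup>2 / (2 * \<gamma>\<^sub>0))) \<longlonglongrightarrow> pbar"
      by simp
  qed
  ultimately have "w = E xbar + pbar" by simp
  then show "W \<longlonglongrightarrow> E xbar + real_of_ereal (\<psi> xbar)" using w by (simp add: pbar_def)
  have "vbar \<in> clarke_subdifferential (\<lambda>y. ereal (E y)) xbar"
  \<comment> \<open>The inequality is known for the sample averages; two deviations of order
    \<open>e\<close> transfer it to \<open>E\<close>, and they vanish in the limit.\<close>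
  proof (rule quadratic_supergradient_imp_clarke[OF V, where L = L and \<kappa> = \<kappa>])
    show "\<bar>E y - E z\<bar> \<le> \<kappa> * norm (y - z)" if "y \<in> V" "z \<in> V" for y z
      using lip that by (auto simp: V_def)
    have eh: "(\<lambda>i. e (h i)) \<longlonglongrightarrow> 0" using lim[OF summable_LIMSEQ_zero[OF e(2)]] .
    fix y assume y: "y \<in> V"
    have "eventually (\<lambda>i. \<forall>y\<in>V3. \<bar>Es (h i) y - E y\<bar> \<le> C * e (h i)) sequentially"
      by (rule eventually_subseq[OF hm devV])
    then have "eventually (\<lambda>i. E y \<le> E (x (h i)) + v (h i) \<bullet> (y - x (h i)) + L * (norm (y - x (h i)))\<^sup>2 + 2 * C * e (h i)) sequentially"
    proof eventually_elim
      case (elim i)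
      have "\<bar>Es (h i) y - E y\<bar> \<le> C * e (h i)" "\<bar>Es (h i) (x (h i)) - E (x (h i))\<bar> \<le> C * e (h i)"
        using elim y hV[of i] by (auto simp: V_def)
      moreover have "Es (h i) y \<le> Es (h i) (x (h i)) + v (h i) \<bullet> (y - x (h i)) + L * (norm (y - x (h i)))\<^sup>2"
        using y hV[of i] by (intro upV(2)) (auto simp: V_def)
      ultimately show ?case by linarith
    qed
    moreover have "(\<lambda>i. E (x (h i)) + v (h i) \<bullet> (y - x (h i)) + L * (norm (y - x (h i)))\<^sup>2 + 2 * C * e (h i))
       \<longlonglongrightarrow> E xbar + vbar \<bullet> (y - xbar) + L * (norm (y - xbar))\<^sup>2 + 2 * C * 0"
      by (intro tendsto_intros Exh vh xh eh)
    ultimately have "E y \<le> E xbar + vbar \<bullet> (y - xbar) + L * (norm (y - xbar))\<^sup>2 + 2 * C * 0"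
      by (intro tendsto_lowerbound[OF _ _ sequentially_bot])
    then show "E y \<le> E xbar + vbar \<bullet> (y - xbar) + L * (norm (y - xbar))\<^sup>2" by simp
  qed
  then show "xbar \<in> stationary_points E \<psi>"
    unfolding stationary_points_def using prox \<gamma>0 by blast
qed

definition "gap k = W k - (E xbar + real_of_ereal (\<psi> xbar))"

lemma composite_xbar: "composite E \<psi> xbar = ereal (E xbar + real_of_ereal (\<psi> xbar))"
  using ereal_real'[OF accumulation_value_finite] unfolding composite_def by (metis plus_ereal.simps(1))

lemma composite_x: "composite E \<psi> (x k) = ereal (W k)"
  by (simp add: composite_def psi_finite W_def)

lemma gap_eq: "real_of_ereal (composite E \<psi> (x k) - composite E \<psi> xbar) = gap k"
  by (simp add: composite_x composite_xbar gap_def)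

lemma gap_tendsto_0: "gap \<longlonglongrightarrow> 0"
  using tendsto_diff[OF W_tendsto tendsto_const[of "E xbar + real_of_ereal (\<psi> xbar)"]]
  by (simp add: gap_def[abs_def])

text \<open>The proximal step supplies an explicit subgradient of the full objective at
  \<open>x (Suc k)\<close>. It suffices to bound its norm, as KL involves the infimum over all
  subgradients, and then to solve the KL inequality for the gap, using that \<open>\<theta>'\<close>
  is a multiple of the gap to the power \<open>- \<beta>\<close>.\<close>

lemma KL_step:
  assumes KL: "KL_condition (composite E \<psi>) xbar (\<lambda>t. M * t powr (1 - \<beta>)) \<eta>"
    and M: "0 < M" and \<beta>: "0 < \<beta>" "\<beta> < 1" and pos: "\<And>k. k \<ge> p0 \<Longrightarrow> 0 < gap k"
  obtains \<delta> c K where "0 < \<delta>" "\<And>k. k \<ge> K \<Longrightarrow> x k \<in> ball xbar \<delta> \<Longrightarrow> x (Suc k) \<in> ball xbar \<delta> \<Longrightarrow>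
    gap (Suc k) powr \<beta> \<le> c * (norm (x (Suc k) - x k) + e k)"
proof -
  obtain V1 \<gamma>\<^sub>0 K1 where V1: "open V1" "xbar \<in> V1" and \<gamma>0: "0 < \<gamma>\<^sub>0" and
    step: "\<And>k. k \<ge> K1 \<Longrightarrow> x k \<in> V1 \<Longrightarrow> \<exists>\<gamma>\<ge>\<gamma>\<^sub>0. x (Suc k) \<in> prox \<gamma> \<psi> (x k - \<gamma> *\<^sub>R v k)"
    using step_lower_bound by metis
  obtain V2 C G where V2: "open V2" "xbar \<in> V2" and
    GG: "\<forall>y\<in>V2. \<forall>u\<in>V2. \<bar>E u - E y - G y \<bullet> (u - y)\<bar> \<le> C * (norm (u - y))\<^sup>2 \<and>
           norm (G u - G y) \<le> C * norm (u - y)" and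
    vG: "eventually (\<lambda>k. x k \<in> V2 \<longrightarrow> norm (v k - G (x k)) \<le> C * e k) sequentially"
    using grad[OF accumulation_point_stationary] by blast
  have G: "\<bar>E u - E y - G y \<bullet> (u - y)\<bar> \<le> C * (norm (u - y))\<^sup>2"
      "norm (G u - G y) \<le> C * norm (u - y)" if "y \<in> V2" "u \<in> V2" for y u
    using GG that by blast+
  have \<eta>: "0 < \<eta>" using KL by (simp add: KL_condition_def)
  define V where "V = V1 \<inter> V2 \<inter> ball xbar \<eta>"
  have V: "open V" "xbar \<in> V" using V1 V2 \<eta> by (auto simp: V_def)
  obtain \<delta> where \<delta>: "\<delta> > 0" "ball xbar \<delta> \<subseteq> V" using V by (meson openE)
  have "eventually (\<lambda>k. gap (Suc k) < \<eta>) sequentially"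
    using LIMSEQ_Suc[OF gap_tendsto_0] \<eta> by (rule order_tendstoD)
  then have "eventually (\<lambda>k. gap (Suc k) < \<eta> \<and> (x k \<in> V2 \<longrightarrow> norm (v k - G (x k)) \<le> C * e k) \<and> k \<ge> K1 \<and> k \<ge> p0) sequentially"
    using vG eventually_ge_at_top[of K1] eventually_ge_at_top[of p0] by eventually_elim simp
  then obtain K where K: "\<And>k. k \<ge> K \<Longrightarrow> gap (Suc k) < \<eta>"
    "\<And>k. k \<ge> K \<Longrightarrow> x k \<in> V2 \<Longrightarrow> norm (v k - G (x k)) \<le> C * e k" "\<And>k. k \<ge> K \<Longrightarrow> k \<ge> K1" "\<And>k. k \<ge> K \<Longrightarrow> k \<ge> p0"
    unfolding eventually_sequentially by blast
  \<comment> \<open>The factor \<open>M * (1 - \<beta>)\<close> comes from the derivative of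
    \<open>\<theta>\<close>; \<open>\<bar>C\<bar>\<close> bounds gradient variation and sample
    error, and \<open>1 / \<gamma>\<^sub>0\<close> the proximal residual.\<close>
  define c where "c = M * (1 - \<beta>) * (\<bar>C\<bar> + 1 / \<gamma>\<^sub>0)"
  show ?thesis
  proof (rule that[of \<delta> K c])
    fix k assume k: "k \<ge> K" and b: "x k \<in> ball xbar \<delta>" "x (Suc k) \<in> ball xbar \<delta>"
    have xV: "x k \<in> V" "x (Suc k) \<in> V" using b \<delta> by auto
    then have xV1: "x k \<in> V1" and xV2: "x k \<in> V2" "x (Suc k) \<in> V2" by (auto simp: V_def)
    obtain \<gamma> where \<gamma>: "\<gamma> \<ge> \<gamma>\<^sub>0" "x (Suc k) \<in> prox \<gamma> \<psi> (x k - \<gamma> *\<^sub>R v k)"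
      using step[OF K(3)[OF k] xV1] by blast
    have gp: "0 < \<gamma>" using \<gamma> \<gamma>0 by simp
    define d where "d = x (Suc k) - x k"
    \<comment> \<open>Fermat's rule for the proximal step gives
      \<open>- v k - (1 / \<gamma>) *\<^sub>R d\<close> as a subgradient of \<open>\<psi>\<close> at
      the new point; adding the gradient of \<open>E\<close> there yields \<open>z\<close>.\<close>
    define z where "z = G (x (Suc k)) - v k - (1 / \<gamma>) *\<^sub>R d"
    have "z \<in> clarke_subdifferential (composite E \<psi>) (x (Suc k))"
    proof (rule proximal_subgradient_imp_clarke[where \<Phi> = "composite E \<psi>" and C = "C + 1 / (2 * \<gamma>)", OF V2(1) xV2(2) composite_x])
      fix u assume u: "u \<in> V2"
      have "ereal (p (Suc k) + v k \<bullet> (x (Suc k) - x k) + (norm (x (Suc k) - x k))\<^sup>2 / (2 * \<gamma>))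
        \<le> \<psi> u + ereal (v k \<bullet> (u - x k) + (norm (u - x k))\<^sup>2 / (2 * \<gamma>))"
        using prox_step(2)[OF proper gp \<gamma>(2)] by (simp add: p_def)
      \<comment> \<open>Recentring the square at the new iterate separates the linear term that
        enters \<open>z\<close> from a quadratic remainder.\<close>
      moreover have "(norm (u - x k))\<^sup>2 = (norm (u - x (Suc k)))\<^sup>2 + 2 * (d \<bullet> (u - x (Suc k))) + (norm d)\<^sup>2"
      proof -
        have "(norm (w + d))\<^sup>2 = (norm w)\<^sup>2 + 2 * (d \<bullet> w) + (norm d)\<^sup>2" for w
          by (simp add: power2_norm_eq_inner inner_add inner_commute)
        moreover have "u - x k = (u - x (Suc k)) + d" by (simp add: d_def)
        ultimately show ?thesis by metis
      qed
      moreover have "v k \<bullet> (u - x k) = v k \<bullet> (u - x (Suc k)) + v k \<bullet> (x (Suc k) - x k)"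
        by (simp add: inner_diff_right)
      ultimately have 1: "ereal (p (Suc k) - v k \<bullet> (u - x (Suc k)) - (1 / \<gamma>) * (d \<bullet> (u - x (Suc k)))
          - (norm (u - x (Suc k)))\<^sup>2 / (2 * \<gamma>)) \<le> \<psi> u"
        using gp by (cases "\<psi> u") (auto simp: d_def add_divide_distrib)
      have 2: "E (x (Suc k)) + G (x (Suc k)) \<bullet> (u - x (Suc k)) - C * (norm (u - x (Suc k)))\<^sup>2 \<le> E u"
        using G(1)[OF xV2(2) u] by linarith
      have "W (Suc k) + z \<bullet> (u - x (Suc k)) - (C + 1 / (2 * \<gamma>)) * (norm (u - x (Suc k)))\<^sup>2
        = (E (x (Suc k)) + G (x (Suc k)) \<bullet> (u - x (Suc k)) - C * (norm (u - x (Suc k)))\<^sup>2)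
        + (p (Suc k) - v k \<bullet> (u - x (Suc k)) - (1 / \<gamma>) * (d \<bullet> (u - x (Suc k))) - (norm (u - x (Suc k)))\<^sup>2 / (2 * \<gamma>))"
        by (simp add: W_def z_def inner_diff_left distrib_right)
      then show "ereal (W (Suc k) + z \<bullet> (u - x (Suc k)) - (C + 1 / (2 * \<gamma>)) * (norm (u - x (Suc k)))\<^sup>2)
          \<le> composite E \<psi> u"
        using 1 2 unfolding composite_def by (cases "\<psi> u") auto
    qed
    then have inf: "(INF v\<in>clarke_subdifferential (composite E \<psi>) (x (Suc k)). ereal (norm v)) \<le> ereal (norm z)"
      by (rule INF_lower)
    have gpos: "0 < gap (Suc k)" "gap (Suc k) < \<eta>" using pos[of "Suc k"] K(1)[OF k] K(4)[OF k] by auto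
    define \<theta>' where "\<theta>' = M * (1 - \<beta>) * gap (Suc k) powr - \<beta>"
    have der: "deriv (\<lambda>t. M * t powr (1 - \<beta>)) (gap (Suc k)) = \<theta>'"
    proof (rule DERIV_imp_deriv)
      show "((\<lambda>t. M * t powr (1 - \<beta>)) has_field_derivative \<theta>') (at (gap (Suc k)))"
        unfolding \<theta>'_def using gpos by (auto intro!: derivative_eq_intros)
    qed
    have \<theta>pos: "0 \<le> \<theta>'" using M \<beta> by (simp add: \<theta>'_def)
    have "x (Suc k) \<in> ball xbar \<eta>" using xV by (simp add: V_def)
    moreover have "composite E \<psi> xbar < composite E \<psi> (x (Suc k))"
      "composite E \<psi> (x (Suc k)) < composite E \<psi> xbar + ereal \<eta>"
      using gpos unfolding composite_x composite_xbar gap_def by auto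
    ultimately have "1 \<le> ereal (deriv (\<lambda>t. M * t powr (1 - \<beta>))
        (real_of_ereal (composite E \<psi> (x (Suc k)) - composite E \<psi> xbar))) *
        (INF v\<in>clarke_subdifferential (composite E \<psi>) (x (Suc k)). ereal (norm v))"
      using KL unfolding KL_condition_def by blast
    also have "\<dots> \<le> ereal \<theta>' * ereal (norm z)"
      unfolding gap_eq der using inf \<theta>pos by (intro ereal_mult_left_mono) auto
    finally have "1 \<le> \<theta>' * norm z" by (simp add: one_ereal_def)
    moreover have "gap (Suc k) powr \<beta> * gap (Suc k) powr - \<beta> = 1" using gpos by (simp add: powr_add[symmetric])
    ultimately have "gap (Suc k) powr \<beta> \<le> gap (Suc k) powr \<beta> * (\<theta>' * norm z)"
      using mult_left_mono[of 1 "\<theta>' * norm z" "gap (Suc k) powr \<beta>"] by simp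
    also have "\<dots> = (gap (Suc k) powr \<beta> * gap (Suc k) powr - \<beta>) * (M * (1 - \<beta>) * norm z)"
      by (simp add: \<theta>'_def mult_ac)
    also have "\<dots> = M * (1 - \<beta>) * norm z"
      using \<open>gap (Suc k) powr \<beta> * gap (Suc k) powr - \<beta> = 1\<close> by simp
    also have "\<dots> \<le> M * (1 - \<beta>) * ((\<bar>C\<bar> + 1 / \<gamma>\<^sub>0) * (norm d + e k))"
    proof (rule mult_left_mono)
      \<comment> \<open>Inserting \<open>G (x k)\<close> separates the change of the gradient along
        the step from the sampling error of \<open>v k\<close>.\<close>
      have "z = (G (x (Suc k)) - G (x k)) - (v k - G (x k)) - (1 / \<gamma>) *\<^sub>R d" by (simp add: z_def)
      then have "norm z = norm ((G (x (Suc k)) - G (x k)) - (v k - G (x k)) - (1 / \<gamma>) *\<^sub>R d)"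
        by (rule arg_cong)
      then have "norm z \<le> norm (G (x (Suc k)) - G (x k)) + norm (v k - G (x k)) + norm ((1 / \<gamma>) *\<^sub>R d)"
        using norm_triangle_ineq4[of "(G (x (Suc k)) - G (x k)) - (v k - G (x k))" "(1 / \<gamma>) *\<^sub>R d"]
          norm_triangle_ineq4[of "G (x (Suc k)) - G (x k)" "v k - G (x k)"] by linarith
      also have "norm (G (x (Suc k)) - G (x k)) \<le> \<bar>C\<bar> * norm d"
        using order_trans[OF G(2)[OF xV2(1) xV2(2)] mult_right_mono[OF abs_ge_self norm_ge_zero]]
        by (simp add: d_def)
      also have "norm (v k - G (x k)) \<le> \<bar>C\<bar> * e k"
        using order_trans[OF K(2)[OF k xV2(1)] mult_right_mono[OF abs_ge_self e(1)]] .
      also have "norm ((1 / \<gamma>) *\<^sub>R d) \<le> 1 / \<gamma>\<^sub>0 * norm d"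
      proof -
        have "1 / \<gamma> \<le> 1 / \<gamma>\<^sub>0" using \<gamma> \<gamma>0 by (simp add: frac_le)
        then have "1 / \<gamma> * norm d \<le> 1 / \<gamma>\<^sub>0 * norm d" by (rule mult_right_mono) simp
        then show ?thesis using gp by simp
      qed
      finally have "norm z \<le> \<bar>C\<bar> * norm d + \<bar>C\<bar> * e k + 1 / \<gamma>\<^sub>0 * norm d" by simp
      moreover have "0 \<le> 1 / \<gamma>\<^sub>0 * e k" using \<gamma>0 e(1) by simp
      ultimately show "norm z \<le> (\<bar>C\<bar> + 1 / \<gamma>\<^sub>0) * (norm d + e k)"
        by (simp add: algebra_simps)
    qed (use M \<beta> in auto)
    finally show "gap (Suc k) powr \<beta> \<le> c * (norm (x (Suc k) - x k) + e k)"
      by (simp add: c_def d_def mult.assoc)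
  qed (use \<delta> in auto)
qed

lemma gap_KL_descent:
  assumes KL: "KL_condition (composite E \<psi>) xbar (\<lambda>t. M * t powr (1 - \<beta>)) \<eta>"
    and M: "0 < M" and \<beta>: "0 < \<beta>" "\<beta> < 1"
    and pos: "\<And>k. k \<ge> p0 \<Longrightarrow> composite E \<psi> xbar < composite E \<psi> (x k)"
    and q: "(2 + 2 * \<beta>) / \<beta> < q" and e_rate: "e \<in> O(\<lambda>k. ln (real k) * real k powr - (q / 2))"
  shows "\<exists>c \<delta> A K. KL_descent x xbar gap e \<beta> \<sigma> A \<delta> c q K r"
proof -
  have gpos: "0 < gap k" if "k \<ge> p0" for k
    using pos[OF that] unfolding composite_x composite_xbar gap_def by simp
  obtain \<delta> c K1 where \<delta>: "0 < \<delta>" and kl: "\<And>k. k \<ge> K1 \<Longrightarrow> x k \<in> ball xbar \<delta> \<Longrightarrow> x (Suc k) \<in> ball xbar \<delta> \<Longrightarrow>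
    gap (Suc k) powr \<beta> \<le> c * (norm (x (Suc k) - x k) + e k)"
    using KL_step[OF KL M \<beta> gpos] by metis
  obtain A K2 where A: "0 \<le> A"
    "\<And>k. k \<ge> K2 \<Longrightarrow> W (Suc k) + \<sigma> * (norm (x (Suc k) - x k))\<^sup>2 \<le> W k + A * e k"
    using W_descent by blast
  have "KL_descent x xbar gap e \<beta> \<sigma> A \<delta> c q (max p0 (max K1 K2)) r"
  proof
    fix k assume k: "k \<ge> max p0 (max K1 K2)"
    then show "0 < gap k" by (intro gpos) simp
    show "gap (Suc k) + \<sigma> * (norm (x (Suc k) - x k))\<^sup>2 \<le> gap k + A * e k"
      using A(2)[of k] k by (simp add: gap_def)
    show "gap (Suc k) powr \<beta> \<le> c * (norm (x (Suc k) - x k) + e k)"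
      if "x k \<in> ball xbar \<delta>" "x (Suc k) \<in> ball xbar \<delta>"
      using k by (intro kl that) simp
  qed (rule \<beta> \<sigma> A(1) \<delta> q e(1) e_rate gap_tendsto_0 sub)+
  then show ?thesis by blast
qed

end

section \<open>Almost sure local estimates\<close>

text \<open>There are uncountably many centres, but by the Lindelof property countably many of the
  neighbourhoods cover them all, and countably many null sets may be united. This is what frees the
  exceptional set from the accumulation point.\<close>

lemma AE_open_cover:
  fixes S :: "'a::second_countable_topology set"
  assumes "\<And>c. c \<in> S \<Longrightarrow> \<exists>V. open V \<and> c \<in> V \<and> (AE \<omega> in M. Q \<omega> V)"
  shows "AE \<omega> in M. \<forall>c\<in>S. \<exists>V. open V \<and> c \<in> V \<and> Q \<omega> V"
proof -
  have "\<forall>c\<in>S. \<exists>V. open V \<and> c \<in> V \<and> (AE \<omega> in M. Q \<omega> V)" using assms by (rule ballI)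
  from bchoice[OF this] obtain V where
    "\<forall>c\<in>S. open (V c) \<and> c \<in> V c \<and> (AE \<omega> in M. Q \<omega> (V c))" ..
  then have V: "open (V c)" "c \<in> V c" "AE \<omega> in M. Q \<omega> (V c)" if "c \<in> S" for c
    using that by simp_all
  have "\<And>U. U \<in> V ` S \<Longrightarrow> open U" using V by auto
  then obtain F where F: "F \<subseteq> V ` S" "countable F" "\<Union>F = \<Union>(V ` S)"
    using Lindelof by metis
  have "AE \<omega> in M. \<forall>U\<in>F. Q \<omega> U"
    using F V by (subst AE_ball_countable) auto
  then show ?thesis
  proof eventually_elim
    case (elim \<omega>)
    show ?case
    proof
      fix c assume c: "c \<in> S"
      then have "c \<in> \<Union>F" using V(2)[OF c] F(3) by auto
      then obtain U where U: "U \<in> F" "c \<in> U" by (rule UnionE)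
      then have "open U" using F(1) V(1) by auto
      then show "\<exists>V. open V \<and> c \<in> V \<and> Q \<omega> V" using elim U by auto
    qed
  qed
qed

lemma (in prob_space) square_integrable_imp_integrable:
  fixes f :: "'a \<Rightarrow> 'b::{banach, second_countable_topology}"
  assumes "square_integrable M f"
  shows "integrable M f"
proof (rule Bochner_Integration.integrable_bound)
  show "integrable M (\<lambda>s. 1 + (norm (f s))\<^sup>2)"
    using assms by (simp add: square_integrable_def)
  show "f \<in> borel_measurable M" using assms by (simp add: square_integrable_def)
  have "norm (f s) \<le> 1 + (norm (f s))\<^sup>2" for s
  proof -
    have "2 * norm (f s) * 1 \<le> (norm (f s))\<^sup>2 + 1\<^sup>2" by (rule sum_squares_bound)
    then show ?thesis using norm_ge_zero[of "f s"] unfolding one_power2 mult_1_right by linarith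
  qed
  then show "AE s in M. norm (f s) \<le> norm (1 + (norm (f s))\<^sup>2)"
    by (intro AE_I2) (metis abs_ge_self order_trans real_norm_def)
qed

text \<open>Displays each component of the gradient as a limit of a sequence of difference
  quotients, hence as a measurable function of the sample.\<close>

lemma directional_quotient_tendsto:
  fixes f :: "'a::euclidean_space \<Rightarrow> real"
  assumes "GDERIV f y :> D"
  shows "(\<lambda>m. (f (y + inverse (real (Suc m)) *\<^sub>R b) - f y) / inverse (real (Suc m))) \<longlonglongrightarrow> D \<bullet> b"
proof -
  have "(f has_derivative (\<lambda>h. h \<bullet> D)) (at (y + 0 *\<^sub>R b))" using assms by (simp add: gderiv_def)
  moreover have "((\<lambda>t::real. y + t *\<^sub>R b) has_derivative (\<lambda>t. t *\<^sub>R b)) (at 0)"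
    by (auto intro!: derivative_eq_intros)
  ultimately have "((\<lambda>t. f (y + t *\<^sub>R b)) has_derivative (\<lambda>t. (t *\<^sub>R b) \<bullet> D)) (at 0)"
    by (rule has_derivative_compose[rotated])
  then have "((\<lambda>t. f (y + t *\<^sub>R b)) has_field_derivative D \<bullet> b) (at 0)"
    unfolding has_field_derivative_def by (rule has_derivative_eq_rhs) (auto simp: inner_commute)
  then have "((\<lambda>h. (f (y + h *\<^sub>R b) - f y) / h) \<longlongrightarrow> D \<bullet> b) (at 0)"
    by (simp add: DERIV_def)
  moreover have "filterlim (\<lambda>m. inverse (real (Suc m))) (at 0) sequentially"
    using LIMSEQ_inverse_real_of_nat by (simp add: filterlim_at)
  ultimately show ?thesis by (rule filterlim_compose)
qed

context iid_sampling
begin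

lemma expected_fun_locally_lipschitz:
  fixes \<phi> :: "'s \<Rightarrow> 'a::euclidean_space \<Rightarrow> real"
  assumes "\<And>y. sq_lipschitz_around \<mu> \<phi> y"
  shows "\<exists>V \<kappa>. open V \<and> c \<in> V \<and> (\<forall>y\<in>V. \<forall>z\<in>V.
    \<bar>expected_fun \<mu> \<phi> y - expected_fun \<mu> \<phi> z\<bar> \<le> \<kappa> * norm (y - z))"
proof -
  obtain \<kappa> V where V: "open V" "c \<in> V" and \<kappa>: "square_integrable \<mu> \<kappa>"
    and lip: "\<forall>s\<in>space \<mu>. \<forall>y\<in>V. \<forall>z\<in>V. \<bar>\<phi> s y - \<phi> s z\<bar> \<le> \<kappa> s * norm (y - z)"
    using assms[of c] unfolding sq_lipschitz_around_def by blast
  have i: "integrable \<mu> (\<lambda>s. \<phi> s y)" for y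
    using assms[of y] unfolding sq_lipschitz_around_def by (blast intro: M.square_integrable_imp_integrable)
  have "\<bar>expected_fun \<mu> \<phi> y - expected_fun \<mu> \<phi> z\<bar> \<le> (\<integral>s. \<kappa> s \<partial>\<mu>) * norm (y - z)" if "y \<in> V" "z \<in> V" for y z
  proof -
    have "\<bar>expected_fun \<mu> \<phi> y - expected_fun \<mu> \<phi> z\<bar> = \<bar>\<integral>s. \<phi> s y - \<phi> s z \<partial>\<mu>\<bar>"
      using i by (simp add: expected_fun_def)
    also have "\<dots> \<le> (\<integral>s. \<bar>\<phi> s y - \<phi> s z\<bar> \<partial>\<mu>)" by (rule integral_abs_bound)
    also have "\<dots> \<le> (\<integral>s. \<kappa> s * norm (y - z) \<partial>\<mu>)"
      by (rule integral_mono) (use i lip that M.square_integrable_imp_integrable[OF \<kappa>] in auto)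
    finally show ?thesis by simp
  qed
  then show ?thesis using V by blast
qed

lemma local_function_rate:
  fixes \<phi> :: "'s \<Rightarrow> 'a::euclidean_space \<Rightarrow> real"
  assumes sq: "\<And>y. sq_lipschitz_around \<mu> \<phi> y"
  shows "\<exists>V. open V \<and> c \<in> V \<and> (AE \<omega> in P. \<exists>C. eventually (\<lambda>N. \<forall>y\<in>V.
     \<bar>sample_average \<phi> (\<lambda>i. \<xi> i \<omega>) N y - expected_fun \<mu> \<phi> y\<bar> \<le> C * (ln (real N) / sqrt (real N)))
     sequentially)"
proof -
  obtain \<kappa> V where V: "open V" "c \<in> V" and \<kappa>: "square_integrable \<mu> \<kappa>"
    and lip: "\<forall>s\<in>space \<mu>. \<forall>y\<in>V. \<forall>z\<in>V. \<bar>\<phi> s y - \<phi> s z\<bar> \<le> \<kappa> s * norm (y - z)"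
    using sq[of c] unfolding sq_lipschitz_around_def by blast
  obtain r where r: "r > 0" "cball c r \<subseteq> V" using V by (meson open_contains_cball)
  have "AE \<omega> in P. \<exists>C. eventually (\<lambda>N. \<forall>y\<in>cball c r.
     \<bar>sample_average \<phi> (\<lambda>i. \<xi> i \<omega>) N y - expected_fun \<mu> \<phi> y\<bar> \<le> C * (ln (real N) / sqrt (real N)))
     sequentially"
  proof (rule uniform_sample_average_rate[OF _ _ \<kappa>])
    show "(\<lambda>s. \<phi> s y) \<in> borel_measurable \<mu>" for y
      using sq[of y] by (simp add: sq_lipschitz_around_def square_integrable_def)
    show "square_integrable \<mu> (\<lambda>s. \<phi> s c)" using sq[of c] by (simp add: sq_lipschitz_around_def)
    show "\<bar>\<phi> s y - \<phi> s z\<bar> \<le> \<kappa> s * norm (y - z)" if "s \<in> space \<mu>" "y \<in> cball c r" "z \<in> cball c r" for s y z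
      using lip that r(2) by blast
  qed (use r in simp)
  then have "AE \<omega> in P. \<exists>C. eventually (\<lambda>N. \<forall>y\<in>ball c r.
     \<bar>sample_average \<phi> (\<lambda>i. \<xi> i \<omega>) N y - expected_fun \<mu> \<phi> y\<bar> \<le> C * (ln (real N) / sqrt (real N)))
     sequentially"
  proof eventually_elim
    case (elim \<omega>)
    then obtain C where "eventually (\<lambda>N. \<forall>y\<in>cball c r.
     \<bar>sample_average \<phi> (\<lambda>i. \<xi> i \<omega>) N y - expected_fun \<mu> \<phi> y\<bar> \<le> C * (ln (real N) / sqrt (real N)))
     sequentially" by blast
    then show ?case
      by (intro exI[of _ C]) (elim eventually_mono, auto)
  qed
  then show ?thesis using r by (intro exI[of _ "ball c r"]) simp
qed

text \<open>The pointwise inequalities are averaged; the averages of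
  \<open>\<bar>\<kappa>\<bar>\<close> and \<open>L\<close> only have to stay bounded, which suits a
  merely integrable \<open>L\<close>. The quantifier over \<open>w\<close> stands inside the almost
  sure statement, so one null set serves every selection of subgradients.\<close>

lemma local_sample_upper_C2:
  fixes \<phi> :: "'s \<Rightarrow> 'a::euclidean_space \<Rightarrow> real"
  assumes uc: "upper_C2_around \<mu> \<phi> c"
  shows "\<exists>V. open V \<and> c \<in> V \<and> (AE \<omega> in P. \<exists>L. \<forall>N\<ge>1. \<forall>z\<in>V. \<forall>w.
     (\<forall>i\<in>{1..N}. w i \<in> clarke_subdifferential (\<lambda>y. ereal (\<phi> (\<xi> i \<omega>) y)) z) \<longrightarrow>
     norm ((1 / real N) *\<^sub>R (\<Sum>i=1..N. w i)) \<le> L \<and>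
     (\<forall>y\<in>V. sample_average \<phi> (\<lambda>i. \<xi> i \<omega>) N y \<le> sample_average \<phi> (\<lambda>i. \<xi> i \<omega>) N z
        + ((1 / real N) *\<^sub>R (\<Sum>i=1..N. w i)) \<bullet> (y - z) + L * (norm (y - z))\<^sup>2))"
proof -
  obtain \<kappa> V1 where V1: "open V1" "c \<in> V1" and \<kappa>: "square_integrable \<mu> \<kappa>"
    and lip: "\<forall>s\<in>space \<mu>. \<forall>y\<in>V1. \<forall>z\<in>V1. \<bar>\<phi> s y - \<phi> s z\<bar> \<le> \<kappa> s * norm (y - z)"
    using uc unfolding upper_C2_around_def sq_lipschitz_around_def by blast
  obtain V2 L where V2: "open V2" "c \<in> V2" and L: "integrable \<mu> L" "\<forall>s\<in>space \<mu>. 0 \<le> L s"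
    and q: "\<forall>s\<in>space \<mu>. \<forall>x\<in>V2. \<forall>v\<in>clarke_subdifferential (\<lambda>y. ereal (\<phi> s y)) x. \<forall>y\<in>V2.
           \<phi> s y \<le> \<phi> s x + v \<bullet> (y - x) + L s * (norm (y - x))\<^sup>2"
    using uc unfolding upper_C2_around_def by blast
  define V where "V = V1 \<inter> V2"
  have V: "open V" "c \<in> V" using V1 V2 by (auto simp: V_def)
  have i\<kappa>: "integrable \<mu> (\<lambda>s. \<bar>\<kappa> s\<bar>)" using M.square_integrable_imp_integrable[OF \<kappa>] by simp
  have "AE \<omega> in P. \<exists>C. \<forall>n\<ge>1. (\<Sum>i=1..n. \<bar>\<kappa> (\<xi> i \<omega>)\<bar>) \<le> C * real n"
    by (rule sample_mean_bounded[OF i\<kappa>]) simp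
  moreover have "AE \<omega> in P. \<exists>C. \<forall>n\<ge>1. (\<Sum>i=1..n. L (\<xi> i \<omega>)) \<le> C * real n"
    by (rule sample_mean_bounded[OF L(1)]) (use L(2) in simp)
  ultimately have "AE \<omega> in P. \<exists>L. \<forall>N\<ge>1. \<forall>z\<in>V. \<forall>w.
     (\<forall>i\<in>{1..N}. w i \<in> clarke_subdifferential (\<lambda>y. ereal (\<phi> (\<xi> i \<omega>) y)) z) \<longrightarrow>
     norm ((1 / real N) *\<^sub>R (\<Sum>i=1..N. w i)) \<le> L \<and>
     (\<forall>y\<in>V. sample_average \<phi> (\<lambda>i. \<xi> i \<omega>) N y \<le> sample_average \<phi> (\<lambda>i. \<xi> i \<omega>) N z
        + ((1 / real N) *\<^sub>R (\<Sum>i=1..N. w i)) \<bullet> (y - z) + L * (norm (y - z))\<^sup>2)"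
    using AE_space
  proof eventually_elim
    case (elim \<omega>)
    obtain C1 where C1: "\<forall>n\<ge>1. (\<Sum>i=1..n. \<bar>\<kappa> (\<xi> i \<omega>)\<bar>) \<le> C1 * real n" using elim(1) by blast
    obtain C2 where C2: "\<forall>n\<ge>1. (\<Sum>i=1..n. L (\<xi> i \<omega>)) \<le> C2 * real n" using elim(2) by blast
    show ?case
    proof (intro exI[of _ "max C1 C2"] allI impI ballI)
      fix N :: nat and z and w :: "nat \<Rightarrow> 'a"
      assume N: "1 \<le> N" and z: "z \<in> V"
        and w: "\<forall>i\<in>{1..N}. w i \<in> clarke_subdifferential (\<lambda>y. ereal (\<phi> (\<xi> i \<omega>) y)) z"
      have \<xi>: "\<xi> i \<omega> \<in> space \<mu>" if "i \<in> {1..N}" for i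
        using sample_in_space[OF _ elim(3)] that by auto
      have "norm (w i) \<le> \<bar>\<kappa> (\<xi> i \<omega>)\<bar>" if i: "i \<in> {1..N}" for i
      proof (rule clarke_subgradient_norm_le[OF V1(1)])
        show "z \<in> V1" using z by (simp add: V_def)
        show "w i \<in> clarke_subdifferential (\<lambda>y. ereal (\<phi> (\<xi> i \<omega>) y)) z" using w i by blast
        fix y u assume "y \<in> V1" "u \<in> V1"
        then have "\<bar>\<phi> (\<xi> i \<omega>) y - \<phi> (\<xi> i \<omega>) u\<bar> \<le> \<kappa> (\<xi> i \<omega>) * norm (y - u)" using lip \<xi>[OF i] by blast
        also have "\<dots> \<le> \<bar>\<kappa> (\<xi> i \<omega>)\<bar> * norm (y - u)" by (intro mult_right_mono) auto
        finally show "\<bar>\<phi> (\<xi> i \<omega>) y - \<phi> (\<xi> i \<omega>) u\<bar> \<le> \<bar>\<kappa> (\<xi> i \<omega>)\<bar> * norm (y - u)" .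
      qed simp
      then have "norm (\<Sum>i=1..N. w i) \<le> (\<Sum>i=1..N. \<bar>\<kappa> (\<xi> i \<omega>)\<bar>)"
        by (rule sum_norm_le)
      also have "\<dots> \<le> C1 * real N" using C1 N by blast
      finally have "norm ((1 / real N) *\<^sub>R (\<Sum>i=1..N. w i)) \<le> C1"
        using N by (simp add: field_simps)
      moreover have "sample_average \<phi> (\<lambda>i. \<xi> i \<omega>) N y \<le> sample_average \<phi> (\<lambda>i. \<xi> i \<omega>) N z
        + ((1 / real N) *\<^sub>R (\<Sum>i=1..N. w i)) \<bullet> (y - z) + max C1 C2 * (norm (y - z))\<^sup>2" if y: "y \<in> V" for y
      proof -
        have "(\<Sum>i=1..N. \<phi> (\<xi> i \<omega>) y) \<le> (\<Sum>i=1..N. \<phi> (\<xi> i \<omega>) z + w i \<bullet> (y - z) + L (\<xi> i \<omega>) * (norm (y - z))\<^sup>2)"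
        proof (rule sum_mono)
          fix i assume i: "i \<in> {1..N}"
          show "\<phi> (\<xi> i \<omega>) y \<le> \<phi> (\<xi> i \<omega>) z + w i \<bullet> (y - z) + L (\<xi> i \<omega>) * (norm (y - z))\<^sup>2"
            using q \<xi>[OF i] w i z y unfolding V_def by blast
        qed
        also have "\<dots> = (\<Sum>i=1..N. \<phi> (\<xi> i \<omega>) z) + (\<Sum>i=1..N. w i) \<bullet> (y - z) + (\<Sum>i=1..N. L (\<xi> i \<omega>)) * (norm (y - z))\<^sup>2"
          by (simp add: sum.distrib inner_sum_left sum_distrib_right)
        also have "(\<Sum>i=1..N. L (\<xi> i \<omega>)) * (norm (y - z))\<^sup>2 \<le> (max C1 C2 * real N) * (norm (y - z))\<^sup>2"
        proof (rule mult_right_mono)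
          have "(\<Sum>i=1..N. L (\<xi> i \<omega>)) \<le> C2 * real N" using C2 N by blast
          also have "\<dots> \<le> max C1 C2 * real N" by (intro mult_right_mono) auto
          finally show "(\<Sum>i=1..N. L (\<xi> i \<omega>)) \<le> max C1 C2 * real N" .
        qed simp
        finally have "(1 / real N) * (\<Sum>i=1..N. \<phi> (\<xi> i \<omega>) y) \<le> (1 / real N) * ((\<Sum>i=1..N. \<phi> (\<xi> i \<omega>) z)
           + (\<Sum>i=1..N. w i) \<bullet> (y - z) + (max C1 C2 * real N) * (norm (y - z))\<^sup>2)"
          by (intro mult_left_mono) auto
        also have "\<dots> = sample_average \<phi> (\<lambda>i. \<xi> i \<omega>) N z
          + ((1 / real N) *\<^sub>R (\<Sum>i=1..N. w i)) \<bullet> (y - z) + max C1 C2 * (norm (y - z))\<^sup>2"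
          using N by (simp add: sample_average_def distrib_left add_divide_distrib)
        finally show ?thesis by (simp add: sample_average_def)
      qed
      ultimately show "norm ((1 / real N) *\<^sub>R (\<Sum>i=1..N. w i)) \<le> max C1 C2 \<and>
        (\<forall>y\<in>V. sample_average \<phi> (\<lambda>i. \<xi> i \<omega>) N y \<le> sample_average \<phi> (\<lambda>i. \<xi> i \<omega>) N z
        + ((1 / real N) *\<^sub>R (\<Sum>i=1..N. w i)) \<bullet> (y - z) + max C1 C2 * (norm (y - z))\<^sup>2)"
        by auto
    qed
  qed
  then show ?thesis using V by blast
qed

text \<open>Each component of the gradient is an integrand with square integrable Lipschitz modulus,
  so the uniform rate applies to it. Upper-C2 makes the selected subgradients equal to the
  gradients, which transfers the rate to their averages.\<close>

lemma local_gradient_rate: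
  fixes \<phi> :: "'s \<Rightarrow> 'a::euclidean_space \<Rightarrow> real"
  assumes uc: "\<And>y. upper_C2_around \<mu> \<phi> y" and c11: "C11_around \<mu> \<phi> c"
  shows "\<exists>V. open V \<and> c \<in> V \<and> (AE \<omega> in P. \<exists>C G.
     (\<forall>y\<in>V. \<forall>u\<in>V. \<bar>expected_fun \<mu> \<phi> u - expected_fun \<mu> \<phi> y - G y \<bullet> (u - y)\<bar> \<le> C * (norm (u - y))\<^sup>2 \<and>
        norm (G u - G y) \<le> C * norm (u - y)) \<and>
     eventually (\<lambda>N. \<forall>z\<in>V. \<forall>w.
       (\<forall>i\<in>{1..N}. w i \<in> clarke_subdifferential (\<lambda>y. ereal (\<phi> (\<xi> i \<omega>) y)) z) \<longrightarrow>
       norm ((1 / real N) *\<^sub>R (\<Sum>i=1..N. w i) - G z) \<le> C * (ln (real N) / sqrt (real N))) sequentially)"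
proof -
  define g where "g s y = gradient (\<phi> s) y" for s y
  obtain \<kappa> \<epsilon> where \<kappa>: "square_integrable \<mu> \<kappa>" and \<epsilon>: "0 < \<epsilon>"
    and d: "\<And>s y. s \<in> space \<mu> \<Longrightarrow> y \<in> cball c \<epsilon> \<Longrightarrow> \<phi> s differentiable (at y)"
    and lip: "\<And>s y z. s \<in> space \<mu> \<Longrightarrow> y \<in> cball c \<epsilon> \<Longrightarrow> z \<in> cball c \<epsilon> \<Longrightarrow>
        norm (g s y - g s z) \<le> \<kappa> s * norm (y - z)"
    and gc: "square_integrable \<mu> (\<lambda>s. g s c)"
    using c11 unfolding C11_around_def g_def by blast
  have i\<kappa>: "integrable \<mu> \<kappa>" by (rule M.square_integrable_imp_integrable[OF \<kappa>])
  have \<phi>sq: "square_integrable \<mu> (\<lambda>s. \<phi> s y)" for y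
    using uc[of y] by (simp add: upper_C2_around_def sq_lipschitz_around_def)
  have \<phi>i: "integrable \<mu> (\<lambda>s. \<phi> s y)" for y by (rule M.square_integrable_imp_integrable[OF \<phi>sq])
  have gm: "(\<lambda>s. g s y) \<in> borel_measurable \<mu>" if y: "y \<in> cball c \<epsilon>" for y
  proof (subst borel_measurable_euclidean_space, intro ballI)
    fix b :: 'a assume "b \<in> Basis"
    show "(\<lambda>s. g s y \<bullet> b) \<in> borel_measurable \<mu>"
    proof (rule borel_measurable_LIMSEQ_real)
      show "(\<lambda>m. (\<phi> s (y + inverse (real (Suc m)) *\<^sub>R b) - \<phi> s y) / inverse (real (Suc m))) \<longlonglongrightarrow> g s y \<bullet> b"
        if "s \<in> space \<mu>" for s
        unfolding g_def by (intro directional_quotient_tendsto differentiable_imp_gradient d that y)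
      show "(\<lambda>s. (\<phi> s (y + inverse (real (Suc m)) *\<^sub>R b) - \<phi> s y) / inverse (real (Suc m))) \<in> borel_measurable \<mu>" for m
        using \<phi>i by (intro borel_measurable_divide borel_measurable_diff) auto
    qed
  qed
  have gi: "integrable \<mu> (\<lambda>s. g s y)" if y: "y \<in> cball c \<epsilon>" for y
  proof (rule Bochner_Integration.integrable_bound)
    show "integrable \<mu> (\<lambda>s. norm (g s c) + \<kappa> s * norm (y - c))"
      using M.square_integrable_imp_integrable[OF gc] i\<kappa> by simp
    show "AE s in \<mu>. norm (g s y) \<le> norm (norm (g s c) + \<kappa> s * norm (y - c))"
    proof (rule AE_I2)
      fix s assume s: "s \<in> space \<mu>"
      have "norm (g s y) \<le> norm (g s c) + norm (g s y - g s c)"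
        using norm_triangle_ineq[of "g s c" "g s y - g s c"] by simp
      also have "norm (g s y - g s c) \<le> \<kappa> s * norm (y - c)" using lip[OF s y] \<epsilon> by simp
      finally show "norm (g s y) \<le> norm (norm (g s c) + \<kappa> s * norm (y - c))" by simp
    qed
  qed (rule gm[OF y])
  \<comment> \<open>The mean gradient. That it acts as gradient of the expectation is obtained by
    integrating the pointwise Taylor estimate, which avoids differentiating under the
    integral.\<close>
  define G where "G y = (\<integral>s. g s y \<partial>\<mu>)" for y
  define C0 where "C0 = (\<integral>s. \<kappa> s \<partial>\<mu>)"
  have taylor: "\<bar>expected_fun \<mu> \<phi> u - expected_fun \<mu> \<phi> y - G y \<bullet> (u - y)\<bar> \<le> C0 * (norm (u - y))\<^sup>2"
    if yu: "y \<in> cball c \<epsilon>" "u \<in> cball c \<epsilon>" for y u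
  proof -
    have ig: "integrable \<mu> (\<lambda>s. g s y \<bullet> (u - y))" using gi[OF yu(1)] by simp
    have "expected_fun \<mu> \<phi> u - expected_fun \<mu> \<phi> y - G y \<bullet> (u - y)
      = (\<integral>s. \<phi> s u - \<phi> s y - g s y \<bullet> (u - y) \<partial>\<mu>)"
      using \<phi>i ig gi[OF yu(1)] by (simp add: expected_fun_def G_def)
    also have "\<bar>\<dots>\<bar> \<le> (\<integral>s. \<bar>\<phi> s u - \<phi> s y - g s y \<bullet> (u - y)\<bar> \<partial>\<mu>)" by (rule integral_abs_bound)
    also have "\<dots> \<le> (\<integral>s. \<kappa> s * (norm (u - y))\<^sup>2 \<partial>\<mu>)"
    proof (rule integral_mono)
      fix s assume s: "s \<in> space \<mu>"
      show "\<bar>\<phi> s u - \<phi> s y - g s y \<bullet> (u - y)\<bar> \<le> \<kappa> s * (norm (u - y))\<^sup>2"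
        unfolding g_def
        by (rule lipschitz_gradient_taylor[of "cball c \<epsilon>"]) (use d[OF s] lip[OF s] yu in \<open>auto simp: g_def\<close>)
    qed (use \<phi>i ig i\<kappa> in auto)
    finally show ?thesis by (simp add: C0_def)
  qed
  have Glip: "norm (G u - G y) \<le> C0 * norm (u - y)" if yu: "y \<in> cball c \<epsilon>" "u \<in> cball c \<epsilon>" for y u
  proof -
    have "G u - G y = (\<integral>s. g s u - g s y \<partial>\<mu>)" using gi yu by (simp add: G_def)
    also have "norm \<dots> \<le> (\<integral>s. norm (g s u - g s y) \<partial>\<mu>)" by (rule integral_norm_bound)
    also have "\<dots> \<le> (\<integral>s. \<kappa> s * norm (u - y) \<partial>\<mu>)"
      by (rule integral_mono) (use gi yu i\<kappa> lip in auto)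
    finally show ?thesis by (simp add: C0_def)
  qed
  have rate: "AE \<omega> in P. \<exists>C. eventually (\<lambda>N. \<forall>z\<in>cball c \<epsilon>.
     \<bar>sample_average (\<lambda>s y. g s y \<bullet> b) (\<lambda>i. \<xi> i \<omega>) N z - expected_fun \<mu> (\<lambda>s y. g s y \<bullet> b) z\<bar>
       \<le> C * (ln (real N) / sqrt (real N))) sequentially" if b: "b \<in> Basis" for b
  proof (rule uniform_sample_average_rate[OF _ _ \<kappa>])
    show "(\<lambda>s. g s y \<bullet> b) \<in> borel_measurable \<mu>" if "y \<in> cball c \<epsilon>" for y
      using gm[OF that] by simp
    have m: "(\<lambda>s. g s c \<bullet> b) \<in> borel_measurable \<mu>" using gm[of c] \<epsilon> by simp
    have "integrable \<mu> (\<lambda>s. (norm (g s c \<bullet> b))\<^sup>2)"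
    proof (rule Bochner_Integration.integrable_bound)
      show "integrable \<mu> (\<lambda>s. (norm (g s c))\<^sup>2)" using gc by (simp add: square_integrable_def)
      show "AE s in \<mu>. norm ((norm (g s c \<bullet> b))\<^sup>2) \<le> norm ((norm (g s c))\<^sup>2)"
      proof (rule AE_I2)
        fix s
        have "\<bar>g s c \<bullet> b\<bar>\<^sup>2 \<le> (norm (g s c))\<^sup>2" using Basis_le_norm[OF b] by (intro power_mono) auto
        then show "norm ((norm (g s c \<bullet> b))\<^sup>2) \<le> norm ((norm (g s c))\<^sup>2)" by simp
      qed
    qed (use m in measurable)
    then show "square_integrable \<mu> (\<lambda>s. g s c \<bullet> b)" using m by (simp add: square_integrable_def)
    show "\<bar>g s y \<bullet> b - g s z \<bullet> b\<bar> \<le> \<kappa> s * norm (y - z)"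
      if "s \<in> space \<mu>" "y \<in> cball c \<epsilon>" "z \<in> cball c \<epsilon>" for s y z
    proof -
      have "\<bar>g s y \<bullet> b - g s z \<bullet> b\<bar> = \<bar>(g s y - g s z) \<bullet> b\<bar>" by (simp add: inner_diff_left)
      also have "\<dots> \<le> norm (g s y - g s z)" by (rule Basis_le_norm[OF b])
      also have "\<dots> \<le> \<kappa> s * norm (y - z)" by (rule lip[OF that])
      finally show ?thesis .
    qed
  qed (use \<epsilon> in simp)
  have "AE \<omega> in P. \<forall>b\<in>(Basis::'a set). \<exists>C. eventually (\<lambda>N. \<forall>z\<in>cball c \<epsilon>.
     \<bar>sample_average (\<lambda>s y. g s y \<bullet> b) (\<lambda>i. \<xi> i \<omega>) N z - expected_fun \<mu> (\<lambda>s y. g s y \<bullet> b) z\<bar>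
       \<le> C * (ln (real N) / sqrt (real N))) sequentially"
    using rate by (subst AE_ball_countable) (auto intro: countable_finite)
  then have "AE \<omega> in P. \<exists>C G.
     (\<forall>y\<in>ball c \<epsilon>. \<forall>u\<in>ball c \<epsilon>. \<bar>expected_fun \<mu> \<phi> u - expected_fun \<mu> \<phi> y - G y \<bullet> (u - y)\<bar> \<le> C * (norm (u - y))\<^sup>2 \<and>
        norm (G u - G y) \<le> C * norm (u - y)) \<and>
     eventually (\<lambda>N. \<forall>z\<in>ball c \<epsilon>. \<forall>w.
       (\<forall>i\<in>{1..N}. w i \<in> clarke_subdifferential (\<lambda>y. ereal (\<phi> (\<xi> i \<omega>) y)) z) \<longrightarrow>
       norm ((1 / real N) *\<^sub>R (\<Sum>i=1..N. w i) - G z) \<le> C * (ln (real N) / sqrt (real N))) sequentially"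
    using AE_space
  proof eventually_elim
    case (elim \<omega>)
    obtain C where C: "\<And>b. b \<in> Basis \<Longrightarrow> eventually (\<lambda>N. \<forall>z\<in>cball c \<epsilon>.
     \<bar>sample_average (\<lambda>s y. g s y \<bullet> b) (\<lambda>i. \<xi> i \<omega>) N z - expected_fun \<mu> (\<lambda>s y. g s y \<bullet> b) z\<bar>
       \<le> C b * (ln (real N) / sqrt (real N))) sequentially"
      using bchoice[OF elim(1)] by blast
    define C1 where "C1 = max C0 (\<Sum>b\<in>Basis. C b)"
    have "eventually (\<lambda>N. \<forall>b\<in>(Basis::'a set). \<forall>z\<in>cball c \<epsilon>.
     \<bar>sample_average (\<lambda>s y. g s y \<bullet> b) (\<lambda>i. \<xi> i \<omega>) N z - expected_fun \<mu> (\<lambda>s y. g s y \<bullet> b) z\<bar>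
       \<le> C b * (ln (real N) / sqrt (real N))) sequentially"
      using C by (intro eventually_ball_finite) auto
    then have ev: "eventually (\<lambda>N. \<forall>z\<in>ball c \<epsilon>. \<forall>w.
       (\<forall>i\<in>{1..N}. w i \<in> clarke_subdifferential (\<lambda>y. ereal (\<phi> (\<xi> i \<omega>) y)) z) \<longrightarrow>
       norm ((1 / real N) *\<^sub>R (\<Sum>i=1..N. w i) - G z) \<le> C1 * (ln (real N) / sqrt (real N))) sequentially"
      using eventually_ge_at_top[of 1]
    proof (eventually_elim, intro ballI allI impI)
      fix N :: nat and z and w :: "nat \<Rightarrow> 'a"
      assume *: "\<forall>b\<in>Basis. \<forall>z\<in>cball c \<epsilon>.
         \<bar>sample_average (\<lambda>s y. g s y \<bullet> b) (\<lambda>i. \<xi> i \<omega>) N z - expected_fun \<mu> (\<lambda>s y. g s y \<bullet> b) z\<bar>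
         \<le> C b * (ln (real N) / sqrt (real N))"
        and N: "1 \<le> N" and z: "z \<in> ball c \<epsilon>"
        and w: "\<forall>i\<in>{1..N}. w i \<in> clarke_subdifferential (\<lambda>y. ereal (\<phi> (\<xi> i \<omega>) y)) z"
      have zc: "z \<in> cball c \<epsilon>" using z by simp
      \<comment> \<open>The neighbourhood may depend on \<open>z\<close>, since the identification
        of the subgradients is made point by point.\<close>
      obtain V L where V: "open V" "z \<in> V" and q: "\<forall>s\<in>space \<mu>. \<forall>x\<in>V. \<forall>v\<in>clarke_subdifferential (\<lambda>y. ereal (\<phi> s y)) x. \<forall>y\<in>V.
           \<phi> s y \<le> \<phi> s x + v \<bullet> (y - x) + L s * (norm (y - x))\<^sup>2"
        using uc[of z] unfolding upper_C2_around_def by blast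
      have wg: "w i = g (\<xi> i \<omega>) z" if i: "i \<in> {1..N}" for i
      proof -
        have s: "\<xi> i \<omega> \<in> space \<mu>" using sample_in_space[OF _ elim(2)] i by simp
        show ?thesis unfolding g_def
          by (rule quadratic_supergradient_eq_gradient[OF V d[OF s zc], where L = "L (\<xi> i \<omega>)"])
             (use q s w i V(2) in blast)
      qed
      define M where "M = (1 / real N) *\<^sub>R (\<Sum>i=1..N. w i)"
      have "norm (M - G z) \<le> (\<Sum>b\<in>Basis. \<bar>(M - G z) \<bullet> b\<bar>)" by (rule norm_le_l1)
      also have "\<dots> \<le> (\<Sum>b\<in>Basis. C b * (ln (real N) / sqrt (real N)))"
      proof (rule sum_mono)
        fix b :: 'a assume b: "b \<in> Basis"
        have "M \<bullet> b = sample_average (\<lambda>s y. g s y \<bullet> b) (\<lambda>i. \<xi> i \<omega>) N z"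
          unfolding M_def sample_average_def by (simp add: inner_sum_left wg)
        moreover have "G z \<bullet> b = expected_fun \<mu> (\<lambda>s y. g s y \<bullet> b) z"
          using gi[OF zc] by (simp add: G_def expected_fun_def)
        ultimately show "\<bar>(M - G z) \<bullet> b\<bar> \<le> C b * (ln (real N) / sqrt (real N))"
          using * b zc by (simp add: inner_diff_left)
      qed
      also have "\<dots> = (\<Sum>b\<in>Basis. C b) * (ln (real N) / sqrt (real N))" by (simp only: sum_distrib_right)
      also have "\<dots> \<le> C1 * (ln (real N) / sqrt (real N))"
        using N by (intro mult_right_mono) (auto simp: C1_def)
      finally show "norm ((1 / real N) *\<^sub>R (\<Sum>i=1..N. w i) - G z) \<le> C1 * (ln (real N) / sqrt (real N))"
        by (simp only: M_def)
    qed
    show ?case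
    proof (intro exI[of _ C1] exI[of _ G] conjI ballI ev)
      fix y u assume yu: "y \<in> ball c \<epsilon>" "u \<in> ball c \<epsilon>"
      have c01: "C0 \<le> C1" by (simp add: C1_def)
      show "\<bar>expected_fun \<mu> \<phi> u - expected_fun \<mu> \<phi> y - G y \<bullet> (u - y)\<bar> \<le> C1 * (norm (u - y))\<^sup>2"
        using yu by (intro order_trans[OF taylor mult_right_mono[OF c01]]) auto
      show "norm (G u - G y) \<le> C1 * norm (u - y)"
        using yu by (intro order_trans[OF Glip mult_right_mono[OF c01]]) auto
    qed
  qed
  then show ?thesis using \<epsilon> by (intro exI[of _ "ball c \<epsilon>"]) simp
qed

end

section \<open>Transfer of the pathwise rates to the random iterates\<close>

theorem theorem4p9:
  fixes \<mu> :: "'s measure" and P :: "'o measure"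
    and \<phi> :: "'s \<Rightarrow> 'a::euclidean_space \<Rightarrow> real"
    and \<psi> \<Phi> :: "'a \<Rightarrow> ereal"
    and \<xi> :: "nat \<Rightarrow> 'o \<Rightarrow> 's"
    and n :: "nat \<Rightarrow> nat"
    and F :: "nat \<Rightarrow> 'o measure"
    and x :: "nat \<Rightarrow> 'o \<Rightarrow> 'a" and x0 :: 'a
    and \<rho> \<sigma> \<gamma>min \<beta> q :: real
  defines "\<Phi> \<equiv> composite (expected_fun \<mu> \<phi>) \<psi>"
  assumes "prob_space \<mu>" and "prob_space P"
    and "proper_fun \<psi>" and "lower_semicontinuous \<psi>" and "prox_bounded \<psi>"
    and "upper_C2_normal_integrand \<mu> \<phi>"
    and "ereal_integrable \<mu> (\<lambda>s. INF y. ereal (\<phi> s y) + \<psi> y)"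
    and "C11_around_set \<mu> \<phi> (stationary_points (expected_fun \<mu> \<phi>) \<psi>)"
    and "0 < \<beta>" and "\<beta> < 1"
    and "mono n" and "\<forall>k. 0 < n k" and "filterlim n at_top sequentially"
    and "(2 + 2 * \<beta>) / \<beta> < q"
    and "(\<lambda>k. inverse (real (n k))) \<in> O(\<lambda>k. real k powr (- q))"
    and "summable (\<lambda>k. sample_error n (Suc k))"
    and "iid_samples P \<mu> \<xi>"
    and "sampling_filtration P \<mu> \<xi> n x F"
    and "0 < \<rho>" and "\<rho> < 1" and "0 < \<sigma>" and "0 < \<gamma>min"
    and "\<Phi> x0 < \<infinity>"
    and "\<forall>\<omega>\<in>space P. PSS_sequence \<phi> \<psi> n \<rho> \<sigma> \<gamma>min x0 (\<lambda>i. \<xi> i \<omega>) (\<lambda>k. x k \<omega>)"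
  shows "\<exists>\<Omega>hat\<in>sets P. measure P (space P - \<Omega>hat) = 0 \<and>
    (\<forall>\<omega>\<in>\<Omega>hat. \<forall>xbar M \<eta> p0.
      let X = (\<lambda>k. x k \<omega>);
          \<theta> = (\<lambda>t. M * t powr (1 - \<beta>));
          tail = (\<lambda>k. \<Sum>t. sample_error n (k + t));
          gap = (\<lambda>k. real_of_ereal (\<Phi> (X k) - \<Phi> xbar));
          err = (\<lambda>k. norm (X k - xbar))
      in
        bounded (range X) \<and>
        (\<exists>r. strict_mono r \<and> (X \<circ> r) \<longlonglongrightarrow> xbar) \<and>
        0 < M \<and> KL_condition \<Phi> xbar \<theta> \<eta> \<and>
        (\<forall>k\<ge>p0. 0 < tail k \<and> tail k < \<eta>) \<and>
        summable (\<lambda>k. inverse (deriv \<theta> (tail (p0 + k)))) \<and>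
        (\<forall>k\<ge>p0. \<Phi> (X k) > \<Phi> xbar)
      \<longrightarrow>
        X \<longlonglongrightarrow> xbar \<and>
        (\<beta> \<le> 1 / 2 \<longrightarrow>
           gap \<in> O(\<lambda>k. ln (real k) / real k powr (q / 2 - 1)) \<and>
           err \<in> O(\<lambda>k. ln (real k) / real k powr (1 / 2 * (q / 2 - 1) - 1))) \<and>
        (1 / 2 < \<beta> \<longrightarrow>
           (q \<le> 4 * \<beta> / (2 * \<beta> - 1) \<longrightarrow>
              gap \<in> O(\<lambda>k. real k powr (- 2 * \<beta> * (q / 2 - 1) + 1) * ln (real k)) \<and>
              err \<in> O(\<lambda>k. real k powr (- \<beta> * (q / 2 - 1) + 1) * ln (real k))) \<and>
           (4 * \<beta> / (2 * \<beta> - 1) < q \<longrightarrow>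
              gap \<in> O(\<lambda>k. real k powr (- 2 * \<beta> / (2 * \<beta> - 1) + 1) * ln (real k)) \<and>
              err \<in> O(\<lambda>k. real k powr (- (1 - \<beta>) / (2 * \<beta> - 1)) * ln (real k) powr (1 - \<beta>)))))"
proof -
  interpret P: prob_space P by fact
  interpret M: prob_space \<mu> by fact
  interpret iid_sampling P \<mu> \<xi> by unfold_locales fact
  define E where "E = expected_fun \<mu> \<phi>"
  have \<Phi>: "\<Phi> = composite E \<psi>" by (simp add: \<Phi>_def E_def)
  have uc: "upper_C2_around \<mu> \<phi> y" for y
    using \<open>upper_C2_normal_integrand \<mu> \<phi>\<close> by (simp add: upper_C2_normal_integrand_def)
  then have sq: "sq_lipschitz_around \<mu> \<phi> y" for y by (simp add: upper_C2_around_def)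
  have c11: "C11_around \<mu> \<phi> y" if "y \<in> stationary_points E \<psi>" for y
    using \<open>C11_around_set \<mu> \<phi> (stationary_points (expected_fun \<mu> \<phi>) \<psi>)\<close> that
    by (simp add: C11_around_set_def E_def)
  have npos: "0 < n k" for k using \<open>\<forall>k. 0 < n k\<close> by simp
  have enn: "0 \<le> sample_error n k" for k
    using npos[of k] by (simp add: sample_error_def)
  have esum: "summable (sample_error n)"
    using \<open>summable (\<lambda>k. sample_error n (Suc k))\<close> by (simp only: summable_Suc_iff)
  have "0 < (2 + 2 * \<beta>) / \<beta>" using \<open>0 < \<beta>\<close> by simp
  then have "0 < q" using \<open>(2 + 2 * \<beta>) / \<beta> < q\<close> by linarith
  then obtain Ce where "eventually (\<lambda>k. sample_error n k \<le> Ce * (ln (real k) * real k powr - (q / 2))) sequentially"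
    using sample_error_rate[OF npos \<open>(\<lambda>k. inverse (real (n k))) \<in> O(\<lambda>k. real k powr (- q))\<close>] by blast
  then have e_rate: "sample_error n \<in> O(\<lambda>k. ln (real k) * real k powr - (q / 2))"
    by (rule upper_bound_imp_bigo) (simp add: enn)
  define rate where "rate \<omega> V \<longleftrightarrow> (\<exists>C. eventually (\<lambda>N. \<forall>y\<in>V.
     \<bar>sample_average \<phi> (\<lambda>i. \<xi> i \<omega>) N y - E y\<bar> \<le> C * (ln (real N) / sqrt (real N))) sequentially)" for \<omega> V
  define subgr where "subgr \<omega> N z w \<longleftrightarrow>
     (\<forall>i\<in>{1..N}. w i \<in> clarke_subdifferential (\<lambda>y. ereal (\<phi> (\<xi> i \<omega>) y)) z)"
    for \<omega> z and N :: nat and w :: "nat \<Rightarrow> 'a"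
  define upper where "upper \<omega> V \<longleftrightarrow> (\<exists>L. \<forall>N\<ge>1. \<forall>z\<in>V. \<forall>w. subgr \<omega> N z w \<longrightarrow>
     norm ((1 / real N) *\<^sub>R (\<Sum>i=1..N. w i)) \<le> L \<and>
     (\<forall>y\<in>V. sample_average \<phi> (\<lambda>i. \<xi> i \<omega>) N y \<le> sample_average \<phi> (\<lambda>i. \<xi> i \<omega>) N z
        + ((1 / real N) *\<^sub>R (\<Sum>i=1..N. w i)) \<bullet> (y - z) + L * (norm (y - z))\<^sup>2))" for \<omega> V
  define smooth where "smooth \<omega> V \<longleftrightarrow> (\<exists>C G.
     (\<forall>y\<in>V. \<forall>u\<in>V. \<bar>E u - E y - G y \<bullet> (u - y)\<bar> \<le> C * (norm (u - y))\<^sup>2 \<and>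
        norm (G u - G y) \<le> C * norm (u - y)) \<and>
     eventually (\<lambda>N. \<forall>z\<in>V. \<forall>w. subgr \<omega> N z w \<longrightarrow>
       norm ((1 / real N) *\<^sub>R (\<Sum>i=1..N. w i) - G z) \<le> C * (ln (real N) / sqrt (real N))) sequentially)" for \<omega> V
  have 1: "AE \<omega> in P. \<forall>c\<in>UNIV. \<exists>V. open V \<and> c \<in> V \<and> rate \<omega> V"
    unfolding rate_def E_def by (rule AE_open_cover, rule local_function_rate[OF sq])
  have 2: "AE \<omega> in P. \<forall>c\<in>UNIV. \<exists>V. open V \<and> c \<in> V \<and> upper \<omega> V"
    unfolding upper_def subgr_def by (rule AE_open_cover, rule local_sample_upper_C2[OF uc])
  have 3: "AE \<omega> in P. \<forall>c\<in>stationary_points E \<psi>. \<exists>V. open V \<and> c \<in> V \<and> smooth \<omega> V"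
    unfolding smooth_def subgr_def E_def
    by (rule AE_open_cover, rule local_gradient_rate[OF uc c11]) (simp add: E_def)
  define good where "good \<omega> \<longleftrightarrow> (\<forall>c. \<exists>V. open V \<and> c \<in> V \<and> rate \<omega> V) \<and>
    (\<forall>c. \<exists>V. open V \<and> c \<in> V \<and> upper \<omega> V) \<and>
    (\<forall>c\<in>stationary_points E \<psi>. \<exists>V. open V \<and> c \<in> V \<and> smooth \<omega> V)" for \<omega>
  have "AE \<omega> in P. good \<omega>" using 1 2 3 by eventually_elim (simp add: good_def)
  \<comment> \<open>The outcomes that are not good need not form a measurable set; the required
    event is the complement of a measurable null set containing them.\<close>
  then obtain Z where Z: "Z \<in> null_sets P" "{\<omega>\<in>space P. \<not> good \<omega>} \<subseteq> Z"
    unfolding eventually_ae_filter by (elim bexE) (rule that)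
  define concl where "concl gap err \<longleftrightarrow>
        (\<beta> \<le> 1 / 2 \<longrightarrow>
           gap \<in> O(\<lambda>k. ln (real k) / real k powr (q / 2 - 1)) \<and>
           err \<in> O(\<lambda>k. ln (real k) / real k powr (1 / 2 * (q / 2 - 1) - 1))) \<and>
        (1 / 2 < \<beta> \<longrightarrow>
           (q \<le> 4 * \<beta> / (2 * \<beta> - 1) \<longrightarrow>
              gap \<in> O(\<lambda>k. real k powr (- 2 * \<beta> * (q / 2 - 1) + 1) * ln (real k)) \<and>
              err \<in> O(\<lambda>k. real k powr (- \<beta> * (q / 2 - 1) + 1) * ln (real k))) \<and>
           (4 * \<beta> / (2 * \<beta> - 1) < q \<longrightarrow>
              gap \<in> O(\<lambda>k. real k powr (- 2 * \<beta> / (2 * \<beta> - 1) + 1) * ln (real k)) \<and>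
              err \<in> O(\<lambda>k. real k powr (- (1 - \<beta>) / (2 * \<beta> - 1)) * ln (real k) powr (1 - \<beta>))))"
    for gap err :: "nat \<Rightarrow> real"
  have path: "X \<longlonglongrightarrow> xbar \<and>
      concl (\<lambda>k. real_of_ereal (\<Phi> (X k) - \<Phi> xbar)) (\<lambda>k. norm (X k - xbar))"
    if \<omega>: "\<omega> \<in> space P - Z" and X: "X = (\<lambda>k. x k \<omega>)" and bdd: "bounded (range X)"
      and r: "strict_mono r" "(X \<circ> r) \<longlonglongrightarrow> xbar" and M: "0 < M"
      and KL: "KL_condition \<Phi> xbar (\<lambda>t. M * t powr (1 - \<beta>)) \<eta>"
      and pos: "\<forall>k\<ge>p0. \<Phi> (X k) > \<Phi> xbar" for \<omega> X xbar M \<eta> p0 r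
  proof -
    have "good \<omega>" using Z(2) \<omega> by blast
    note good = this[unfolded good_def, THEN conjunct1] this[unfolded good_def, THEN conjunct2, THEN conjunct1]
      this[unfolded good_def, THEN conjunct2, THEN conjunct2]
    have pss: "PSS_sequence \<phi> \<psi> n \<rho> \<sigma> \<gamma>min x0 (\<lambda>i. \<xi> i \<omega>) X"
      unfolding X using \<open>\<forall>\<omega>\<in>space P. PSS_sequence \<phi> \<psi> n \<rho> \<sigma> \<gamma>min x0 (\<lambda>i. \<xi> i \<omega>) (\<lambda>k. x k \<omega>)\<close> \<omega> by simp
    define Es where "Es k = sample_average \<phi> (\<lambda>i. \<xi> i \<omega>) (n k)" for k
    define mean where "mean k w = (1 / real (n k)) *\<^sub>R (\<Sum>i=1..n k. w i)" for k and w :: "nat \<Rightarrow> 'a"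
    \<comment> \<open>Subgradients and initial step size of each iteration are selected together, as
      one pair, for the fixed outcome.\<close>
    have "\<forall>k. \<exists>wg. subgr \<omega> (n k) (X k) (fst wg) \<and> \<gamma>min \<le> snd wg \<and>
        PSS_linesearch (composite (Es k) \<psi>) \<psi> \<rho> \<sigma> (snd wg) (X k) (mean k (fst wg)) (X (Suc k))"
    proof
      fix k
      obtain w g where "subgr \<omega> (n k) (X k) w \<and> \<gamma>min \<le> g \<and>
        PSS_linesearch (composite (Es k) \<psi>) \<psi> \<rho> \<sigma> g (X k) (mean k w) (X (Suc k))"
        using pss unfolding PSS_sequence_def subgr_def Es_def mean_def by blast
      then show "\<exists>wg. subgr \<omega> (n k) (X k) (fst wg) \<and> \<gamma>min \<le> snd wg \<and>
        PSS_linesearch (composite (Es k) \<psi>) \<psi> \<rho> \<sigma> (snd wg) (X k) (mean k (fst wg)) (X (Suc k))"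
        by (intro exI[of _ "(w, g)"]) simp
    qed
    from choice[OF this] obtain wg where wg: "subgr \<omega> (n k) (X k) (fst (wg k))" "\<gamma>min \<le> snd (wg k)"
        "PSS_linesearch (composite (Es k) \<psi>) \<psi> \<rho> \<sigma> (snd (wg k)) (X k) (mean k (fst (wg k))) (X (Suc k))" for k
      by blast
    define v where "v k = mean k (fst (wg k))" for k
    define g where "g k = snd (wg k)" for k
    have path: "pss_path E Es \<psi> X v g (sample_error n) \<rho> \<sigma> \<gamma>min xbar r"
    proof
      show "\<exists>V \<kappa>. open V \<and> c \<in> V \<and> (\<forall>y\<in>V. \<forall>z\<in>V. \<bar>E y - E z\<bar> \<le> \<kappa> * norm (y - z))" for c
        unfolding E_def by (rule expected_fun_locally_lipschitz[OF sq])
      show "\<exists>V C. open V \<and> c \<in> V \<and> eventually (\<lambda>k. \<forall>y\<in>V. \<bar>Es k y - E y\<bar> \<le> C * sample_error n k) sequentially" for c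
      proof -
        obtain V C where V: "open V" "c \<in> V" and ev: "eventually (\<lambda>N. \<forall>y\<in>V.
          \<bar>sample_average \<phi> (\<lambda>i. \<xi> i \<omega>) N y - E y\<bar> \<le> C * (ln (real N) / sqrt (real N))) sequentially"
          using good(1)[rule_format, of c] unfolding rate_def by blast
        \<comment> \<open>The rates hold for averages of all large sample numbers \<open>N\<close>;
          they are read along \<open>N = n k\<close>, which tends to infinity.\<close>
        have "eventually (\<lambda>k. \<forall>y\<in>V. \<bar>Es k y - E y\<bar> \<le> C * sample_error n k) sequentially"
          using eventually_compose_filterlim[OF ev \<open>filterlim n at_top sequentially\<close>]
          by (simp add: Es_def sample_error_def)
        then show ?thesis using V by blast
      qed
      show "\<exists>V L. open V \<and> c \<in> V \<and> (\<forall>k. X k \<in> V \<longrightarrow> norm (v k) \<le> L \<and>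
        (\<forall>y\<in>V. Es k y \<le> Es k (X k) + v k \<bullet> (y - X k) + L * (norm (y - X k))\<^sup>2))" for c
      proof -
        obtain V L where V: "open V" "c \<in> V" and L: "\<forall>N\<ge>1. \<forall>z\<in>V. \<forall>w. subgr \<omega> N z w \<longrightarrow>
           norm ((1 / real N) *\<^sub>R (\<Sum>i=1..N. w i)) \<le> L \<and>
           (\<forall>y\<in>V. sample_average \<phi> (\<lambda>i. \<xi> i \<omega>) N y \<le> sample_average \<phi> (\<lambda>i. \<xi> i \<omega>) N z
              + ((1 / real N) *\<^sub>R (\<Sum>i=1..N. w i)) \<bullet> (y - z) + L * (norm (y - z))\<^sup>2)"
          using good(2)[rule_format, of c] unfolding upper_def by blast
        have "norm (v k) \<le> L \<and> (\<forall>y\<in>V. Es k y \<le> Es k (X k) + v k \<bullet> (y - X k) + L * (norm (y - X k))\<^sup>2)"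
          if "X k \<in> V" for k
        proof -
          have "1 \<le> n k" using npos[of k] by simp
          from L[rule_format, OF this that wg(1)] show ?thesis
            unfolding v_def mean_def Es_def by simp
        qed
        then show ?thesis using V by blast
      qed
      show "\<exists>V C G. open V \<and> c \<in> V \<and>
        (\<forall>y\<in>V. \<forall>u\<in>V. \<bar>E u - E y - G y \<bullet> (u - y)\<bar> \<le> C * (norm (u - y))\<^sup>2 \<and>
           norm (G u - G y) \<le> C * norm (u - y)) \<and>
        eventually (\<lambda>k. X k \<in> V \<longrightarrow> norm (v k - G (X k)) \<le> C * sample_error n k) sequentially"
        if c: "c \<in> stationary_points E \<psi>" for c
      proof -
        obtain V C G where V: "open V" "c \<in> V" and G: "\<forall>y\<in>V. \<forall>u\<in>V. \<bar>E u - E y - G y \<bullet> (u - y)\<bar> \<le> C * (norm (u - y))\<^sup>2 \<and>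
           norm (G u - G y) \<le> C * norm (u - y)"
          and ev: "eventually (\<lambda>N. \<forall>z\<in>V. \<forall>w. subgr \<omega> N z w \<longrightarrow>
           norm ((1 / real N) *\<^sub>R (\<Sum>i=1..N. w i) - G z) \<le> C * (ln (real N) / sqrt (real N))) sequentially"
          using good(3)[rule_format, OF c] unfolding smooth_def by blast
        have "eventually (\<lambda>k. X k \<in> V \<longrightarrow> norm (v k - G (X k)) \<le> C * sample_error n k) sequentially"
          using eventually_compose_filterlim[OF ev \<open>filterlim n at_top sequentially\<close>]
        proof eventually_elim
          case (elim k)
          show ?case using elim wg(1)[of k] by (simp add: v_def mean_def sample_error_def)
        qed
        then show ?thesis using V G by blast
      qed
      show "PSS_linesearch (composite (Es k) \<psi>) \<psi> \<rho> \<sigma> (g k) (X k) (v k) (X (Suc k))" for k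
        unfolding v_def g_def by (rule wg)
      show "\<gamma>min \<le> g k" for k unfolding g_def by (rule wg)
      have "X 0 = x0" using pss by (simp add: PSS_sequence_def)
      then show "\<psi> (X 0) < \<infinity>"
        using \<open>\<Phi> x0 < \<infinity>\<close> unfolding \<Phi> composite_def by (cases "\<psi> x0") auto
    qed (fact enn esum bdd r \<open>proper_fun \<psi>\<close> \<open>lower_semicontinuous \<psi>\<close> \<open>prox_bounded \<psi>\<close> \<open>0 < \<rho>\<close> \<open>\<rho> < 1\<close>
        \<open>0 < \<sigma>\<close> \<open>0 < \<gamma>min\<close>)+
    interpret pss_path E Es \<psi> X v g "sample_error n" \<rho> \<sigma> \<gamma>min xbar r by (rule path)
    have posc: "composite E \<psi> xbar < composite E \<psi> (X k)" if "k \<ge> p0" for k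
      using pos that unfolding \<Phi> by blast
    have "\<exists>c \<delta> A K. KL_descent X xbar gap (sample_error n) \<beta> \<sigma> A \<delta> c q K r"
      by (rule gap_KL_descent[where ?p0.0 = p0, OF KL[unfolded \<Phi>] M \<open>0 < \<beta>\<close> \<open>\<beta> < 1\<close> posc \<open>(2 + 2 * \<beta>) / \<beta> < q\<close> e_rate])
    then obtain c \<delta> A K where "KL_descent X xbar gap (sample_error n) \<beta> \<sigma> A \<delta> c q K r"
      by (elim exE) (rule that)
    then interpret KL_descent X xbar gap "sample_error n" \<beta> \<sigma> A \<delta> c q K r .
    have eq: "(\<lambda>k. real_of_ereal (\<Phi> (X k) - \<Phi> xbar)) = gap" unfolding \<Phi> by (rule ext) (rule gap_eq)
    show ?thesis unfolding eq concl_def using convergent rates by blast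
  qed
  have mZ: "measure P (space P - (space P - Z)) = 0"
  proof -
    have "space P - (space P - Z) = Z" using sets.sets_into_space[of Z P] Z(1) by auto
    then show ?thesis using Z(1) by (simp add: measure_def null_setsD1)
  qed
  show ?thesis
    unfolding Let_def concl_def[symmetric]
  proof (intro bexI[of _ "space P - Z"] conjI[OF mZ] ballI allI impI; (elim conjE exE)?)
    fix \<omega> xbar M \<eta> p0 r
    assume "\<omega> \<in> space P - Z" "bounded (range (\<lambda>k. x k \<omega>))" "strict_mono r" "((\<lambda>k. x k \<omega>) \<circ> r) \<longlonglongrightarrow> xbar"
      "0 < M" "KL_condition \<Phi> xbar (\<lambda>t. M * t powr (1 - \<beta>)) \<eta>" "\<forall>k\<ge>p0. \<Phi> xbar < \<Phi> (x k \<omega>)"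
    then show "(\<lambda>k. x k \<omega>) \<longlonglongrightarrow> xbar \<and>
        concl (\<lambda>k. real_of_ereal (\<Phi> (x k \<omega>) - \<Phi> xbar)) (\<lambda>k. norm (x k \<omega> - xbar))"
      by (rule path[OF _ refl])
  next
    show "space P - Z \<in> sets P" using Z(1) by auto
  qed
qed

end
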